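(* Let $\Lambda$ be a row-finite $k$-graph with no sources and let $K$ be a field. Then the Kumjian--Pask algebra $A=\mathrm{KP}_K(\Lambda)$, with its canonical $\mathbb{Z}^k$-grading, has the following properties: (1) any finitely generated right (left) graded ideal of $A$ is generated by one homogeneous idempotent; (2) any graded right (left) ideal of $A$ is idempotent; (3) any graded (two-sided) ideal of $A$ is graded semi-prime; (4) $J(A)=J^{\mathrm{gr}}(A)=0$; and (5) there is a one-to-one correspondence between the graded right (left) ideals of $A$ and the right (left) ideals of $A_0$, the homogeneous component of degree $0\in\mathbb{Z}^k$.
   Context: A $k$-graph is a countable category $\Lambda=(\Lambda^0,\Lambda,r,s)$ (objects identified with identity morphisms $\Lambda^0$; paths composed right to left, so $\lambda\mu$ is defined when $s(\lambda)=r(\mu)$) with a functor $d:\Lambda\to\mathbb{N}^k$ such that if $d(\lambda)=m+n$ there are unique $\mu,\nu\in\Lambda$ with $d(\mu)=m$, $d(\nu)=n$, $\lambda=\mu\nu$. For $v\in\Lambda^0$, $n\in\mathbb{N}^k$, $v\Lambda^n=r^{-1}(v)\cap d^{-1}(n)$. $\Lambda$ is row-finite if every $v\Lambda^n$ is finite, and has no sources if every $v\Lambda^n$ is nonempty. $\mathrm{KP}_K(\Lambda)$ is the $K$-algebra generated by $\Lambda\cup\Lambda^*$ ($\Lambda^*=\{\lambda^*:\lambda\in\Lambda\}$ formal symbols) subject to: (KP1) the elements of $\Lambda^0$ are mutually orthogonal idempotents and $v=v^*$ for $v\in\Lambda^0$; (KP2) for $\lambda,\mu\in\Lambda$ with $r(\mu)=s(\lambda)$,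 the product $\lambda\mu$ equals the composite $\lambda\circ\mu$, $\mu^*\lambda^*=(\lambda\circ\mu)^*$, $r(\lambda)\lambda=\lambda=\lambda s(\lambda)$, $s(\lambda)\lambda^*=\lambda^*=\lambda^*r(\lambda)$; (KP3) $\lambda^*\mu=\delta_{\lambda,\mu}s(\lambda)$ whenever $d(\lambda)=d(\mu)$; (KP4) $v=\sum_{\lambda\in v\Lambda^n}\lambda\lambda^*$ for all $v\in\Lambda^0$, $n\in\mathbb{N}^k\setminus\{0\}$. It is $\mathbb{Z}^k$-graded with $\lambda\mu^*$ (for $s(\lambda)=s(\mu)$) homogeneous of degree $d(\lambda)-d(\mu)$; it need not be unital but has graded local units. A (left, right, two-sided) ideal is graded if it is generated, as an additive group, by its homogeneous elements. A one-sided ideal $I$ is idempotent if $I^2=I$. A graded ideal $I$ is graded semi-prime if for every graded two-sided ideal $J$, $J^2\subseteq I$ implies $J\subseteq I$. $J(A)$ is the Jacobson radical and $J^{\mathrm{gr}}(A)$ the graded Jacobson radical (the intersection of the annihilators of all graded simple unital left $A$-modules). *)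

theory Defs
  imports
    "HOL-Algebra.Algebra"
    "HOL-Analysis.Finite_Cartesian_Product"
    "HOL-Library.Poly_Mapping"
begin

section \<open>Higher-rank graphs\<close>

text \<open>
  Only the elements of \<open>Mor\<close> are paths; objects are identified with their identity
  morphisms.  \<open>cmp \<Lambda> \<alpha> \<beta>\<close> is the right-to-left composite, meaningful when
  \<open>src \<Lambda> \<alpha> = rng \<Lambda> \<beta>\<close>.  The rank is the cardinality of the finite index type \<open>'k\<close>.
\<close>

record ('a, 'k::finite) kgraph =
  Mor :: "'a set"
  Obj :: "'a set"
  rng :: "'a \<Rightarrow> 'a"
  src :: "'a \<Rightarrow> 'a"
  cmp :: "'a \<Rightarrow> 'a \<Rightarrow> 'a"
  deg :: "'a \<Rightarrow> nat ^ 'k"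

locale k_graph =
  fixes \<Lambda> :: "('a, 'k::finite) kgraph"
  assumes countable_Mor: "countable (Mor \<Lambda>)"
    and Obj_subset: "Obj \<Lambda> \<subseteq> Mor \<Lambda>"
    and rng_Obj: "\<alpha> \<in> Mor \<Lambda> \<Longrightarrow> rng \<Lambda> \<alpha> \<in> Obj \<Lambda>"
    and src_Obj: "\<alpha> \<in> Mor \<Lambda> \<Longrightarrow> src \<Lambda> \<alpha> \<in> Obj \<Lambda>"
    and rng_id: "v \<in> Obj \<Lambda> \<Longrightarrow> rng \<Lambda> v = v"
    and src_id: "v \<in> Obj \<Lambda> \<Longrightarrow> src \<Lambda> v = v"
    and cmp_closed: "\<lbrakk>\<alpha> \<in> Mor \<Lambda>; \<beta> \<in> Mor \<Lambda>; src \<Lambda> \<alpha> = rng \<Lambda> \<beta>\<rbrakk> \<Longrightarrow> cmp \<Lambda> \<alpha> \<beta> \<in> Mor \<Lambda>"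
    and rng_cmp: "\<lbrakk>\<alpha> \<in> Mor \<Lambda>; \<beta> \<in> Mor \<Lambda>; src \<Lambda> \<alpha> = rng \<Lambda> \<beta>\<rbrakk> \<Longrightarrow> rng \<Lambda> (cmp \<Lambda> \<alpha> \<beta>) = rng \<Lambda> \<alpha>"
    and src_cmp: "\<lbrakk>\<alpha> \<in> Mor \<Lambda>; \<beta> \<in> Mor \<Lambda>; src \<Lambda> \<alpha> = rng \<Lambda> \<beta>\<rbrakk> \<Longrightarrow> src \<Lambda> (cmp \<Lambda> \<alpha> \<beta>) = src \<Lambda> \<beta>"
    and cmp_assoc: "\<lbrakk>\<alpha> \<in> Mor \<Lambda>; \<beta> \<in> Mor \<Lambda>; \<gamma> \<in> Mor \<Lambda>; src \<Lambda> \<alpha> = rng \<Lambda> \<beta>; src \<Lambda> \<beta> = rng \<Lambda> \<gamma>\<rbrakk>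
           \<Longrightarrow> cmp \<Lambda> (cmp \<Lambda> \<alpha> \<beta>) \<gamma> = cmp \<Lambda> \<alpha> (cmp \<Lambda> \<beta> \<gamma>)"
    and cmp_id_left: "\<alpha> \<in> Mor \<Lambda> \<Longrightarrow> cmp \<Lambda> (rng \<Lambda> \<alpha>) \<alpha> = \<alpha>"
    and cmp_id_right: "\<alpha> \<in> Mor \<Lambda> \<Longrightarrow> cmp \<Lambda> \<alpha> (src \<Lambda> \<alpha>) = \<alpha>"
    and deg_id: "v \<in> Obj \<Lambda> \<Longrightarrow> deg \<Lambda> v = 0"
    and deg_cmp: "\<lbrakk>\<alpha> \<in> Mor \<Lambda>; \<beta> \<in> Mor \<Lambda>; src \<Lambda> \<alpha> = rng \<Lambda> \<beta>\<rbrakk>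
           \<Longrightarrow> deg \<Lambda> (cmp \<Lambda> \<alpha> \<beta>) = deg \<Lambda> \<alpha> + deg \<Lambda> \<beta>"
    and factorization: "\<lbrakk>\<alpha> \<in> Mor \<Lambda>; deg \<Lambda> \<alpha> = m + n\<rbrakk>
           \<Longrightarrow> \<exists>!(\<beta>, \<gamma>). \<beta> \<in> Mor \<Lambda> \<and> \<gamma> \<in> Mor \<Lambda> \<and> src \<Lambda> \<beta> = rng \<Lambda> \<gamma> \<and>
                 deg \<Lambda> \<beta> = m \<and> deg \<Lambda> \<gamma> = n \<and> \<alpha> = cmp \<Lambda> \<beta> \<gamma>"

definition paths_into :: "('a, 'k::finite) kgraph \<Rightarrow> 'a \<Rightarrow> nat ^ 'k \<Rightarrow> 'a set" where
  "paths_into \<Lambda> v n = {\<alpha> \<in> Mor \<Lambda>. rng \<Lambda> \<alpha> = v \<and> deg \<Lambda> \<alpha> = n}"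

definition row_finite :: "('a, 'k::finite) kgraph \<Rightarrow> bool" where
  "row_finite \<Lambda> \<longleftrightarrow> (\<forall>v \<in> Obj \<Lambda>. \<forall>n. finite (paths_into \<Lambda> v n))"

definition no_sources :: "('a, 'k::finite) kgraph \<Rightarrow> bool" where
  "no_sources \<Lambda> \<longleftrightarrow> (\<forall>v \<in> Obj \<Lambda>. \<forall>n. paths_into \<Lambda> v n \<noteq> {})"

definition deg_diff :: "nat ^ 'k \<Rightarrow> nat ^ 'k \<Rightarrow> int ^ 'k" where
  "deg_diff m n = (\<chi> i. int (m $ i) - int (n $ i))"


section \<open>Ideals of rings without unit\<close>

text \<open>
  Rings need not be unital here: the field \<open>one\<close> of the ring records is a dummy that
  nothing below refers to, and the unital locales \<^locale>\<open>ring\<close> and \<^locale>\<open>ideal\<close> do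
  not apply.
\<close>

definition right_ideal :: "('x, 'b) ring_scheme \<Rightarrow> 'x set \<Rightarrow> bool" where
  "right_ideal A I \<longleftrightarrow> additive_subgroup I A \<and> (\<forall>x \<in> I. \<forall>a \<in> carrier A. x \<otimes>\<^bsub>A\<^esub> a \<in> I)"

definition left_ideal :: "('x, 'b) ring_scheme \<Rightarrow> 'x set \<Rightarrow> bool" where
  "left_ideal A I \<longleftrightarrow> additive_subgroup I A \<and> (\<forall>x \<in> I. \<forall>a \<in> carrier A. a \<otimes>\<^bsub>A\<^esub> x \<in> I)"

definition twosided_ideal :: "('x, 'b) ring_scheme \<Rightarrow> 'x set \<Rightarrow> bool" where
  "twosided_ideal A I \<longleftrightarrow> right_ideal A I \<and> left_ideal A I"

definition right_ideal_gen :: "('x, 'b) ring_scheme \<Rightarrow> 'x set \<Rightarrow> 'x set" where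
  "right_ideal_gen A S = \<Inter>{I. right_ideal A I \<and> S \<subseteq> I}"

definition left_ideal_gen :: "('x, 'b) ring_scheme \<Rightarrow> 'x set \<Rightarrow> 'x set" where
  "left_ideal_gen A S = \<Inter>{I. left_ideal A I \<and> S \<subseteq> I}"

definition scalar_closed :: "('f, 'x, 'b) module_scheme \<Rightarrow> 'x set \<Rightarrow> bool" where
  "scalar_closed A I \<longleftrightarrow> (\<forall>c. \<forall>x \<in> I. c \<odot>\<^bsub>A\<^esub> x \<in> I)"

definition algebra_ideal_gen :: "('f, 'x, 'b) module_scheme \<Rightarrow> 'x set \<Rightarrow> 'x set" where
  "algebra_ideal_gen A S = \<Inter>{I. twosided_ideal A I \<and> scalar_closed A I \<and> S \<subseteq> I}"

definition linear_span :: "('f, 'x, 'b) module_scheme \<Rightarrow> 'x set \<Rightarrow> 'x set" where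
  "linear_span A S = \<Inter>{V. additive_subgroup V A \<and> scalar_closed A V \<and> S \<subseteq> V}"


section \<open>The free algebra on paths and ghost paths\<close>

datatype 'a kp_gen = Path 'a | Ghost 'a

text \<open>Words are wrapped so that concatenation provides the monoid structure underlying the
  convolution product of \<open>'a word \<Rightarrow>\<^sub>0 'f::field\<close>.\<close>

datatype 'g word = Word (letters: "'g list")

instantiation word :: (type) monoid_add
begin

definition zero_word :: "'a word" where "zero_word = Word []"

definition plus_word :: "'a word \<Rightarrow> 'a word \<Rightarrow> 'a word" where
  "plus_word u w = Word (letters u @ letters w)"

instance
  by standard (simp_all add: zero_word_def plus_word_def)

end

type_synonym ('a, 'f) free_elem = "'a kp_gen word \<Rightarrow>\<^sub>0 'f"

text \<open>The free non-unital algebra: the empty word is excluded.\<close>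

definition free_algebra :: "('a, 'k::finite) kgraph \<Rightarrow> ('f::field, ('a, 'f) free_elem) module" where
  "free_algebra \<Lambda> =
     \<lparr>carrier = {p. \<forall>w \<in> Poly_Mapping.keys p.
                   letters w \<noteq> [] \<and> set (letters w) \<subseteq> Path ` Mor \<Lambda> \<union> Ghost ` Mor \<Lambda>},
      monoid.mult = (*), one = undefined, ring.zero = 0, add = (+),
      smult = (\<lambda>c. Poly_Mapping.map ((*) c))\<rparr>"

definition pth :: "'a \<Rightarrow> ('a, 'f::field) free_elem" where
  "pth \<alpha> = Poly_Mapping.single (Word [Path \<alpha>]) 1"

definition gst :: "'a \<Rightarrow> ('a, 'f::field) free_elem" where
  "gst \<alpha> = Poly_Mapping.single (Word [Ghost \<alpha>]) 1"

text \<open>Each relation \<open>x = y\<close> is represented by the element \<open>x - y\<close>.\<close>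

inductive_set kp_relations :: "('a, 'k::finite) kgraph \<Rightarrow> ('a, 'f::field) free_elem set"
  for \<Lambda> :: "('a, 'k) kgraph"
where
  KP1_orth: "\<lbrakk>v \<in> Obj \<Lambda>; w \<in> Obj \<Lambda>\<rbrakk>
     \<Longrightarrow> pth v * pth w - (if v = w then pth v else 0) \<in> kp_relations \<Lambda>"
| KP1_star: "v \<in> Obj \<Lambda> \<Longrightarrow> pth v - gst v \<in> kp_relations \<Lambda>"
| KP2_path: "\<lbrakk>\<alpha> \<in> Mor \<Lambda>; \<beta> \<in> Mor \<Lambda>; rng \<Lambda> \<beta> = src \<Lambda> \<alpha>\<rbrakk>
     \<Longrightarrow> pth \<alpha> * pth \<beta> - pth (cmp \<Lambda> \<alpha> \<beta>) \<in> kp_relations \<Lambda>"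
| KP2_ghost: "\<lbrakk>\<alpha> \<in> Mor \<Lambda>; \<beta> \<in> Mor \<Lambda>; rng \<Lambda> \<beta> = src \<Lambda> \<alpha>\<rbrakk>
     \<Longrightarrow> gst \<beta> * gst \<alpha> - gst (cmp \<Lambda> \<alpha> \<beta>) \<in> kp_relations \<Lambda>"
| KP2_rng_path: "\<alpha> \<in> Mor \<Lambda> \<Longrightarrow> pth (rng \<Lambda> \<alpha>) * pth \<alpha> - pth \<alpha> \<in> kp_relations \<Lambda>"
| KP2_path_src: "\<alpha> \<in> Mor \<Lambda> \<Longrightarrow> pth \<alpha> * pth (src \<Lambda> \<alpha>) - pth \<alpha> \<in> kp_relations \<Lambda>"
| KP2_src_ghost: "\<alpha> \<in> Mor \<Lambda> \<Longrightarrow> pth (src \<Lambda> \<alpha>) * gst \<alpha> - gst \<alpha> \<in> kp_relations \<Lambda>"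
| KP2_ghost_rng: "\<alpha> \<in> Mor \<Lambda> \<Longrightarrow> gst \<alpha> * pth (rng \<Lambda> \<alpha>) - gst \<alpha> \<in> kp_relations \<Lambda>"
| KP3: "\<lbrakk>\<alpha> \<in> Mor \<Lambda>; \<beta> \<in> Mor \<Lambda>; deg \<Lambda> \<alpha> = deg \<Lambda> \<beta>\<rbrakk>
     \<Longrightarrow> gst \<alpha> * pth \<beta> - (if \<alpha> = \<beta> then pth (src \<Lambda> \<alpha>) else 0) \<in> kp_relations \<Lambda>"
| KP4: "\<lbrakk>v \<in> Obj \<Lambda>; n \<noteq> 0\<rbrakk>
     \<Longrightarrow> pth v - (\<Sum>\<alpha> \<in> paths_into \<Lambda> v n. pth \<alpha> * gst \<alpha>) \<in> kp_relations \<Lambda>"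


section \<open>The Kumjian--Pask algebra and its grading\<close>

type_synonym ('a, 'f) kp_elem = "('a, 'f) free_elem set"

definition kp_ideal :: "('a, 'k::finite) kgraph \<Rightarrow> ('a, 'f::field) free_elem set" where
  "kp_ideal \<Lambda> = algebra_ideal_gen (free_algebra \<Lambda>) (kp_relations \<Lambda>)"

text \<open>\<^const>\<open>FactRing\<close> extended by the induced scalar multiplication of cosets.\<close>

definition KP :: "('a, 'k::finite) kgraph \<Rightarrow> ('f::field, ('a, 'f) kp_elem) module" where
  "KP \<Lambda> = ring.extend (free_algebra \<Lambda> Quot kp_ideal \<Lambda>)
     (module.fields (\<lambda>c C. \<Union>x \<in> C. kp_ideal \<Lambda> +>\<^bsub>free_algebra \<Lambda>\<^esub> (c \<odot>\<^bsub>free_algebra \<Lambda>\<^esub> x)))"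

definition kp_path :: "('a, 'k::finite) kgraph \<Rightarrow> 'a \<Rightarrow> ('a, 'f::field) kp_elem" where
  "kp_path \<Lambda> \<alpha> = kp_ideal \<Lambda> +>\<^bsub>free_algebra \<Lambda>\<^esub> pth \<alpha>"

definition kp_ghost :: "('a, 'k::finite) kgraph \<Rightarrow> 'a \<Rightarrow> ('a, 'f::field) kp_elem" where
  "kp_ghost \<Lambda> \<alpha> = kp_ideal \<Lambda> +>\<^bsub>free_algebra \<Lambda>\<^esub> gst \<alpha>"

definition KP_component :: "('a, 'k::finite) kgraph \<Rightarrow> int ^ 'k \<Rightarrow> ('a, 'f::field) kp_elem set" where
  "KP_component \<Lambda> n = linear_span (KP \<Lambda>)
     {kp_path \<Lambda> \<alpha> \<otimes>\<^bsub>KP \<Lambda>\<^esub> kp_ghost \<Lambda> \<beta> | \<alpha> \<beta>.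
        \<alpha> \<in> Mor \<Lambda> \<and> \<beta> \<in> Mor \<Lambda> \<and> src \<Lambda> \<alpha> = src \<Lambda> \<beta> \<and> deg_diff (deg \<Lambda> \<alpha>) (deg \<Lambda> \<beta>) = n}"


section \<open>Graded ideals, graded modules and radicals\<close>

text \<open>A grading is given by its family of homogeneous components.\<close>

definition homogeneous :: "('g \<Rightarrow> 'x set) \<Rightarrow> 'x set" where
  "homogeneous G = (\<Union>n. G n)"

definition graded_subgroup :: "('x, 'b) ring_scheme \<Rightarrow> ('g \<Rightarrow> 'x set) \<Rightarrow> 'x set \<Rightarrow> bool" where
  "graded_subgroup A G I \<longleftrightarrow> I = generate (add_monoid A) (I \<inter> homogeneous G)"

definition graded_right_ideal :: "('x, 'b) ring_scheme \<Rightarrow> ('g \<Rightarrow> 'x set) \<Rightarrow> 'x set \<Rightarrow> bool" where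
  "graded_right_ideal A G I \<longleftrightarrow> right_ideal A I \<and> graded_subgroup A G I"

definition graded_left_ideal :: "('x, 'b) ring_scheme \<Rightarrow> ('g \<Rightarrow> 'x set) \<Rightarrow> 'x set \<Rightarrow> bool" where
  "graded_left_ideal A G I \<longleftrightarrow> left_ideal A I \<and> graded_subgroup A G I"

definition graded_ideal :: "('x, 'b) ring_scheme \<Rightarrow> ('g \<Rightarrow> 'x set) \<Rightarrow> 'x set \<Rightarrow> bool" where
  "graded_ideal A G I \<longleftrightarrow> twosided_ideal A I \<and> graded_subgroup A G I"

definition graded_semiprime :: "('x, 'b) ring_scheme \<Rightarrow> ('g \<Rightarrow> 'x set) \<Rightarrow> 'x set \<Rightarrow> bool" where
  "graded_semiprime A G I \<longleftrightarrow> graded_ideal A G I \<and>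
     (\<forall>J. graded_ideal A G J \<longrightarrow> J \<cdot>\<^bsub>A\<^esub> J \<subseteq> I \<longrightarrow> J \<subseteq> I)"

definition left_module :: "('x, 'b) ring_scheme \<Rightarrow> ('x, 'm, 'c) module_scheme \<Rightarrow> bool" where
  "left_module A M \<longleftrightarrow> abelian_group M \<and>
     (\<forall>a \<in> carrier A. \<forall>x \<in> carrier M. a \<odot>\<^bsub>M\<^esub> x \<in> carrier M) \<and>
     (\<forall>a \<in> carrier A. \<forall>b \<in> carrier A. \<forall>x \<in> carrier M.
        (a \<oplus>\<^bsub>A\<^esub> b) \<odot>\<^bsub>M\<^esub> x = a \<odot>\<^bsub>M\<^esub> x \<oplus>\<^bsub>M\<^esub> b \<odot>\<^bsub>M\<^esub> x) \<and>
     (\<forall>a \<in> carrier A. \<forall>x \<in> carrier M. \<forall>y \<in> carrier M.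
        a \<odot>\<^bsub>M\<^esub> (x \<oplus>\<^bsub>M\<^esub> y) = a \<odot>\<^bsub>M\<^esub> x \<oplus>\<^bsub>M\<^esub> a \<odot>\<^bsub>M\<^esub> y) \<and>
     (\<forall>a \<in> carrier A. \<forall>b \<in> carrier A. \<forall>x \<in> carrier M.
        (a \<otimes>\<^bsub>A\<^esub> b) \<odot>\<^bsub>M\<^esub> x = a \<odot>\<^bsub>M\<^esub> (b \<odot>\<^bsub>M\<^esub> x))"

definition unital_module :: "('x, 'b) ring_scheme \<Rightarrow> ('x, 'm, 'c) module_scheme \<Rightarrow> bool" where
  "unital_module A M \<longleftrightarrow> left_module A M \<and>
     generate (add_monoid M) {a \<odot>\<^bsub>M\<^esub> x | a x. a \<in> carrier A \<and> x \<in> carrier M} = carrier M"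

definition left_submodule :: "('x, 'b) ring_scheme \<Rightarrow> ('x, 'm, 'c) module_scheme \<Rightarrow> 'm set \<Rightarrow> bool" where
  "left_submodule A M N \<longleftrightarrow> additive_subgroup N M \<and> (\<forall>a \<in> carrier A. \<forall>x \<in> N. a \<odot>\<^bsub>M\<^esub> x \<in> N)"

definition simple_module :: "('x, 'b) ring_scheme \<Rightarrow> ('x, 'm, 'c) module_scheme \<Rightarrow> bool" where
  "simple_module A M \<longleftrightarrow> unital_module A M \<and> carrier M \<noteq> {\<zero>\<^bsub>M\<^esub>} \<and>
     (\<forall>N. left_submodule A M N \<longrightarrow> N = {\<zero>\<^bsub>M\<^esub>} \<or> N = carrier M)"

definition graded_module ::
    "('x, 'b) ring_scheme \<Rightarrow> ('g::ab_group_add \<Rightarrow> 'x set) \<Rightarrow>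
     ('x, 'm, 'c) module_scheme \<Rightarrow> ('g \<Rightarrow> 'm set) \<Rightarrow> bool" where
  "graded_module A G M D \<longleftrightarrow> left_module A M \<and>
     (\<forall>n. additive_subgroup (D n) M) \<and>
     (\<forall>x \<in> carrier M. \<exists>!h. (\<forall>n. h n \<in> D n) \<and> finite {n. h n \<noteq> \<zero>\<^bsub>M\<^esub>} \<and>
        x = finsum M h {n. h n \<noteq> \<zero>\<^bsub>M\<^esub>}) \<and>
     (\<forall>m n. \<forall>a \<in> G m. \<forall>x \<in> D n. a \<odot>\<^bsub>M\<^esub> x \<in> D (m + n))"

definition graded_simple_module ::
    "('x, 'b) ring_scheme \<Rightarrow> ('g::ab_group_add \<Rightarrow> 'x set) \<Rightarrow>
     ('x, 'm, 'c) module_scheme \<Rightarrow> ('g \<Rightarrow> 'm set) \<Rightarrow> bool" where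
  "graded_simple_module A G M D \<longleftrightarrow> graded_module A G M D \<and> unital_module A M \<and>
     carrier M \<noteq> {\<zero>\<^bsub>M\<^esub>} \<and>
     (\<forall>N. left_submodule A M N \<and> graded_subgroup M D N \<longrightarrow> N = {\<zero>\<^bsub>M\<^esub>} \<or> N = carrier M)"

definition annihilator :: "('x, 'b) ring_scheme \<Rightarrow> ('x, 'm, 'c) module_scheme \<Rightarrow> 'x set" where
  "annihilator A M = {a \<in> carrier A. \<forall>x \<in> carrier M. a \<odot>\<^bsub>M\<^esub> x = \<zero>\<^bsub>M\<^esub>}"

text \<open>
  The modules range over those with elements in \<^typ>\<open>'x set\<close>.  This loses none up to
  isomorphism: a (graded) simple unital module is generated by one (homogeneous) element,
  so it is a quotient \<open>A/L\<close> by a left ideal, whose elements are cosets in \<open>A\<close>.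
  The intersection is taken inside \<open>carrier A\<close>, hence is \<open>A\<close> if there are no such modules.
\<close>

definition jacobson_radical :: "('x, 'b) ring_scheme \<Rightarrow> 'x set" where
  "jacobson_radical A = carrier A \<inter>
     (\<Inter>M \<in> {M :: ('x, 'x set) module. simple_module A M}. annihilator A M)"

definition graded_jacobson_radical ::
    "('x, 'b) ring_scheme \<Rightarrow> ('g::ab_group_add \<Rightarrow> 'x set) \<Rightarrow> 'x set" where
  "graded_jacobson_radical A G = carrier A \<inter>
     (\<Inter>M \<in> {M :: ('x, 'x set) module. \<exists>D. graded_simple_module A G M D}. annihilator A M)"

end

(*
  KP(Lambda) is graded von Neumann regular: by (KP4) and (KP3) every homogeneous element is a
  combination of elements mu nu* with deg mu and deg nu fixed, so these multiply like
  matrix units, and Gaussian elimination on the coefficient matrix yields, for x of degree n,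
  some y of degree -n with x y x = x.

  For any graded von Neumann regular ring, (1)-(3) are the classical arguments, and (5) sends a
  right ideal B of the degree-0 part to {x. x_n y : B for all n and all y of degree -n}.
  For the graded radical, a homogeneous idempotent e is not killed by A/L, where L is maximal
  among the graded left ideals that contain all a - ae but not e.  For the radical, normalise an
  element x of minimal support so that its lowest term is an idempotent e of degree 0.  By
  minimality x commutes with the homogeneous elements of eAe, so its top term u has an inverse
  in fAf for an idempotent f = u y.  If u has positive degree then f + xu is left invertible in fAf
  although its extreme terms f and u u have different degrees and are both invertible, a
  contradiction; if u has degree 0 then x = e is an idempotent, which is impossible as well.
*)
theory Submission
  imports Defs
begin

section \<open>Graded von Neumann regular rings\<close>

text \<open>Without a unit, neither properness of left ideals nor unitality of \<open>A/L\<close>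
  behaves as usual. An idempotent replaces the unit: once \<open>L\<close> contains all
  \<open>a - ae\<close>, \<open>e\<close> is a right unit modulo \<open>L\<close>, so
  \<open>A/L\<close> is generated by the class of \<open>e\<close>, and avoiding \<open>e\<close>
  takes over the role of being proper. The components of \<open>KP\<close> are given as spans, so
  directness of their sum has to be proved. The free algebra is graded by the degrees of words and
  every relation is homogeneous; hence the ideal is stable under taking homogeneous parts, and the
  projections descend to the quotient. The words lowest and top refer to the lexicographic order of
  the degree group, which the ring-theoretic part sees only through a positive cone
  \<open>pos\<close>. The radical is not known to be graded beforehand, so an element of it cannot
  be split into components; this is why supports of minimal size are used. The equation x y x = x is
  symmetric, so the left-hand halves of (1) and (5) are the right-hand ones for the opposite
  ring.\<close>

lemma (in abelian_group) additive_map: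
  assumes f: "\<And>x. x \<in> carrier G \<Longrightarrow> f x \<in> carrier G"
    and add: "\<And>x y. \<lbrakk>x \<in> carrier G; y \<in> carrier G\<rbrakk> \<Longrightarrow> f (x \<oplus> y) = f x \<oplus> f y"
  shows additive_map_zero: "f \<zero> = \<zero>"
    and additive_map_minus: "x \<in> carrier G \<Longrightarrow> f (\<ominus> x) = \<ominus> f x"
    and additive_map_diff: "\<lbrakk>x \<in> carrier G; y \<in> carrier G\<rbrakk> \<Longrightarrow> f (x \<ominus> y) = f x \<ominus> f y"
    and additive_map_finsum: "\<lbrakk>finite S; g \<in> S \<rightarrow> carrier G\<rbrakk> \<Longrightarrow>
      f (finsum G g S) = finsum G (\<lambda>i. f (g i)) S"
proof -
  show z: "f \<zero> = \<zero>"
    using add[of \<zero> \<zero>] f[of \<zero>] by (metis add.r_cancel_one' l_zero zero_closed)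
  show m: "f (\<ominus> x) = \<ominus> f x" if "x \<in> carrier G" for x
    using that add[of "\<ominus> x" x] z f by (metis a_inv_closed l_neg minus_equality)
  show "f (x \<ominus> y) = f x \<ominus> f y" if "x \<in> carrier G" "y \<in> carrier G" for x y
    using that by (simp add: a_minus_def add m)
  show "f (finsum G g S) = finsum G (\<lambda>i. f (g i)) S"
    if "finite S" "g \<in> S \<rightarrow> carrier G"
    using that
  proof (induction S rule: finite_induct)
    case empty
    then show ?case by (simp add: z)
  next
    case (insert a S)
    have "g a \<in> carrier G" "g \<in> S \<rightarrow> carrier G" using insert by auto
    moreover have "(\<lambda>i. f (g i)) \<in> S \<rightarrow> carrier G" using calculation f by auto
    ultimately show ?case using insert f by (simp add: add)
  qed
qed

section \<open>Rings without unit\<close>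

locale nonunital_ring = abelian_group A for A (structure) +
  assumes mult_closed [simp]: "\<lbrakk>x \<in> carrier A; y \<in> carrier A\<rbrakk> \<Longrightarrow> x \<otimes> y \<in> carrier A"
    and mult_assoc: "\<lbrakk>x \<in> carrier A; y \<in> carrier A; z \<in> carrier A\<rbrakk> \<Longrightarrow> (x \<otimes> y) \<otimes> z = x \<otimes> (y \<otimes> z)"
    and distr_right: "\<lbrakk>x \<in> carrier A; y \<in> carrier A; z \<in> carrier A\<rbrakk> \<Longrightarrow> (x \<oplus> y) \<otimes> z = x \<otimes> z \<oplus> y \<otimes> z"
    and distr_left: "\<lbrakk>x \<in> carrier A; y \<in> carrier A; z \<in> carrier A\<rbrakk> \<Longrightarrow> z \<otimes> (x \<oplus> y) = z \<otimes> x \<oplus> z \<otimes> y"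
begin

lemma mult_zero_left [simp]: "x \<in> carrier A \<Longrightarrow> \<zero> \<otimes> x = \<zero>"
  using additive_map_zero[of "\<lambda>y. y \<otimes> x"] by (simp add: distr_right)

lemma mult_zero_right [simp]: "x \<in> carrier A \<Longrightarrow> x \<otimes> \<zero> = \<zero>"
  using additive_map_zero[of "\<lambda>y. x \<otimes> y"] by (simp add: distr_left)

lemma minus_mult_left: "\<lbrakk>x \<in> carrier A; y \<in> carrier A\<rbrakk> \<Longrightarrow> (\<ominus> y) \<otimes> x = \<ominus> (y \<otimes> x)"
  using additive_map_minus[of "\<lambda>y. y \<otimes> x"] by (simp add: distr_right)

lemma minus_mult_right: "\<lbrakk>x \<in> carrier A; y \<in> carrier A\<rbrakk> \<Longrightarrow> x \<otimes> (\<ominus> y) = \<ominus> (x \<otimes> y)"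
  using additive_map_minus[of "\<lambda>y. x \<otimes> y"] by (simp add: distr_left)

lemma diff_mult: "\<lbrakk>x \<in> carrier A; y \<in> carrier A; z \<in> carrier A\<rbrakk> \<Longrightarrow> (x \<ominus> y) \<otimes> z = x \<otimes> z \<ominus> y \<otimes> z"
  by (simp add: a_minus_def distr_right minus_mult_left)

lemma mult_diff: "\<lbrakk>x \<in> carrier A; y \<in> carrier A; z \<in> carrier A\<rbrakk> \<Longrightarrow> z \<otimes> (x \<ominus> y) = z \<otimes> x \<ominus> z \<otimes> y"
  by (simp add: a_minus_def distr_left minus_mult_right)

lemma diff_zero [simp]: "x \<in> carrier A \<Longrightarrow> x \<ominus> \<zero> = x"
  by (simp add: a_minus_def)

lemma diff_self [simp]: "x \<in> carrier A \<Longrightarrow> x \<ominus> x = \<zero>"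
  by (simp add: a_minus_def r_neg)

lemma diff_eq_zeroD: "\<lbrakk>x \<ominus> y = \<zero>; x \<in> carrier A; y \<in> carrier A\<rbrakk> \<Longrightarrow> x = y"
  by (metis a_minus_def add.inv_solve_right' add.l_one zero_closed)

lemma add_diff_cancel: "\<lbrakk>x \<in> carrier A; y \<in> carrier A\<rbrakk> \<Longrightarrow> y \<oplus> (x \<ominus> y) = x"
  by (metis a_comm a_minus_def add.inv_closed add.inv_solve_right add.m_closed)

end

lemma subgroup_add_monoid_iff:
  assumes "abelian_group A"
  shows "additive_subgroup I A \<longleftrightarrow> I \<subseteq> carrier A \<and> \<zero>\<^bsub>A\<^esub> \<in> I \<and>
     (\<forall>x\<in>I. \<forall>y\<in>I. x \<oplus>\<^bsub>A\<^esub> y \<in> I) \<and> (\<forall>x\<in>I. \<ominus>\<^bsub>A\<^esub> x \<in> I)"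
proof -
  interpret abelian_group A by fact
  show ?thesis
    unfolding additive_subgroup_def subgroup_def
    by (auto simp: a_inv_def)
qed

text \<open>The projections are part of the data: \<open>pr_hom\<close> makes the sum of the
  \<open>G n\<close> direct, and \<open>G_generates\<close> makes it all of \<open>A\<close>. The
  quasi-inverse in \<open>regular\<close> is taken in the opposite degree, so that
  \<open>x y\<close> and \<open>y x\<close> are idempotents of degree 0.\<close>

locale graded_regular_ring = nonunital_ring A
  for A :: "('x, 'b) ring_scheme" (structure) +
  fixes G :: "'g::ab_group_add \<Rightarrow> 'x set" and pr :: "'g \<Rightarrow> 'x \<Rightarrow> 'x"
  assumes G_subgroup: "additive_subgroup (G n) A"
    and G_mult: "\<lbrakk>x \<in> G m; y \<in> G n\<rbrakk> \<Longrightarrow> x \<otimes> y \<in> G (m + n)"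
    and pr_closed: "x \<in> carrier A \<Longrightarrow> pr n x \<in> G n"
    and pr_add: "\<lbrakk>x \<in> carrier A; y \<in> carrier A\<rbrakk> \<Longrightarrow> pr n (x \<oplus> y) = pr n x \<oplus> pr n y"
    and pr_hom: "x \<in> G m \<Longrightarrow> pr n x = (if n = m then x else \<zero>)"
    and G_generates: "carrier A \<subseteq> generate (add_monoid A) (\<Union>n. G n)"
    and regular: "x \<in> G n \<Longrightarrow> \<exists>y \<in> G (- n). x \<otimes> y \<otimes> x = x"
begin

lemma additive_subgroup_iff: "additive_subgroup I A \<longleftrightarrow> I \<subseteq> carrier A \<and> \<zero> \<in> I \<and>
     (\<forall>x\<in>I. \<forall>y\<in>I. x \<oplus> y \<in> I) \<and> (\<forall>x\<in>I. \<ominus> x \<in> I)"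
  by (rule subgroup_add_monoid_iff) (rule abelian_group_axioms)

lemma subgroup_diff: "\<lbrakk>additive_subgroup I A; x \<in> I; y \<in> I\<rbrakk> \<Longrightarrow> x \<ominus> y \<in> I"
  by (simp add: additive_subgroup_iff a_minus_def)

lemma G_carrier [simp]: "x \<in> G n \<Longrightarrow> x \<in> carrier A"
  using G_subgroup[of n] by (auto simp: additive_subgroup_iff)

lemma G_zero [simp]: "\<zero> \<in> G n"
  using G_subgroup[of n] by (auto simp: additive_subgroup_iff)

lemma G_minus: "x \<in> G n \<Longrightarrow> \<ominus> x \<in> G n"
  using G_subgroup[of n] by (auto simp: additive_subgroup_iff)

lemma G_diff: "x \<in> G n \<Longrightarrow> y \<in> G n \<Longrightarrow> x \<ominus> y \<in> G n"
  using G_subgroup[of n] by (simp add: additive_subgroup_iff a_minus_def)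

lemma G_add: "x \<in> G n \<Longrightarrow> y \<in> G n \<Longrightarrow> x \<oplus> y \<in> G n"
  using G_subgroup[of n] by (simp add: additive_subgroup_iff)

lemma pr_carrier [simp]: "x \<in> carrier A \<Longrightarrow> pr n x \<in> carrier A"
  using pr_closed G_carrier by blast

lemma pr_zero [simp]: "pr n \<zero> = \<zero>"
  by (rule additive_map_zero) (auto simp: pr_add)

lemma pr_minus: "x \<in> carrier A \<Longrightarrow> pr n (\<ominus> x) = \<ominus> pr n x"
  by (rule additive_map_minus) (auto simp: pr_add)

lemma pr_diff: "\<lbrakk>x \<in> carrier A; y \<in> carrier A\<rbrakk> \<Longrightarrow> pr n (x \<ominus> y) = pr n x \<ominus> pr n y"
  by (rule additive_map_diff) (auto simp: pr_add)

lemma pr_finsum: "\<lbrakk>finite S; g \<in> S \<rightarrow> carrier A\<rbrakk> \<Longrightarrow>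
    pr n (finsum A g S) = finsum A (\<lambda>i. pr n (g i)) S"
  by (rule additive_map_finsum) (auto simp: pr_add)

text \<open>Components are closed under negation, so the inverses occurring in
  \<open>generate\<close> are absorbed by the homogeneous case.\<close>

lemma graded_induct [consumes 1, case_names hom add]:
  assumes "x \<in> carrier A"
    and hom: "\<And>x n. x \<in> G n \<Longrightarrow> P x"
    and add: "\<And>x y. \<lbrakk>x \<in> carrier A; y \<in> carrier A; P x; P y\<rbrakk> \<Longrightarrow> P (x \<oplus> y)"
  shows "P x"
proof -
  have "x \<in> generate (add_monoid A) (\<Union>n. G n)" using assms(1) G_generates by blast
  then have "x \<in> carrier A \<and> P x"
  proof induction
    case one
    then show ?case using hom[OF G_zero] by simp
  next
    case (incl h)
    then show ?case using hom by auto
  next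
    case (inv h)
    then show ?case using hom G_minus by (auto simp: a_inv_def[symmetric])
  next
    case (eng h1 h2)
    then show ?case using add by simp
  qed
  then show ?thesis ..
qed

section \<open>Homogeneous components and finite supports\<close>

definition supp :: "'x \<Rightarrow> 'g set" where
  "supp x = {n. pr n x \<noteq> \<zero>}"

lemma finsum_const_zero: "(\<And>i. i \<in> S \<Longrightarrow> g i = \<zero>) \<Longrightarrow> finsum A g S = \<zero>"
  by (metis add.finprod_one_eqI)

lemma finsum_single:
  assumes "finite S" "a \<in> S" "g a \<in> carrier A" "\<And>i. i \<in> S \<Longrightarrow> i \<noteq> a \<Longrightarrow> g i = \<zero>"
  shows "finsum A g S = g a"
proof -
  have "finsum A g (S - {a}) = \<zero>" using assms by (intro finsum_const_zero) auto
  moreover have "finsum A g (insert a (S - {a})) = g a \<oplus> finsum A g (S - {a})"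
    using assms by (intro finsum_insert) auto
  ultimately show ?thesis using assms by (simp add: insert_absorb)
qed

text \<open>The decomposition is claimed for all finite supersets \<open>T\<close> of
  \<open>S\<close>, since in the step for a sum the index sets of both summands have to be enlarged
  to a common one.\<close>

lemma decomposition_aux:
  assumes "x \<in> carrier A"
  shows "\<exists>S. finite S \<and> (\<forall>n. n \<notin> S \<longrightarrow> pr n x = \<zero>) \<and>
    (\<forall>T. finite T \<longrightarrow> S \<subseteq> T \<longrightarrow> x = finsum A (\<lambda>n. pr n x) T)"
  using assms
proof (induction rule: graded_induct)
  case (hom x n)
  have "x = finsum A (\<lambda>m. pr m x) T" if "finite T" "{n} \<subseteq> T" for T
    using finsum_single[of T n "\<lambda>m. pr m x"] that hom by (simp add: pr_hom)
  with hom show ?case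
    by (intro exI[of _ "{n}"]) (auto simp: pr_hom)
next
  case (add x y)
  obtain S where S: "finite S" "\<forall>n. n \<notin> S \<longrightarrow> pr n x = \<zero>"
    "\<forall>T. finite T \<longrightarrow> S \<subseteq> T \<longrightarrow> x = finsum A (\<lambda>n. pr n x) T" using add(3) by blast
  obtain S' where S': "finite S'" "\<forall>n. n \<notin> S' \<longrightarrow> pr n y = \<zero>"
    "\<forall>T. finite T \<longrightarrow> S' \<subseteq> T \<longrightarrow> y = finsum A (\<lambda>n. pr n y) T" using add(4) by blast
  have "x \<oplus> y = finsum A (\<lambda>n. pr n (x \<oplus> y)) T" if "finite T" "S \<union> S' \<subseteq> T" for T
  proof -
    have "finsum A (\<lambda>n. pr n (x \<oplus> y)) T = finsum A (\<lambda>n. pr n x \<oplus> pr n y) T"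
      using add by (intro finsum_cong') (auto simp: pr_add)
    also have "\<dots> = finsum A (\<lambda>n. pr n x) T \<oplus> finsum A (\<lambda>n. pr n y) T"
      using add by (intro finsum_addf) auto
    also have "\<dots> = x \<oplus> y" using that S S' by (metis Un_subset_iff)
    finally show ?thesis by simp
  qed
  then show ?case using S S' add by (intro exI[of _ "S \<union> S'"]) (auto simp: pr_add)
qed

lemma finite_supp: "x \<in> carrier A \<Longrightarrow> finite (supp x)"
  using decomposition_aux[of x] unfolding supp_def
  by (smt (verit) finite_subset mem_Collect_eq subsetI)

lemma decomposition:
  assumes "x \<in> carrier A" "finite T" "supp x \<subseteq> T"
  shows "x = finsum A (\<lambda>n. pr n x) T"
proof -
  obtain S where S: "finite S" "\<forall>n. n \<notin> S \<longrightarrow> pr n x = \<zero>"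
    "\<forall>T. finite T \<longrightarrow> S \<subseteq> T \<longrightarrow> x = finsum A (\<lambda>n. pr n x) T" using decomposition_aux[OF assms(1)] by blast
  have "x = finsum A (\<lambda>n. pr n x) (S \<union> T)" using S assms by blast
  also have "\<dots> = finsum A (\<lambda>n. pr n x) T"
    using assms S by (intro add.finprod_mono_neutral_cong_right) (auto simp: supp_def)
  finally show ?thesis .
qed

lemma pr_eqI:
  assumes "x \<in> carrier A" "y \<in> carrier A" "\<And>n. pr n x = pr n y"
  shows "x = y"
proof -
  have "supp x = supp y" by (simp add: supp_def assms(3))
  then have "finsum A (\<lambda>n. pr n x) (supp x) = finsum A (\<lambda>n. pr n y) (supp y)"
    by (simp add: assms(3))
  then show ?thesis using decomposition[of x "supp x"] decomposition[of y "supp y"] assms finite_supp by simp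
qed

lemma supp_empty: "\<lbrakk>x \<in> carrier A; x \<noteq> \<zero>\<rbrakk> \<Longrightarrow> supp x \<noteq> {}"
  using pr_eqI[of x \<zero>] by (auto simp: supp_def)

lemma pr_mult_hom:
  assumes "x \<in> carrier A" "r \<in> G d"
  shows "pr n (x \<otimes> r) = pr (n - d) x \<otimes> r"
  using assms(1)
proof (induction rule: graded_induct)
  case (hom x m)
  have "x \<otimes> r \<in> G (m + d)" using hom assms by (simp add: G_mult)
  then show ?case using hom assms by (auto simp: pr_hom algebra_simps)
next
  case (add x y)
  then show ?case using assms by (simp add: pr_add distr_right)
qed

lemma pr_hom_mult:
  assumes "x \<in> carrier A" "r \<in> G d"
  shows "pr n (r \<otimes> x) = r \<otimes> pr (n - d) x"
  using assms(1)
proof (induction rule: graded_induct)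
  case (hom x m)
  have "r \<otimes> x \<in> G (d + m)" using hom assms by (simp add: G_mult)
  then show ?case using hom assms by (auto simp: pr_hom algebra_simps)
next
  case (add x y)
  then show ?case using assms by (simp add: pr_add distr_left)
qed

lemma finsum_in_subgroup:
  assumes "additive_subgroup I A" "\<And>i. i \<in> S \<Longrightarrow> g i \<in> I"
  shows "finsum A g S \<in> I"
proof (cases "finite S")
  case True
  have "I \<subseteq> carrier A" using assms by (simp add: additive_subgroup_iff)
  with True assms(2) show ?thesis
  proof (induction S rule: finite_induct)
    case empty
    then show ?case using assms(1) by (simp add: additive_subgroup_iff)
  next
    case (insert a S)
    then have "finsum A g (insert a S) = g a \<oplus> finsum A g S" by (intro finsum_insert) auto
    then show ?case using insert assms(1) by (simp add: additive_subgroup_iff)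
  qed
next
  case False
  then show ?thesis using assms(1) by (simp add: finsum_infinite additive_subgroup_iff)
qed

lemma mem_subgroup_of_pr:
  assumes "additive_subgroup I A" "x \<in> carrier A" "\<And>n. pr n x \<in> I"
  shows "x \<in> I"
  using decomposition[of x "supp x"] finsum_in_subgroup[OF assms(1), of "supp x" "\<lambda>n. pr n x"] assms finite_supp
  by simp

text \<open>Stability under projections replaces generation by homogeneous elements in the later
  arguments. One direction holds because the property passes through \<open>generate\<close>, the
  other because an element is the finite sum of its components.\<close>

lemma graded_subgroup_iff:
  assumes I: "additive_subgroup I A"
  shows "graded_subgroup A G I \<longleftrightarrow> (\<forall>x\<in>I. \<forall>n. pr n x \<in> I)"
proof
  assume gr: "graded_subgroup A G I"
  have II: "I \<subseteq> carrier A" "\<zero> \<in> I" "\<And>x y. x \<in> I \<Longrightarrow> y \<in> I \<Longrightarrow> x \<oplus> y \<in> I" "\<And>x. x \<in> I \<Longrightarrow> \<ominus> x \<in> I"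
    using I by (auto simp: additive_subgroup_iff)
  have hompr: "pr n h \<in> I" if "h \<in> I \<inter> homogeneous G" for h n
    using that II by (auto simp: homogeneous_def pr_hom)
  show "\<forall>x\<in>I. \<forall>n. pr n x \<in> I"
  proof (intro ballI allI)
    fix x n assume "x \<in> I"
    then have "x \<in> generate (add_monoid A) (I \<inter> homogeneous G)"
      using gr unfolding graded_subgroup_def by blast
    then have "x \<in> I \<and> pr n x \<in> I"
    proof induction
      case one
      then show ?case using II by simp
    next
      case (incl h)
      then show ?case using hompr by auto
    next
      case (inv h)
      then show ?case using hompr II by (auto simp: a_inv_def[symmetric] pr_minus subsetD)
    next
      case (eng h1 h2)
      then show ?case using II by (auto simp: pr_add subsetD)
    qed
    then show "pr n x \<in> I" ..
  qed
next
  assume R: "\<forall>x\<in>I. \<forall>n. pr n x \<in> I"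
  have II: "I \<subseteq> carrier A" using I by (auto simp: additive_subgroup_iff)
  have "subgroup (generate (add_monoid A) (I \<inter> homogeneous G)) (add_monoid A)"
    by (rule group.generate_is_subgroup) (use II a_group in auto)
  then have sg: "additive_subgroup (generate (add_monoid A) (I \<inter> homogeneous G)) A"
    by (rule additive_subgroup.intro)
  have "I \<subseteq> generate (add_monoid A) (I \<inter> homogeneous G)"
  proof
    fix x assume x: "x \<in> I"
    have "pr n x \<in> I \<inter> homogeneous G" for n
      using x R pr_closed[of x n] II by (auto simp: homogeneous_def)
    then have "pr n x \<in> generate (add_monoid A) (I \<inter> homogeneous G)" for n
      by (rule generate.incl)
    moreover have "x \<in> carrier A" using x II by blast
    ultimately show "x \<in> generate (add_monoid A) (I \<inter> homogeneous G)"
      using mem_subgroup_of_pr[OF sg] by blast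
  qed
  moreover have "generate (add_monoid A) (I \<inter> homogeneous G) \<subseteq> I"
    by (rule group.generate_subgroup_incl[OF a_group]) (use I in \<open>auto simp: additive_subgroup_def\<close>)
  ultimately show "graded_subgroup A G I" unfolding graded_subgroup_def by blast
qed

end


section \<open>Graded one-sided ideals\<close>

context graded_regular_ring
begin

lemma right_ideal_subset: "right_ideal A I \<Longrightarrow> I \<subseteq> carrier A"
  by (simp add: right_ideal_def additive_subgroup_iff)

lemma left_ideal_subset: "left_ideal A I \<Longrightarrow> I \<subseteq> carrier A"
  by (simp add: left_ideal_def additive_subgroup_iff)

lemma graded_right_ideal_iff:
  "graded_right_ideal A G I \<longleftrightarrow> right_ideal A I \<and> (\<forall>x\<in>I. \<forall>n. pr n x \<in> I)"
  unfolding graded_right_ideal_def right_ideal_def using graded_subgroup_iff by blast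

lemma graded_left_ideal_iff:
  "graded_left_ideal A G I \<longleftrightarrow> left_ideal A I \<and> (\<forall>x\<in>I. \<forall>n. pr n x \<in> I)"
  unfolding graded_left_ideal_def left_ideal_def using graded_subgroup_iff by blast

text \<open>Homogeneous elements are adjoined one at a time, as in orthogonalisation: the part of
  \<open>x\<close> not yet reproduced by \<open>e\<close> contributes a further idempotent. All
  corrections have degree 0, whatever the degrees in \<open>H\<close>. The last clause keeps
  \<open>e\<close> inside the right ideal generated by \<open>H\<close>.\<close>

lemma idempotent_generating_finite_set:
  assumes "finite H" "H \<subseteq> homogeneous G"
  shows "\<exists>e \<in> G 0. e \<otimes> e = e \<and> (\<forall>x\<in>H. e \<otimes> x = x) \<and> (\<forall>I. right_ideal A I \<longrightarrow> H \<subseteq> I \<longrightarrow> e \<in> I)"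
  using assms
proof (induction H rule: finite_induct)
  case empty
  have "\<zero> \<otimes> \<zero> = \<zero>" by (rule mult_zero_left) simp
  then show ?case
    by (intro bexI[of _ \<zero>]) (auto simp: right_ideal_def additive_subgroup_iff)
next
  case (insert x H)
  then obtain e where e: "e \<in> G 0" "e \<otimes> e = e" "\<And>y. y \<in> H \<Longrightarrow> e \<otimes> y = y"
    and eI: "\<And>I. right_ideal A I \<Longrightarrow> H \<subseteq> I \<Longrightarrow> e \<in> I" by auto
  obtain n where x: "x \<in> G n" using insert by (auto simp: homogeneous_def)
  have Hc: "y \<in> carrier A" if "y \<in> H" for y using that insert by (auto simp: homogeneous_def)
  \<comment> \<open>The part of \<open>x\<close> that \<open>e\<close> misses:
    \<open>e f = 0\<close>, and regularity makes \<open>g = f z\<close> an idempotent fixing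
    \<open>f\<close> from the left.\<close>
  define f where "f = x \<ominus> e \<otimes> x"
  have ex: "e \<otimes> x \<in> G n" using G_mult[OF e(1) x] by simp
  then have f: "f \<in> G n" using x by (simp add: f_def G_diff)
  obtain z where z: "z \<in> G (- n)" "f \<otimes> z \<otimes> f = f" using regular[OF f] by blast
  define g where "g = f \<otimes> z"
  have g: "g \<in> G 0" using G_mult[OF f z(1)] by (simp add: g_def)
  have [simp]: "e \<in> carrier A" "x \<in> carrier A" "f \<in> carrier A" "z \<in> carrier A" "g \<in> carrier A"
    using e x f z g G_carrier by auto
  have ef: "e \<otimes> f = \<zero>"
  proof -
    have "e \<otimes> f = e \<otimes> x \<ominus> (e \<otimes> e) \<otimes> x" by (simp add: f_def mult_diff mult_assoc)
    then show ?thesis using e by simp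
  qed
  have eg: "e \<otimes> g = \<zero>" by (simp add: g_def mult_assoc[symmetric] ef)
  have gf: "g \<otimes> f = f" using z by (simp add: g_def)
  have gg: "g \<otimes> g = g"
  proof -
    have "g \<otimes> g = (f \<otimes> z \<otimes> f) \<otimes> z" by (simp add: g_def mult_assoc)
    then show ?thesis using z by (simp add: g_def)
  qed
  \<comment> \<open>Here \<open>e g = 0\<close>, but \<open>g e\<close> may be nonzero. Removing it
    gives \<open>u e = 0\<close>, while \<open>u g = g\<close> survives, so \<open>e + u\<close>
    still reproduces \<open>f\<close>.\<close>
  define u where "u = g \<ominus> g \<otimes> e"
  have u: "u \<in> G 0" using g G_mult[OF g e(1)] by (simp add: u_def G_diff)
  have [simp]: "u \<in> carrier A" using u by simp
  have ue: "u \<otimes> e = \<zero>" by (simp add: u_def diff_mult mult_assoc e)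
  have ug: "u \<otimes> g = g" by (simp add: u_def diff_mult mult_assoc eg gg)
  define e' where "e' = e \<oplus> u"
  have e': "e' \<in> G 0" "e' \<in> carrier A" using e u by (auto simp: e'_def G_add)
  have e'e: "e' \<otimes> e = e" by (simp add: e'_def distr_right e ue)
  have e'g: "e' \<otimes> g = g" by (simp add: e'_def distr_right eg ug)
  have e'u: "e' \<otimes> u = u" using e' e'e e'g by (simp add: u_def mult_diff mult_assoc[symmetric])
  have "e' \<otimes> e' = e' \<otimes> e \<oplus> e' \<otimes> u" using e' by (simp add: e'_def distr_left)
  then have "e' \<otimes> e' = e'" using e'e e'u by (simp add: e'_def)
  moreover have "e' \<otimes> y = y" if "y \<in> insert x H" for y
  proof (cases "y \<in> H")
    case True
    then have "e' \<otimes> y = (e' \<otimes> e) \<otimes> y" using e(3) e' Hc by (simp add: mult_assoc)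
    then show ?thesis using e'e e True by simp
  next
    case False
    then have y: "y = x" using that by simp
    have "e \<otimes> x \<oplus> f = x" by (simp add: f_def add_diff_cancel)
    then have x: "x = e \<otimes> x \<oplus> g \<otimes> f" using gf by simp
    have "e' \<otimes> x = e' \<otimes> (e \<otimes> x \<oplus> g \<otimes> f)" using x by simp
    also have "\<dots> = (e' \<otimes> e) \<otimes> x \<oplus> (e' \<otimes> g) \<otimes> f" using e' by (simp add: distr_left mult_assoc)
    also have "\<dots> = x" using x e'e e'g by simp
    finally show ?thesis using y by simp
  qed
  moreover have "e' \<in> I" if I: "right_ideal A I" "insert x H \<subseteq> I" for I
  proof -
    have eI': "e \<in> I" using eI I by simp
    have cl: "\<And>a b. a \<in> I \<Longrightarrow> b \<in> carrier A \<Longrightarrow> a \<otimes> b \<in> I" and ag: "additive_subgroup I A"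
      using I by (auto simp: right_ideal_def)
    have "f \<in> I" using I eI' cl ag by (simp add: f_def subgroup_diff)
    then have "g \<in> I" using cl by (simp add: g_def)
    then have "u \<in> I" using cl ag by (simp add: u_def subgroup_diff)
    then show ?thesis using eI' ag by (simp add: e'_def additive_subgroup_iff)
  qed
  ultimately show ?case using e' by blast
qed

lemma right_ideal_gen_right_ideal:
  assumes "S \<subseteq> carrier A"
  shows "right_ideal A (right_ideal_gen A S)"
proof -
  let ?F = "{I. right_ideal A I \<and> S \<subseteq> I}"
  have "carrier A \<in> ?F"
    using assms by (auto simp: right_ideal_def additive_subgroup_iff)
  then have "\<Inter>?F \<subseteq> carrier A" by (rule Inter_lower)
  moreover have "\<zero> \<in> \<Inter>?F" "\<And>x. x \<in> \<Inter>?F \<Longrightarrow> \<ominus> x \<in> \<Inter>?F"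
    "\<And>x y. \<lbrakk>x \<in> \<Inter>?F; y \<in> \<Inter>?F\<rbrakk> \<Longrightarrow> x \<oplus> y \<in> \<Inter>?F"
    "\<And>x a. \<lbrakk>x \<in> \<Inter>?F; a \<in> carrier A\<rbrakk> \<Longrightarrow> x \<otimes> a \<in> \<Inter>?F"
    by (auto simp: right_ideal_def additive_subgroup_iff)
  ultimately show ?thesis
    unfolding right_ideal_gen_def right_ideal_def additive_subgroup_iff by simp
qed

lemma right_ideal_gen_least: "right_ideal A I \<Longrightarrow> S \<subseteq> I \<Longrightarrow> right_ideal_gen A S \<subseteq> I"
  by (auto simp: right_ideal_gen_def)

lemma right_ideal_gen_incl: "S \<subseteq> right_ideal_gen A S"
  by (auto simp: right_ideal_gen_def)

theorem fg_graded_right_ideal: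
  assumes I: "graded_right_ideal A G I" "finite S" "S \<subseteq> carrier A" "I = right_ideal_gen A S"
  shows "\<exists>e \<in> G 0. e \<otimes> e = e \<and> I = right_ideal_gen A {e}"
proof -
  \<comment> \<open>The given generators may be inhomogeneous. Their nonzero components are finitely
    many, lie in \<open>I\<close> because \<open>I\<close> is graded, and still generate
    \<open>I\<close>.\<close>
  define H where "H = (\<Union>x\<in>S. (\<lambda>n. pr n x) ` supp x)"
  have rI: "right_ideal A I" using I by (simp add: graded_right_ideal_def)
  have SI: "S \<subseteq> I" using I right_ideal_gen_incl by blast
  have "finite H" using I finite_supp by (auto simp: H_def)
  moreover have "H \<subseteq> homogeneous G" using I pr_closed by (auto simp: H_def homogeneous_def)
  ultimately obtain e where e: "e \<in> G 0" "e \<otimes> e = e" "\<And>x. x \<in> H \<Longrightarrow> e \<otimes> x = x"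
    and eI: "\<And>I. right_ideal A I \<Longrightarrow> H \<subseteq> I \<Longrightarrow> e \<in> I"
    using idempotent_generating_finite_set[of H] by auto
  have "H \<subseteq> I" using I(1) SI by (auto simp: H_def graded_right_ideal_iff)
  then have "e \<in> I" using eI rI by blast
  then have 1: "right_ideal_gen A {e} \<subseteq> I" using rI right_ideal_gen_least by simp
  have re: "right_ideal A (right_ideal_gen A {e})" using right_ideal_gen_right_ideal[of "{e}"] e by simp
  have ein: "e \<in> right_ideal_gen A {e}" using right_ideal_gen_incl by blast
  have "x \<in> right_ideal_gen A {e}" if x: "x \<in> S" for x
  proof (rule mem_subgroup_of_pr)
    show "additive_subgroup (right_ideal_gen A {e}) A" using re by (simp add: right_ideal_def)
    show xc: "x \<in> carrier A" using I x by blast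
    fix n
    have "e \<otimes> pr n x = pr n x"
    proof (cases "pr n x = \<zero>")
      case True
      then show ?thesis using e by simp
    next
      case False
      then show ?thesis using e x by (auto simp: H_def supp_def)
    qed
    moreover have "e \<otimes> pr n x \<in> right_ideal_gen A {e}"
      using re ein xc by (simp add: right_ideal_def)
    ultimately show "pr n x \<in> right_ideal_gen A {e}" by simp
  qed
  then have "I \<subseteq> right_ideal_gen A {e}" using right_ideal_gen_least[OF re] I by blast
  then show ?thesis using 1 e by blast
qed

text \<open>Only homogeneous elements have to be factored inside \<open>I\<close>, as products of
  ideals are closed under sums. The factorisation is supplied by regularity:
  \<open>x = (x y) x\<close> for a right ideal and \<open>x = x (y x)\<close> for a left
  one.\<close>

lemma ideal_prod_self_mem:
  assumes I: "additive_subgroup I A" "\<forall>x\<in>I. \<forall>n. pr n x \<in> I"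
    and fac: "\<And>x n. \<lbrakk>x \<in> I; x \<in> G n\<rbrakk> \<Longrightarrow> \<exists>y\<in>I. \<exists>z\<in>I. x = y \<otimes> z"
    and x: "x \<in> I"
  shows "x \<in> I \<cdot> I"
proof -
  have Ic: "I \<subseteq> carrier A" using I by (simp add: additive_subgroup_iff)
  have hom: "y \<in> I \<cdot> I" if "y \<in> I" "y \<in> G n" for y n
    using fac[OF that] by (auto intro: ideal_prod.prod)
  have zI: "\<zero> \<in> I \<cdot> I" using hom[of \<zero> 0] I by (simp add: additive_subgroup_iff)
  have "finsum A (\<lambda>n. pr n x) S \<in> I \<cdot> I" if "finite S" for S
    using that
  proof (induction S rule: finite_induct)
    case empty
    then show ?case using zI by simp
  next
    case (insert a S)
    have "finsum A (\<lambda>n. pr n x) (insert a S) = pr a x \<oplus> finsum A (\<lambda>n. pr n x) S"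
      using x Ic insert by (intro finsum_insert) auto
    moreover have "pr a x \<in> I \<cdot> I" using hom[of "pr a x" a] I(2) x pr_closed Ic by blast
    ultimately show ?case using insert ideal_prod.sum by metis
  qed
  then show ?thesis using decomposition[of x "supp x"] x Ic finite_supp
    by (metis order_refl subsetD)
qed

lemma ideal_prod_self_subset:
  assumes "additive_subgroup I A" "\<And>x y. x \<in> I \<Longrightarrow> y \<in> I \<Longrightarrow> x \<otimes> y \<in> I"
  shows "I \<cdot> I \<subseteq> I"
proof
  fix x assume "x \<in> I \<cdot> I"
  then show "x \<in> I" by induction (use assms in \<open>auto simp: additive_subgroup_iff\<close>)
qed

theorem graded_right_ideal_idempotent:
  assumes "graded_right_ideal A G I"
  shows "I \<cdot> I = I"
proof -
  have I: "right_ideal A I" "\<forall>x\<in>I. \<forall>n. pr n x \<in> I" using assms by (auto simp: graded_right_ideal_iff)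
  then have ag: "additive_subgroup I A" and cl: "\<And>x a. x \<in> I \<Longrightarrow> a \<in> carrier A \<Longrightarrow> x \<otimes> a \<in> I"
    by (auto simp: right_ideal_def)
  have "\<exists>y\<in>I. \<exists>z\<in>I. x = y \<otimes> z" if x: "x \<in> I" "x \<in> G n" for x n
  proof -
    obtain y where y: "y \<in> G (- n)" "x \<otimes> y \<otimes> x = x" using regular x by blast
    then have "x \<otimes> y \<in> I" using cl x by simp
    then show ?thesis using y x by metis
  qed
  then have "I \<subseteq> I \<cdot> I" using ideal_prod_self_mem[OF ag I(2)] by blast
  moreover have "I \<cdot> I \<subseteq> I"
    using ag cl right_ideal_subset[OF I(1)] by (intro ideal_prod_self_subset) auto
  ultimately show ?thesis by blast
qed

theorem graded_left_ideal_idempotent: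
  assumes "graded_left_ideal A G I"
  shows "I \<cdot> I = I"
proof -
  have I: "left_ideal A I" "\<forall>x\<in>I. \<forall>n. pr n x \<in> I" using assms by (auto simp: graded_left_ideal_iff)
  then have ag: "additive_subgroup I A" and cl: "\<And>x a. x \<in> I \<Longrightarrow> a \<in> carrier A \<Longrightarrow> a \<otimes> x \<in> I"
    by (auto simp: left_ideal_def)
  have "\<exists>y\<in>I. \<exists>z\<in>I. x = y \<otimes> z" if x: "x \<in> I" "x \<in> G n" for x n
  proof -
    obtain y where y: "y \<in> G (- n)" "x \<otimes> y \<otimes> x = x" using regular x by blast
    then have "y \<otimes> x \<in> I" "x = x \<otimes> (y \<otimes> x)" using cl x by (simp_all add: mult_assoc)
    then show ?thesis using x by blast
  qed
  then have "I \<subseteq> I \<cdot> I" using ideal_prod_self_mem[OF ag I(2)] by blast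
  moreover have "I \<cdot> I \<subseteq> I"
    using ag cl left_ideal_subset[OF I(1)] by (intro ideal_prod_self_subset) auto
  ultimately show ?thesis by blast
qed

text \<open>Idempotence gives \<open>J = J J\<close>, so a hypothesis on \<open>J J\<close> is one
  on \<open>J\<close>.\<close>

theorem graded_ideal_semiprime:
  assumes "graded_ideal A G I"
  shows "graded_semiprime A G I"
  unfolding graded_semiprime_def
proof (intro conjI allI impI)
  fix J assume "graded_ideal A G J" "J \<cdot> J \<subseteq> I"
  then show "J \<subseteq> I"
    using graded_right_ideal_idempotent[of J]
    by (simp add: graded_ideal_def graded_right_ideal_def twosided_ideal_def)
qed (fact assms)

text \<open>A graded right ideal is determined by its part of degree 0: a homogeneous
  \<open>p = p y p\<close> lies in the right ideal generated by \<open>p y\<close>, and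
  \<open>p y\<close> has degree 0.\<close>

theorem graded_right_ideal_correspondence:
  "bij_betw (\<lambda>I. I \<inter> G 0) {I. graded_right_ideal A G I} {B. right_ideal (A\<lparr>carrier := G 0\<rparr>) B}"
proof -
  let ?A0 = "A\<lparr>carrier := G 0\<rparr>"
  have ag0: "abelian_group ?A0"
  proof (rule abelian_groupI, simp_all)
    fix x y z assume x: "x \<in> G 0" and y: "y \<in> G 0"
    show "x \<oplus> y \<in> G 0" using x y by (rule G_add)
    show "x \<oplus> y = y \<oplus> x" using x y by (simp add: a_comm)
    show "\<exists>y\<in>G 0. y \<oplus> x = \<zero>" using G_minus[OF x] x by (intro bexI[of _ "\<ominus> x"]) (simp_all add: l_neg)
    show "\<lbrakk>z \<in> G 0\<rbrakk> \<Longrightarrow> x \<oplus> y \<oplus> z = x \<oplus> (y \<oplus> z)" using x y by (simp add: a_assoc)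
  qed
  \<comment> \<open>The additive inverse is defined through the carrier of the record, so its
    agreement with the one of \<open>A\<close> has to be checked after the carrier is
    restricted.\<close>
  have inv0: "\<ominus>\<^bsub>?A0\<^esub> x = \<ominus> x" if "x \<in> G 0" for x
    using abelian_group.minus_equality[OF ag0, of "\<ominus> x" x] that by (simp add: G_minus l_neg)
  have asg0: "additive_subgroup B ?A0 \<longleftrightarrow> B \<subseteq> G 0 \<and> \<zero> \<in> B \<and>
     (\<forall>x\<in>B. \<forall>y\<in>B. x \<oplus> y \<in> B) \<and> (\<forall>x\<in>B. \<ominus> x \<in> B)" for B
  proof -
    have "(\<forall>x\<in>B. \<ominus>\<^bsub>?A0\<^esub> x \<in> B) \<longleftrightarrow> (\<forall>x\<in>B. \<ominus> x \<in> B)" if "B \<subseteq> G 0"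
      using that inv0 by (metis subsetD)
    then show ?thesis using subgroup_add_monoid_iff[OF ag0, of B] by auto
  qed
  show ?thesis
  proof (rule bij_betw_imageI)
    show "inj_on (\<lambda>I. I \<inter> G 0) {I. graded_right_ideal A G I}"
    proof (rule inj_onI)
      have le: "I \<subseteq> J" if I: "graded_right_ideal A G I" and J: "graded_right_ideal A G J"
        and eq: "I \<inter> G 0 = J \<inter> G 0" for I J
      proof
        fix x assume x: "x \<in> I"
        have xc: "x \<in> carrier A" using x I right_ideal_subset unfolding graded_right_ideal_def by blast
        show "x \<in> J"
        proof (rule mem_subgroup_of_pr[OF _ xc])
          show "additive_subgroup J A" using J by (simp add: graded_right_ideal_def right_ideal_def)
          fix n
          let ?p = "pr n x"
          have p: "?p \<in> G n" "?p \<in> I" using x xc I pr_closed by (auto simp: graded_right_ideal_iff)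
          obtain y where y: "y \<in> G (- n)" "?p \<otimes> y \<otimes> ?p = ?p" using regular p by blast
          have "?p \<otimes> y \<in> I \<inter> G 0"
            using p y I G_mult[OF p(1) y(1)] by (simp add: graded_right_ideal_def right_ideal_def)
          then have "?p \<otimes> y \<in> J" using eq by blast
          then have "?p \<otimes> y \<otimes> ?p \<in> J" using J p by (simp add: graded_right_ideal_def right_ideal_def)
          then show "?p \<in> J" using y by simp
        qed
      qed
      fix I J assume "I \<in> {I. graded_right_ideal A G I}" "J \<in> {I. graded_right_ideal A G I}" "I \<inter> G 0 = J \<inter> G 0"
      then show "I = J" using le[of I J] le[of J I] by auto
    qed
    show "(\<lambda>I. I \<inter> G 0) ` {I. graded_right_ideal A G I} = {B. right_ideal ?A0 B}"
    proof (intro equalityI subsetI)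
      fix B assume "B \<in> (\<lambda>I. I \<inter> G 0) ` {I. graded_right_ideal A G I}"
      then obtain I where I: "graded_right_ideal A G I" "B = I \<inter> G 0" by blast
      then show "B \<in> {B. right_ideal ?A0 B}"
        using G_mult[of _ 0 _ 0]
        by (auto simp: graded_right_ideal_def right_ideal_def asg0 additive_subgroup_iff G_add G_minus)
    next
      fix B assume "B \<in> {B. right_ideal ?A0 B}"
      then have B: "B \<subseteq> G 0" "\<zero> \<in> B" "\<And>x y. x \<in> B \<Longrightarrow> y \<in> B \<Longrightarrow> x \<oplus> y \<in> B" "\<And>x. x \<in> B \<Longrightarrow> \<ominus> x \<in> B"
        "\<And>x a. x \<in> B \<Longrightarrow> a \<in> G 0 \<Longrightarrow> x \<otimes> a \<in> B"
        by (auto simp: right_ideal_def asg0)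
      define I where "I = {x \<in> carrier A. \<forall>n. \<forall>y \<in> G (- n). pr n x \<otimes> y \<in> B}"
      have ag: "additive_subgroup I A"
        unfolding additive_subgroup_iff I_def
        using B by (auto simp: pr_add pr_minus distr_right minus_mult_left)
      \<comment> \<open>Testing \<open>x a\<close> against \<open>y\<close> amounts to testing
        \<open>x\<close> against \<open>a y\<close>, whose degree is again opposite to that of the
        component of \<open>x\<close> involved.\<close>
      have homr: "x \<otimes> a \<in> I" if x: "x \<in> I" and a: "a \<in> G d" for x a d
      proof -
        have "pr n (x \<otimes> a) \<otimes> y \<in> B" if y: "y \<in> G (- n)" for n y
        proof -
          have "pr n (x \<otimes> a) \<otimes> y = pr (n - d) x \<otimes> (a \<otimes> y)"
            using x a y by (simp add: I_def pr_mult_hom mult_assoc)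
          moreover have "a \<otimes> y \<in> G (- (n - d))" using G_mult[OF a y] by simp
          ultimately show ?thesis using x by (simp add: I_def)
        qed
        then show ?thesis using x a by (simp add: I_def)
      qed
      have Ic: "I \<subseteq> carrier A" by (auto simp: I_def)
      have mem: "x \<otimes> a \<in> I" if x: "x \<in> I" and a: "a \<in> carrier A" for x a
        using a
      proof (induction rule: graded_induct)
        case (hom a n)
        then show ?case using homr x by blast
      next
        case (add a b)
        then show ?case using ag x Ic by (auto simp: distr_left additive_subgroup_iff)
      qed
      have "pr n x \<in> I" if x: "x \<in> I" for x n
      proof -
        have "pr m (pr n x) = (if m = n then pr n x else \<zero>)" for m
          using pr_hom[OF pr_closed] x Ic by blast
        then show ?thesis using x B by (auto simp: I_def)
      qed
      then have gr: "graded_right_ideal A G I"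
        using ag mem by (auto simp: graded_right_ideal_iff right_ideal_def)
      \<comment> \<open>For \<open>x\<close> of degree 0 in \<open>I\<close>, regularity gives
        \<open>x = x (y x)\<close>, and \<open>y x\<close> is a test element of degree 0.
        Conversely, \<open>B\<close> absorbs \<open>G 0\<close> from the right.\<close>
      have "I \<inter> G 0 = B"
      proof (intro equalityI subsetI)
        fix x assume x: "x \<in> I \<inter> G 0"
        then obtain y where y: "y \<in> G (- 0)" "x \<otimes> y \<otimes> x = x" using regular by blast
        have "pr 0 x = x" using x pr_hom[of x 0 0] by simp
        moreover have "y \<otimes> x \<in> G (- 0)" using x y G_mult[of y 0 x 0] by simp
        moreover have "\<forall>y \<in> G (- 0). pr 0 x \<otimes> y \<in> B" using x unfolding I_def by blast
        ultimately have "x \<otimes> (y \<otimes> x) \<in> B" by metis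
        moreover have "x \<otimes> y \<otimes> x = x \<otimes> (y \<otimes> x)"
          using x y G_carrier by (intro mult_assoc) blast+
        ultimately show "x \<in> B" using y by simp
      next
        fix x assume x: "x \<in> B"
        then have "x \<in> G 0" using B by blast
        then show "x \<in> I \<inter> G 0" using x B by (auto simp: I_def pr_hom)
      qed
      then show "B \<in> (\<lambda>I. I \<inter> G 0) ` {I. graded_right_ideal A G I}" using gr by blast
    qed
  qed
qed

end

text \<open>Only the product changes, so carriers, additive subgroups and gradings are literally the
  same objects. Restricting the carrier commutes with the construction, which carries the degree-0
  part along.\<close>

definition opposite :: "('x, 'b) ring_scheme \<Rightarrow> ('x, 'b) ring_scheme" where
  "opposite A = A\<lparr>monoid.mult := \<lambda>x y. y \<otimes>\<^bsub>A\<^esub> x\<rparr>"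

lemma opposite_simps [simp]:
  "carrier (opposite A) = carrier A" "\<zero>\<^bsub>opposite A\<^esub> = \<zero>\<^bsub>A\<^esub>"
  "ring.add (opposite A) = ring.add A" "x \<otimes>\<^bsub>opposite A\<^esub> y = y \<otimes>\<^bsub>A\<^esub> x"
  "add_monoid (opposite A) = add_monoid A" "(opposite A)\<lparr>carrier := S\<rparr> = opposite (A\<lparr>carrier := S\<rparr>)"
  by (simp_all add: opposite_def)

lemma additive_subgroup_opposite [simp]: "additive_subgroup I (opposite A) = additive_subgroup I A"
  by (simp add: additive_subgroup_def)

lemma right_ideal_opposite [simp]: "right_ideal (opposite A) = left_ideal A"
  by (auto simp: fun_eq_iff right_ideal_def left_ideal_def)

lemma right_ideal_gen_opposite [simp]: "right_ideal_gen (opposite A) S = left_ideal_gen A S"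
  by (simp add: right_ideal_gen_def left_ideal_gen_def)

lemma graded_right_ideal_opposite [simp]:
  "graded_right_ideal (opposite A) G = graded_left_ideal A G"
  by (simp add: fun_eq_iff graded_right_ideal_def graded_left_ideal_def graded_subgroup_def)

context graded_regular_ring
begin

text \<open>The equation \<open>x y x = x\<close> reads the same in both directions, and degrees are
  added in a commutative group, so reversing the product respects them.\<close>

lemma graded_regular_opposite: "graded_regular_ring (opposite A) G pr"
proof (intro graded_regular_ring.intro graded_regular_ring_axioms.intro
    nonunital_ring.intro nonunital_ring_axioms.intro)
  show "abelian_group (opposite A)"
    using a_comm_monoid a_comm_group
    by (simp add: abelian_group_def abelian_monoid_def abelian_group_axioms_def)
  show "x \<otimes>\<^bsub>opposite A\<^esub> y \<in> G (m + n)" if "x \<in> G m" "y \<in> G n" for x y m n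
    using G_mult[OF that(2,1)] by (simp add: add.commute)
  show "\<exists>y \<in> G (- n). x \<otimes>\<^bsub>opposite A\<^esub> y \<otimes>\<^bsub>opposite A\<^esub> x = x" if x: "x \<in> G n" for x n
  proof -
    obtain y where "y \<in> G (- n)" "x \<otimes> y \<otimes> x = x" using regular x by blast
    then show ?thesis using x by (intro bexI[of _ y]) (simp_all add: mult_assoc)
  qed
  show "carrier (opposite A) \<subseteq> generate (add_monoid (opposite A)) (\<Union>n. G n)"
    using G_generates by simp
qed (simp_all add: mult_assoc distr_left distr_right pr_closed pr_add pr_hom G_subgroup)

lemmas fg_graded_left_ideal =
  graded_regular_ring.fg_graded_right_ideal[OF graded_regular_opposite, simplified]

lemmas graded_left_ideal_correspondence =
  graded_regular_ring.graded_right_ideal_correspondence[OF graded_regular_opposite, simplified]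

end


section \<open>Quotient modules and the graded Jacobson radical\<close>

text \<open>The module \<open>A/L\<close> of cosets. The action is a union over representatives, as
  for products of cosets in a factor ring; it collapses to a single coset when \<open>L\<close> is a
  left ideal.\<close>

definition quotient_module :: "('x, 'b) ring_scheme \<Rightarrow> 'x set \<Rightarrow> ('x, 'x set) module" where
  "quotient_module A L = \<lparr>carrier = a_rcosets\<^bsub>A\<^esub> L, monoid.mult = undefined, one = undefined,
     ring.zero = L, add = set_add A, smult = (\<lambda>a C. \<Union>x\<in>C. L +>\<^bsub>A\<^esub> (a \<otimes>\<^bsub>A\<^esub> x))\<rparr>"

context graded_regular_ring
begin

context
  fixes L
  assumes L: "left_ideal A L"
begin

interpretation L: abelian_subgroup L A
proof (rule abelian_subgroupI3)
  show "additive_subgroup L A" using L by (simp add: left_ideal_def)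
qed (fact abelian_group_axioms)

lemma L_subgroup: "additive_subgroup L A"
  using L by (simp add: left_ideal_def)

lemma L_mult: "a \<in> carrier A \<Longrightarrow> x \<in> L \<Longrightarrow> a \<otimes> x \<in> L"
  using L by (simp add: left_ideal_def)

lemma L_carrier: "x \<in> L \<Longrightarrow> x \<in> carrier A"
  by (rule L.a_Hcarr)

abbreviation "QM \<equiv> quotient_module A L"

lemma coset_eq_iff:
  assumes "a \<in> carrier A" "b \<in> carrier A"
  shows "L +> a = L +> b \<longleftrightarrow> a \<ominus> b \<in> L"
proof -
  have "L +> a = L +> b \<longleftrightarrow> a \<in> L +> b"
    using L.a_rcos_self[OF assms(1)] L.a_repr_independence'[OF _ assms(2), of a] by metis
  also have "\<dots> \<longleftrightarrow> a \<ominus> b \<in> L"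
    unfolding a_minus_def by (rule L.a_rcos_module[OF assms(2,1)])
  finally show ?thesis .
qed

lemma quotient_carrier: "carrier QM = (\<lambda>a. L +> a) ` carrier A"
  by (auto simp: quotient_module_def A_RCOSETS_def RCOSETS_def a_r_coset_def)

lemma coset_in_quotient [simp]: "a \<in> carrier A \<Longrightarrow> L +> a \<in> carrier QM"
  by (simp add: quotient_carrier)

lemma quotient_zero: "\<zero>\<^bsub>QM\<^esub> = L +> \<zero>"
  by (simp add: quotient_module_def L_carrier subsetI)

lemma quotient_add: "\<lbrakk>a \<in> carrier A; b \<in> carrier A\<rbrakk> \<Longrightarrow> (L +> a) \<oplus>\<^bsub>QM\<^esub> (L +> b) = L +> (a \<oplus> b)"
  by (simp add: quotient_module_def L.a_rcos_sum)

lemma coset_eq_zero: "a \<in> carrier A \<Longrightarrow> L +> a = \<zero>\<^bsub>QM\<^esub> \<longleftrightarrow> a \<in> L"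
  by (simp add: quotient_zero coset_eq_iff)

text \<open>The union runs over equal cosets: representatives \<open>x\<close> and \<open>y\<close>
  differ by an element of \<open>L\<close>, and \<open>a (y - x)\<close> stays in the left
  ideal.\<close>

lemma quotient_smult:
  assumes "a \<in> carrier A" "x \<in> carrier A"
  shows "a \<odot>\<^bsub>QM\<^esub> (L +> x) = L +> (a \<otimes> x)"
proof -
  have "L +> (a \<otimes> y) = L +> (a \<otimes> x)" if "y \<in> L +> x" for y
  proof -
    have yc: "y \<in> carrier A" using that assms L.a_elemrcos_carrier by blast
    have "L +> y = L +> x" using that assms by (metis L.a_repr_independence')
    then have "y \<ominus> x \<in> L" using yc assms coset_eq_iff by blast
    then have "a \<otimes> (y \<ominus> x) \<in> L" using assms L_mult by blast
    then show ?thesis using yc assms by (simp add: coset_eq_iff mult_diff)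
  qed
  moreover have "L +> x \<noteq> {}" using L.a_rcos_self[OF assms(2)] by blast
  ultimately have "(\<Union>y\<in>L +> x. L +> (a \<otimes> y)) = L +> (a \<otimes> x)"
    by (rule SUP_eq_const[rotated])
  then show ?thesis by (simp add: quotient_module_def)
qed

lemma quotient_abelian_group: "abelian_group QM"
proof (rule abelian_groupI)
  fix x y z assume xyz: "x \<in> carrier QM" "y \<in> carrier QM"
  obtain a where a: "x = L +> a" "a \<in> carrier A" using xyz(1) unfolding quotient_carrier by (rule imageE)
  obtain b where b: "y = L +> b" "b \<in> carrier A" using xyz(2) unfolding quotient_carrier by (rule imageE)
  show "x \<oplus>\<^bsub>QM\<^esub> y \<in> carrier QM" using a b by (simp add: quotient_add)
  show "x \<oplus>\<^bsub>QM\<^esub> y = y \<oplus>\<^bsub>QM\<^esub> x" using a b by (simp add: quotient_add a_comm)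
  show "\<zero>\<^bsub>QM\<^esub> \<oplus>\<^bsub>QM\<^esub> x = x" using a by (simp add: quotient_zero quotient_add)
  show "\<exists>y \<in> carrier QM. y \<oplus>\<^bsub>QM\<^esub> x = \<zero>\<^bsub>QM\<^esub>"
    using a by (intro bexI[of _ "L +> (\<ominus> a)"]) (simp_all add: quotient_zero quotient_add l_neg)
  assume z: "z \<in> carrier QM"
  obtain c where c: "z = L +> c" "c \<in> carrier A" using z unfolding quotient_carrier by (rule imageE)
  show "x \<oplus>\<^bsub>QM\<^esub> y \<oplus>\<^bsub>QM\<^esub> z = x \<oplus>\<^bsub>QM\<^esub> (y \<oplus>\<^bsub>QM\<^esub> z)"
    using a b c by (simp add: quotient_add a_assoc)
qed (simp add: quotient_zero)

lemma quotient_left_module: "left_module A QM"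
  unfolding left_module_def
  by (auto simp: quotient_abelian_group quotient_carrier quotient_smult quotient_add
      distr_left distr_right mult_assoc)

lemma quotient_minus: "a \<in> carrier A \<Longrightarrow> \<ominus>\<^bsub>QM\<^esub> (L +> a) = L +> (\<ominus> a)"
  using abelian_group.minus_equality[OF quotient_abelian_group, of "L +> (\<ominus> a)" "L +> a"]
  by (simp add: quotient_add l_neg quotient_zero)

lemma quotient_finsum:
  assumes "finite S" "g \<in> S \<rightarrow> carrier A"
  shows "finsum QM (\<lambda>i. L +> g i) S = L +> finsum A g S"
  using assms
proof (induction S rule: finite_induct)
  case empty
  then show ?case
    using abelian_monoid.finsum_empty[OF abelian_group.axioms(1)[OF quotient_abelian_group]]
    by (simp add: quotient_zero)
next
  case (insert a S)
  have "g a \<in> carrier A" "g \<in> S \<rightarrow> carrier A" using insert by auto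
  moreover have "finsum QM (\<lambda>i. L +> g i) (insert a S) = (L +> g a) \<oplus>\<^bsub>QM\<^esub> finsum QM (\<lambda>i. L +> g i) S"
    using insert calculation
    by (intro abelian_monoid.finsum_insert[OF abelian_group.axioms(1)[OF quotient_abelian_group]]) (auto simp: Pi_def)
  ultimately show ?case using insert by (simp add: quotient_add)
qed

text \<open>Since \<open>e\<close> is a right unit modulo \<open>L\<close>, every class
  \<open>L + a\<close> is \<open>a\<close> acting on the class of \<open>e\<close>.\<close>

lemma quotient_unital:
  assumes e: "e \<in> carrier A" "\<And>a. a \<in> carrier A \<Longrightarrow> a \<ominus> a \<otimes> e \<in> L"
  shows "unital_module A QM"
proof -
  let ?X = "{a \<odot>\<^bsub>QM\<^esub> x | a x. a \<in> carrier A \<and> x \<in> carrier QM}"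
  have "C \<in> ?X" if C: "C \<in> carrier QM" for C
  proof -
    obtain a where a: "C = L +> a" "a \<in> carrier A" using C unfolding quotient_carrier by (rule imageE)
    then have "C = a \<odot>\<^bsub>QM\<^esub> (L +> e)" using e by (simp add: quotient_smult coset_eq_iff)
    then show ?thesis using a e coset_in_quotient by blast
  qed
  then have "carrier QM \<subseteq> generate (add_monoid QM) ?X" by (meson generate.incl subsetI)
  moreover have "?X \<subseteq> carrier (add_monoid QM)"
    using quotient_left_module by (auto simp: left_module_def)
  then have "generate (add_monoid QM) ?X \<subseteq> carrier QM"
    using group.generate_incl[OF abelian_group.a_group[OF quotient_abelian_group], of ?X] by simp
  ultimately show ?thesis using quotient_left_module by (simp add: unital_module_def)
qed

text \<open>The parameter \<open>Q\<close> is gradedness for graded simple quotients and the trivial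
  property for simple ones. The preimage of \<open>N\<close> is a left ideal above \<open>L\<close>:
  if it contains \<open>e\<close>, it contains every \<open>a = a e + (a - a e)\<close>; otherwise
  it equals \<open>L\<close> by maximality.\<close>

lemma quotient_simple_aux:
  assumes e: "e \<in> carrier A" "\<And>a. a \<in> carrier A \<Longrightarrow> a \<ominus> a \<otimes> e \<in> L"
    and maxL: "\<And>L'. \<lbrakk>left_ideal A L'; Q L'; L \<subseteq> L'; e \<notin> L'\<rbrakk> \<Longrightarrow> L' = L"
    and N: "left_submodule A QM N" and Q: "Q {a \<in> carrier A. L +> a \<in> N}"
  shows "N = {\<zero>\<^bsub>QM\<^esub>} \<or> N = carrier QM"
proof -
  let ?L' = "{a \<in> carrier A. L +> a \<in> N}"
  have Nsub: "N \<subseteq> carrier QM" "\<zero>\<^bsub>QM\<^esub> \<in> N" "\<And>x y. \<lbrakk>x \<in> N; y \<in> N\<rbrakk> \<Longrightarrow> x \<oplus>\<^bsub>QM\<^esub> y \<in> N"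
      "\<And>x. x \<in> N \<Longrightarrow> \<ominus>\<^bsub>QM\<^esub> x \<in> N" "\<And>a x. \<lbrakk>a \<in> carrier A; x \<in> N\<rbrakk> \<Longrightarrow> a \<odot>\<^bsub>QM\<^esub> x \<in> N"
    using N subgroup_add_monoid_iff[OF quotient_abelian_group, of N] by (auto simp: left_submodule_def)
  have LL': "L \<subseteq> ?L'"
  proof
    fix x assume "x \<in> L"
    then have "x \<in> carrier A" "L +> x = \<zero>\<^bsub>QM\<^esub>" using L_carrier coset_eq_zero by auto
    then show "x \<in> ?L'" using Nsub by simp
  qed
  have l: "left_ideal A ?L'"
    unfolding left_ideal_def additive_subgroup_iff
  proof (intro conjI ballI)
    show "\<zero> \<in> ?L'" using Nsub(2) by (simp add: quotient_zero)
    fix x assume x: "x \<in> ?L'"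
    show "\<ominus> x \<in> ?L'" using x Nsub(4)[of "L +> x"] by (simp add: quotient_minus)
    show "x \<oplus> y \<in> ?L'" if "y \<in> ?L'" for y
      using x that Nsub(3)[of "L +> x" "L +> y"] by (simp add: quotient_add)
    show "a \<otimes> x \<in> ?L'" if "a \<in> carrier A" for a
      using x that Nsub(5)[of a "L +> x"] by (simp add: quotient_smult)
  qed blast
  have NL: "N = (\<lambda>a. L +> a) ` ?L'" using Nsub(1) by (auto simp: quotient_carrier)
  show ?thesis
  proof (cases "e \<in> ?L'")
    case True
    have "a \<in> ?L'" if a: "a \<in> carrier A" for a
    proof -
      have "a \<otimes> e \<in> ?L'" using l True a by (simp add: left_ideal_def)
      moreover have "a \<ominus> a \<otimes> e \<in> ?L'" using e a LL' by blast
      ultimately have "a \<otimes> e \<oplus> (a \<ominus> a \<otimes> e) \<in> ?L'"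
        using l by (simp add: left_ideal_def additive_subgroup_iff)
      then show ?thesis using e a by (simp add: add_diff_cancel)
    qed
    then have "?L' = carrier A" by blast
    then show ?thesis using NL by (simp add: quotient_carrier)
  next
    case False
    then have "?L' = L" using maxL l LL' Q by blast
    then have "N = (\<lambda>a. L +> a) ` L" using NL by simp
    also have "\<dots> = {\<zero>\<^bsub>QM\<^esub>}"
    proof -
      have "L +> a = \<zero>\<^bsub>QM\<^esub>" if "a \<in> L" for a using that L_carrier coset_eq_zero by blast
      moreover have "\<zero> \<in> L" using L_subgroup by (simp add: additive_subgroup_iff)
      ultimately show ?thesis by blast
    qed
    finally show ?thesis ..
  qed
qed

end

text \<open>Zorn's lemma for left ideals avoiding \<open>e\<close>. A union of a chain avoiding
  \<open>e\<close> again avoids \<open>e\<close>, whereas in a ring without unit a union of proper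
  left ideals may be everything.\<close>

lemma maximal_left_ideal:
  assumes L0: "left_ideal A L0" "Q L0" "e \<notin> L0"
    and chain: "\<And>C. \<lbrakk>C \<noteq> {}; \<And>L. L \<in> C \<Longrightarrow> Q L\<rbrakk> \<Longrightarrow> Q (\<Union>C)"
  shows "\<exists>L. left_ideal A L \<and> Q L \<and> L0 \<subseteq> L \<and> e \<notin> L \<and>
    (\<forall>L'. left_ideal A L' \<longrightarrow> Q L' \<longrightarrow> L \<subseteq> L' \<longrightarrow> e \<notin> L' \<longrightarrow> L' = L)"
proof -
  let ?F = "{L. left_ideal A L \<and> Q L \<and> L0 \<subseteq> L \<and> e \<notin> L}"
  have "\<exists>Y\<in>?F. \<forall>Z\<in>?F. Y \<subseteq> Z \<longrightarrow> Z = Y"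
  proof (rule subset_Zorn_nonempty)
    show "?F \<noteq> {}" using L0 by blast
    fix C assume C: "C \<noteq> {}" "subset.chain ?F C"
    have CF: "\<And>L. L \<in> C \<Longrightarrow> left_ideal A L \<and> Q L \<and> L0 \<subseteq> L \<and> e \<notin> L"
      and tot: "\<And>Z Y. Z \<in> C \<Longrightarrow> Y \<in> C \<Longrightarrow> Z \<subseteq> Y \<or> Y \<subseteq> Z"
      using C by (auto simp: subset_chain_def)
    have ind: "L \<subseteq> carrier A" "\<zero> \<in> L" "\<And>x y. x \<in> L \<Longrightarrow> y \<in> L \<Longrightarrow> x \<oplus> y \<in> L" "\<And>x. x \<in> L \<Longrightarrow> \<ominus> x \<in> L"
      "\<And>a x. a \<in> carrier A \<Longrightarrow> x \<in> L \<Longrightarrow> a \<otimes> x \<in> L" if "L \<in> C" for L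
      using CF[OF that] by (auto simp: left_ideal_def additive_subgroup_iff)
    have "left_ideal A (\<Union>C)"
      unfolding left_ideal_def additive_subgroup_iff
    proof (intro conjI ballI)
      show "\<Union>C \<subseteq> carrier A" using ind(1) by blast
      show "\<zero> \<in> \<Union>C" using ind(2) C(1) by blast
      show "x \<oplus> y \<in> \<Union>C" if xy: "x \<in> \<Union>C" "y \<in> \<Union>C" for x y
      proof -
        obtain Z Y where XY: "Z \<in> C" "x \<in> Z" "Y \<in> C" "y \<in> Y" using xy by blast
        show ?thesis using tot[OF XY(1,3)]
        proof
          assume "Z \<subseteq> Y" then show ?thesis using ind(3)[OF XY(3)] XY by blast
        next
          assume "Y \<subseteq> Z" then show ?thesis using ind(3)[OF XY(1)] XY by blast
        qed
      qed
      show "\<ominus> x \<in> \<Union>C" if "x \<in> \<Union>C" for x using ind(4) that by blast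
      show "a \<otimes> x \<in> \<Union>C" if "x \<in> \<Union>C" "a \<in> carrier A" for a x using ind(5) that by blast
    qed
    moreover have "Q (\<Union>C)" using chain C(1) CF by blast
    moreover have "L0 \<subseteq> \<Union>C" "e \<notin> \<Union>C" using CF C(1) by blast+
    ultimately show "\<Union>C \<in> ?F" by blast
  qed
  then obtain L where L: "L \<in> ?F" "\<forall>Z\<in>?F. L \<subseteq> Z \<longrightarrow> Z = L" by (rule bexE)
  show ?thesis
  proof (intro exI[of _ L] conjI allI impI)
    fix L' assume L': "left_ideal A L'" "Q L'" "L \<subseteq> L'" "e \<notin> L'"
    then have "L' \<in> ?F" using L(1) by (simp add: order_trans[of L0 L L'])
    then show "L' = L" using L(2) L'(3) by simp
  qed (use L(1) in simp_all)
qed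

text \<open>Additivity of the action in the ring variable gives \<open>0 x + 0 x = 0 x\<close>, from
  which \<open>0 x\<close> is cancelled.\<close>

lemma zero_in_annihilator:
  assumes M: "left_module A M"
  shows "\<zero> \<in> annihilator A M"
  unfolding annihilator_def
proof (intro CollectI conjI ballI)
  fix x assume x: "x \<in> carrier M"
  interpret M: abelian_group M using M by (simp add: left_module_def)
  have c: "\<zero> \<odot>\<^bsub>M\<^esub> x \<in> carrier M" using M x by (simp add: left_module_def)
  have "\<forall>a \<in> carrier A. \<forall>b \<in> carrier A. \<forall>x \<in> carrier M.
      (a \<oplus> b) \<odot>\<^bsub>M\<^esub> x = a \<odot>\<^bsub>M\<^esub> x \<oplus>\<^bsub>M\<^esub> b \<odot>\<^bsub>M\<^esub> x"
    using M by (simp add: left_module_def)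
  from this[rule_format, OF zero_closed zero_closed x]
  have "\<zero> \<odot>\<^bsub>M\<^esub> x \<oplus>\<^bsub>M\<^esub> \<zero> \<odot>\<^bsub>M\<^esub> x = \<zero> \<odot>\<^bsub>M\<^esub> x" by simp
  then show "\<zero> \<odot>\<^bsub>M\<^esub> x = \<zero>\<^bsub>M\<^esub>" using M.add.r_cancel_one'[OF c c] by simp
qed simp

text \<open>A nonzero component \<open>p\<close> of a radical element \<open>a\<close> is reached
  through the gradedness of \<open>L\<close>: from \<open>a e \<in> L\<close> its component
  \<open>p e = p\<close> lies in \<open>L\<close>, and so does \<open>e = y p\<close>, although
  \<open>L\<close> avoids \<open>e\<close>.\<close>

theorem graded_jacobson_radical_zero: "graded_jacobson_radical A G = {\<zero>}"
proof
  show "{\<zero>} \<subseteq> graded_jacobson_radical A G"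
    using zero_in_annihilator
    by (auto simp: graded_jacobson_radical_def graded_simple_module_def graded_module_def)
  show "graded_jacobson_radical A G \<subseteq> {\<zero>}"
  proof (rule ccontr)
    assume "\<not> graded_jacobson_radical A G \<subseteq> {\<zero>}"
    then obtain a where aJ: "a \<in> graded_jacobson_radical A G" and "a \<noteq> \<zero>" by blast
    then have a: "a \<in> carrier A" "a \<noteq> \<zero>" by (simp_all add: graded_jacobson_radical_def)
    have ann: "a \<odot>\<^bsub>M\<^esub> x = \<zero>\<^bsub>M\<^esub>" if M: "graded_simple_module A G M D" "x \<in> carrier M"
      for M :: "('x, 'x set) module" and D x
    proof -
      have "a \<in> annihilator A M" using aJ M(1) unfolding graded_jacobson_radical_def by auto
      then show ?thesis using M(2) by (simp add: annihilator_def)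
    qed
    obtain n where n: "pr n a \<noteq> \<zero>" using supp_empty[OF a] by (auto simp: supp_def)
    define p where "p = pr n a"
    have p: "p \<in> G n" "p \<noteq> \<zero>" using a n pr_closed by (auto simp: p_def)
    obtain y where y: "y \<in> G (- n)" "p \<otimes> y \<otimes> p = p" using regular p by blast
    define e where "e = y \<otimes> p"
    have e: "e \<in> G 0" using G_mult[OF y(1) p(1)] by (simp add: e_def)
    have [simp]: "e \<in> carrier A" "p \<in> carrier A" "y \<in> carrier A" using e p y G_carrier by auto
    have pe: "p \<otimes> e = p" using y by (simp add: e_def mult_assoc)
    have ee: "e \<otimes> e = e" using pe by (simp add: e_def mult_assoc)
    define Q where "Q = (\<lambda>L. \<forall>x\<in>L. \<forall>n. pr n x \<in> L)"
    \<comment> \<open>The smallest left ideal modulo which \<open>e\<close> is a right unit. As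
      \<open>e\<close> is idempotent, it equals the left annihilator of \<open>e\<close>; gradedness
      and \<open>e \<notin> L0\<close> are read off from this description.\<close>
    define L0 where "L0 = (\<lambda>a. a \<ominus> a \<otimes> e) ` carrier A"
    have L0k: "L0 = {x \<in> carrier A. x \<otimes> e = \<zero>}"
    proof -
      have "(b \<ominus> b \<otimes> e) \<otimes> e = \<zero>" if "b \<in> carrier A" for b
        using that by (simp add: diff_mult mult_assoc ee)
      moreover have "b = b \<ominus> b \<otimes> e" if "b \<in> carrier A" "b \<otimes> e = \<zero>" for b
        using that by simp
      ultimately show ?thesis unfolding L0_def by (auto intro!: image_eqI)
    qed
    have "left_ideal A L0"
      unfolding L0k left_ideal_def additive_subgroup_iff
      by (auto simp: distr_right minus_mult_left mult_assoc)
    moreover have "Q L0"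
      unfolding Q_def L0k
    proof (intro ballI allI)
      fix x m assume x: "x \<in> {x \<in> carrier A. x \<otimes> e = \<zero>}"
      then have xe: "x \<in> carrier A" "x \<otimes> e = \<zero>" by blast+
      have "pr m x \<otimes> e = \<zero>"
        using pr_mult_hom[OF xe(1) e, of m] xe(2) pr_zero[of m] by (metis diff_0_right)
      then show "pr m x \<in> {x \<in> carrier A. x \<otimes> e = \<zero>}" using x by simp
    qed
    moreover have "e \<notin> L0"
    proof
      assume "e \<in> L0"
      then have "e = \<zero>" using ee by (simp add: L0k)
      then show False using pe p by simp
    qed
    moreover have "Q (\<Union>C)" if "\<And>L. L \<in> C \<Longrightarrow> Q L" for C using that by (auto simp: Q_def)
    ultimately obtain L where L: "left_ideal A L" "Q L" "L0 \<subseteq> L" "e \<notin> L"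
      and maxL: "\<And>L'. \<lbrakk>left_ideal A L'; Q L'; L \<subseteq> L'; e \<notin> L'\<rbrakk> \<Longrightarrow> L' = L"
      using maximal_left_ideal[of L0 Q e] by (metis (no_types, lifting))
    let ?M = "quotient_module A L"
    define D where "D = (\<lambda>n. (\<lambda>a. L +> a) ` G n)"
    note ab = quotient_abelian_group[OF L(1)]
    interpret M: abelian_group ?M by (rule ab)
    have eL: "b \<ominus> b \<otimes> e \<in> L" if "b \<in> carrier A" for b using L(3) that by (auto simp: L0_def)
    have ag: "additive_subgroup L A" using L(1) by (simp add: left_ideal_def)
    have Lc: "L \<subseteq> carrier A" using ag by (simp add: additive_subgroup_iff)
    have z0: "\<zero> \<in> L" using ag by (simp add: additive_subgroup_iff)
    \<comment> \<open>Gradedness of \<open>L\<close> lets the projections descend to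
      classes.\<close>
    have prC: "pr n b \<ominus> pr n c \<in> L" if "b \<in> carrier A" "c \<in> carrier A" "L +> b = L +> c" for b c n
    proof -
      have "b \<ominus> c \<in> L" using coset_eq_iff[OF L(1)] that by blast
      then have "pr n (b \<ominus> c) \<in> L" using L(2) by (simp add: Q_def)
      then show ?thesis using that by (simp add: pr_diff)
    qed
    have Dag: "additive_subgroup (D n) ?M" for n
      unfolding subgroup_add_monoid_iff[OF ab] D_def
      using quotient_add[OF L(1)] quotient_minus[OF L(1)] quotient_zero[OF L(1)] coset_in_quotient[OF L(1)]
      by (auto simp: G_add G_minus intro!: image_eqI)
    \<comment> \<open>Existence comes from the components of a representative \<open>x\<close>. For
      uniqueness, homogeneous representatives \<open>b n\<close> of any other decomposition add up
      to \<open>x\<close> modulo \<open>L\<close>, and projecting compares them with the components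
      of \<open>x\<close>.\<close>
    have Dec: "\<exists>!h. (\<forall>n. h n \<in> D n) \<and> finite {n. h n \<noteq> \<zero>\<^bsub>?M\<^esub>} \<and>
        Z = finsum ?M h {n. h n \<noteq> \<zero>\<^bsub>?M\<^esub>}" if Z: "Z \<in> carrier ?M" for Z
    proof -
      obtain x where x: "Z = L +> x" "x \<in> carrier A"
        using Z unfolding quotient_carrier[OF L(1)] by (rule imageE)
      have cz: "L +> b = \<zero>\<^bsub>?M\<^esub> \<longleftrightarrow> b \<in> L" if "b \<in> carrier A" for b
        using coset_eq_zero[OF L(1)] that by blast
      show ?thesis
      proof (rule ex1I[of _ "\<lambda>n. L +> pr n x"], intro conjI allI)
        show "L +> pr n x \<in> D n" for n using x pr_closed by (auto simp: D_def)
        have sub: "{n. L +> pr n x \<noteq> \<zero>\<^bsub>?M\<^esub>} \<subseteq> supp x"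
          using x cz[OF pr_carrier] z0 by (auto simp: supp_def)
        show "finite {n. L +> pr n x \<noteq> \<zero>\<^bsub>?M\<^esub>}" using sub finite_supp[OF x(2)] finite_subset by blast
        have "Z = finsum ?M (\<lambda>n. L +> pr n x) (supp x)"
          using quotient_finsum[OF L(1), of "supp x" "\<lambda>n. pr n x"] finite_supp[OF x(2)] x
            decomposition[OF x(2) _ order_refl] by simp
        also have "\<dots> = finsum ?M (\<lambda>n. L +> pr n x) {n. L +> pr n x \<noteq> \<zero>\<^bsub>?M\<^esub>}"
          using sub finite_supp[OF x(2)] x coset_in_quotient[OF L(1)]
          by (intro M.add.finprod_mono_neutral_cong_right) auto
        finally show "Z = finsum ?M (\<lambda>n. L +> pr n x) {n. L +> pr n x \<noteq> \<zero>\<^bsub>?M\<^esub>}" .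
      next
        fix h assume h: "(\<forall>n. h n \<in> D n) \<and> finite {n. h n \<noteq> \<zero>\<^bsub>?M\<^esub>} \<and>
          Z = finsum ?M h {n. h n \<noteq> \<zero>\<^bsub>?M\<^esub>}"
        let ?S = "{n. h n \<noteq> \<zero>\<^bsub>?M\<^esub>}"
        have "\<forall>n. \<exists>b. b \<in> G n \<and> h n = L +> b" using h by (auto simp: D_def)
        then obtain b where b: "\<And>n. b n \<in> G n" "\<And>n. h n = L +> b n" by metis
        have bS: "b \<in> ?S \<rightarrow> carrier A" using G_carrier[OF b(1)] by (rule funcsetI)
        have "Z = finsum ?M (\<lambda>n. L +> b n) ?S" using h b(2) by (metis (no_types, lifting) ext)
        then have "L +> x = L +> finsum A b ?S" using x quotient_finsum[OF L(1) _ bS] h by simp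
        moreover have fc: "finsum A b ?S \<in> carrier A" using bS by (rule finsum_closed)
        ultimately have d: "pr n x \<ominus> pr n (finsum A b ?S) \<in> L" for n using prC x by blast
        have pb: "pr n (finsum A b ?S) = (if n \<in> ?S then b n else \<zero>)" for n
        proof -
          have "pr n (finsum A b ?S) = finsum A (\<lambda>i. pr n (b i)) ?S" using h bS by (intro pr_finsum) auto
          moreover have "finsum A (\<lambda>i. pr n (b i)) ?S = pr n (b n)" if "n \<in> ?S"
          proof (rule finsum_single)
            show "finite ?S" using h by (elim conjE)
          qed (use that in \<open>simp_all add: pr_hom[OF b(1)] G_carrier[OF b(1)]\<close>)
          moreover have "finsum A (\<lambda>i. pr n (b i)) ?S = \<zero>" if "n \<notin> ?S"
            using that pr_hom[OF b(1)] by (intro finsum_const_zero) auto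
          ultimately show ?thesis by (simp add: pr_hom[OF b(1)])
        qed
        show "h = (\<lambda>n. L +> pr n x)"
        proof
          fix n
          show "h n = L +> pr n x"
          proof (cases "n \<in> ?S")
            case True
            then have "pr n x \<ominus> b n \<in> L" using d[of n] pb[of n] by simp
            then have "L +> pr n x = L +> b n" using coset_eq_iff[OF L(1), of "pr n x" "b n"] x G_carrier[OF b(1)] by simp
            then show ?thesis using b(2) by simp
          next
            case False
            then have "pr n x \<in> L" using d[of n] pb[of n] x by simp
            then have "L +> pr n x = \<zero>\<^bsub>?M\<^esub>" using cz x by simp
            then show ?thesis using False by simp
          qed
        qed
      qed
    qed
    have "graded_module A G ?M D"
      unfolding graded_module_def
    proof (intro conjI allI ballI)
      show "left_module A ?M" by (rule quotient_left_module[OF L(1)])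
      fix b Z m n assume "b \<in> G m" "Z \<in> D n"
      then show "b \<odot>\<^bsub>?M\<^esub> Z \<in> D (m + n)"
        using G_mult quotient_smult[OF L(1)] by (auto simp: D_def intro!: image_eqI)
    qed (use Dag Dec in auto)
    moreover have "N = {\<zero>\<^bsub>?M\<^esub>} \<or> N = carrier ?M"
      if N: "left_submodule A ?M N" "graded_subgroup ?M D N" for N
    proof (rule quotient_simple_aux[OF L(1), where Q = Q and e = e])
      have Nag: "additive_subgroup N ?M" using N by (simp add: left_submodule_def)
      have Ns: "N \<subseteq> carrier ?M" "\<zero>\<^bsub>?M\<^esub> \<in> N" "\<And>x y. \<lbrakk>x \<in> N; y \<in> N\<rbrakk> \<Longrightarrow> x \<oplus>\<^bsub>?M\<^esub> y \<in> N"
        "\<And>x. x \<in> N \<Longrightarrow> \<ominus>\<^bsub>?M\<^esub> x \<in> N"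
        using Nag by (simp_all add: subgroup_add_monoid_iff[OF ab])
      \<comment> \<open>For submodules of \<open>A/L\<close>, gradedness is expressed by homogeneous
        generators. The set \<open>K\<close> contains these generators and their negatives and is
        closed under sums, hence contains \<open>N\<close>; this turns gradedness of
        \<open>N\<close> into stability of its preimage under projections.\<close>
      define K where "K = {C. \<exists>c\<in>carrier A. C = L +> c \<and> (\<forall>n. L +> pr n c \<in> N)}"
      have Kadd: "C \<oplus>\<^bsub>?M\<^esub> C' \<in> K" if C: "C \<in> K" "C' \<in> K" for C C'
      proof -
        obtain c where c: "c \<in> carrier A" "C = L +> c" "\<And>n. L +> pr n c \<in> N"
          using C(1) unfolding K_def by blast
        obtain c' where c': "c' \<in> carrier A" "C' = L +> c'" "\<And>n. L +> pr n c' \<in> N"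
          using C(2) unfolding K_def by blast
        have "L +> pr n (c \<oplus> c') \<in> N" for n
          using Ns(3)[OF c(3) c'(3), of n n] quotient_add[OF L(1)] c(1) c'(1) by (simp add: pr_add)
        moreover have "C \<oplus>\<^bsub>?M\<^esub> C' = L +> (c \<oplus> c')" using c c' quotient_add[OF L(1)] by simp
        moreover have "c \<oplus> c' \<in> carrier A" using c(1) c'(1) by simp
        ultimately show ?thesis unfolding K_def by blast
      qed
      have Khom: "C \<in> K" if C: "C \<in> N" "C \<in> D m" for C m
      proof -
        obtain c where c: "C = L +> c" "c \<in> G m" using C(2) unfolding D_def by (rule imageE)
        have "L +> pr n c \<in> N" for n
          using C(1) c(1) Ns(2) quotient_zero[OF L(1)] pr_hom[OF c(2), of n] by simp
        then show ?thesis using c G_carrier unfolding K_def by blast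
      qed
      have NK: "C \<in> K" if "C \<in> N" for C
      proof -
        have "C \<in> generate (add_monoid ?M) (N \<inter> homogeneous D)"
          using N(2) that unfolding graded_subgroup_def by blast
        then show ?thesis
        proof (induction rule: generate.induct)
          case one
          have "\<zero>\<^bsub>?M\<^esub> \<in> D 0" using Dag[of 0] by (simp add: subgroup_add_monoid_iff[OF ab])
          then show ?case using Khom Ns(2) by simp
        next
          case (incl h)
          then show ?case using Khom by (auto simp: homogeneous_def)
        next
          case (inv h)
          then obtain m where h: "h \<in> N" "h \<in> D m" by (auto simp: homogeneous_def)
          have "\<ominus>\<^bsub>?M\<^esub> h \<in> N" using Ns(4) h(1) by simp
          moreover have "\<ominus>\<^bsub>?M\<^esub> h \<in> D m" using Dag[of m] h(2) by (simp add: subgroup_add_monoid_iff[OF ab])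
          ultimately have "\<ominus>\<^bsub>?M\<^esub> h \<in> K" by (rule Khom)
          then show ?case by (simp add: a_inv_def)
        next
          case (eng h1 h2)
          then show ?case using Kadd by simp
        qed
      qed
      show "Q {b \<in> carrier A. L +> b \<in> N}"
        unfolding Q_def
      proof (intro ballI allI CollectI conjI)
        fix b n assume "b \<in> {b \<in> carrier A. L +> b \<in> N}"
        then have b: "b \<in> carrier A" "L +> b \<in> N" by simp_all
        show "pr n b \<in> carrier A" using b(1) by simp
        have "L +> b \<in> K" using b(2) by (rule NK)
        then obtain c where c: "c \<in> carrier A" "L +> b = L +> c" "\<And>n. L +> pr n c \<in> N"
          unfolding K_def by blast
        have "L +> pr n b = L +> pr n c"
          using coset_eq_iff[OF L(1), of "pr n b" "pr n c"] prC[OF b(1) c(1,2)] b c by simp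
        then show "L +> pr n b \<in> N" using c(3) by simp
      qed
      show "left_submodule A ?M N" by fact
    qed (use eL maxL in auto)
    moreover have "carrier ?M \<noteq> {\<zero>\<^bsub>?M\<^esub>}"
    proof
      assume "carrier ?M = {\<zero>\<^bsub>?M\<^esub>}"
      then have "L +> e = \<zero>\<^bsub>?M\<^esub>" using coset_in_quotient[OF L(1), of e] by simp
      then show False using coset_eq_zero[OF L(1), of e] L by simp
    qed
    ultimately have "graded_simple_module A G ?M D"
      using quotient_unital[OF L(1), of e] eL by (simp add: graded_simple_module_def)
    then have "a \<odot>\<^bsub>?M\<^esub> (L +> e) = \<zero>\<^bsub>?M\<^esub>" using ann coset_in_quotient[OF L(1), of e] by simp
    then have "a \<otimes> e \<in> L" using quotient_smult[OF L(1), of a e] coset_eq_zero[OF L(1), of "a \<otimes> e"] a by simp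
    then have "pr n (a \<otimes> e) \<in> L" using L(2) by (simp add: Q_def)
    then have "p \<in> L" using pr_mult_hom[of a e 0 n] a e pe by (simp add: p_def)
    then have "y \<otimes> p \<in> L" using L(1) by (simp add: left_ideal_def)
    then show False using L(4) by (simp add: e_def)
  qed
qed

end


section \<open>The Jacobson radical\<close>

context graded_regular_ring
begin

text \<open>These rules make the Jacobson radical a two-sided ideal; an intersection of annihilators
  inherits each of them.\<close>

lemma annihilator_closed:
  assumes M: "left_module A M"
  shows "\<lbrakk>x \<in> annihilator A M; y \<in> annihilator A M\<rbrakk> \<Longrightarrow> x \<oplus> y \<in> annihilator A M"
    and "x \<in> annihilator A M \<Longrightarrow> \<ominus> x \<in> annihilator A M"
    and "\<lbrakk>x \<in> annihilator A M; a \<in> carrier A\<rbrakk> \<Longrightarrow> a \<otimes> x \<in> annihilator A M"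
    and "\<lbrakk>x \<in> annihilator A M; a \<in> carrier A\<rbrakk> \<Longrightarrow> x \<otimes> a \<in> annihilator A M"
proof -
  interpret M: abelian_group M using M by (simp add: left_module_def)
  have cl: "a \<odot>\<^bsub>M\<^esub> m \<in> carrier M" if "a \<in> carrier A" "m \<in> carrier M" for a m
    using M that by (simp add: left_module_def)
  have add: "(a \<oplus> b) \<odot>\<^bsub>M\<^esub> m = a \<odot>\<^bsub>M\<^esub> m \<oplus>\<^bsub>M\<^esub> b \<odot>\<^bsub>M\<^esub> m"
    if "a \<in> carrier A" "b \<in> carrier A" "m \<in> carrier M" for a b m
    using M that by (simp add: left_module_def)
  have mult: "(a \<otimes> b) \<odot>\<^bsub>M\<^esub> m = a \<odot>\<^bsub>M\<^esub> (b \<odot>\<^bsub>M\<^esub> m)"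
    if "a \<in> carrier A" "b \<in> carrier A" "m \<in> carrier M" for a b m
    using M that by (simp add: left_module_def)
  have addz: "a \<odot>\<^bsub>M\<^esub> (m \<oplus>\<^bsub>M\<^esub> n) = a \<odot>\<^bsub>M\<^esub> m \<oplus>\<^bsub>M\<^esub> a \<odot>\<^bsub>M\<^esub> n"
    if "a \<in> carrier A" "m \<in> carrier M" "n \<in> carrier M" for a m n
    using M that by (simp add: left_module_def)
  have z: "a \<odot>\<^bsub>M\<^esub> \<zero>\<^bsub>M\<^esub> = \<zero>\<^bsub>M\<^esub>" if "a \<in> carrier A" for a
    using addz[OF that M.zero_closed M.zero_closed] cl[OF that M.zero_closed]
    by (simp add: M.add.r_cancel_one')
  show "x \<oplus> y \<in> annihilator A M" if "x \<in> annihilator A M" "y \<in> annihilator A M" for x y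
    using that by (simp add: annihilator_def add)
  show "\<ominus> x \<in> annihilator A M" if x: "x \<in> annihilator A M" for x
    unfolding annihilator_def
  proof (intro CollectI conjI ballI)
    show "\<ominus> x \<in> carrier A" using x by (simp add: annihilator_def)
    fix m assume m: "m \<in> carrier M"
    have "(x \<oplus> \<ominus> x) \<odot>\<^bsub>M\<^esub> m = \<zero>\<^bsub>M\<^esub>"
      using x m zero_in_annihilator[OF M] by (simp add: r_neg annihilator_def)
    then show "(\<ominus> x) \<odot>\<^bsub>M\<^esub> m = \<zero>\<^bsub>M\<^esub>"
      using x m add[of x "\<ominus> x" m] cl[of "\<ominus> x" m] by (simp add: annihilator_def)
  qed
  show "a \<otimes> x \<in> annihilator A M" if "x \<in> annihilator A M" "a \<in> carrier A" for a x
    using that z by (simp add: annihilator_def mult)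
  show "x \<otimes> a \<in> annihilator A M" if "x \<in> annihilator A M" "a \<in> carrier A" for a x
    using that cl by (simp add: annihilator_def mult)
qed

lemma simple_left_module: "simple_module A M \<Longrightarrow> left_module A M"
  by (simp add: simple_module_def unital_module_def)

abbreviation "J \<equiv> jacobson_radical A"

lemma jacobson_iff: "x \<in> J \<longleftrightarrow> x \<in> carrier A \<and>
    (\<forall>M :: ('x, 'x set) module. simple_module A M \<longrightarrow> x \<in> annihilator A M)"
  by (simp add: jacobson_radical_def)

lemma jacobson_zero: "\<zero> \<in> J"
  by (simp add: jacobson_iff zero_in_annihilator simple_left_module)

lemma jacobson_carrier: "x \<in> J \<Longrightarrow> x \<in> carrier A"
  by (simp add: jacobson_iff)

lemma jacobson_minus: "x \<in> J \<Longrightarrow> \<ominus> x \<in> J"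
  by (simp add: jacobson_iff annihilator_closed simple_left_module)

lemma jacobson_diff:
  "\<lbrakk>x \<in> J; y \<in> J\<rbrakk> \<Longrightarrow> x \<ominus> y \<in> J"
  by (simp add: jacobson_iff annihilator_closed simple_left_module a_minus_def)

lemma jacobson_mult:
  "\<lbrakk>x \<in> J; a \<in> carrier A\<rbrakk> \<Longrightarrow> a \<otimes> x \<in> J"
  "\<lbrakk>x \<in> J; a \<in> carrier A\<rbrakk> \<Longrightarrow> x \<otimes> a \<in> J"
  by (simp_all add: jacobson_iff annihilator_closed simple_left_module)

text \<open>This is left invertibility of \<open>1 - x\<close> for radical \<open>x\<close>, with an
  idempotent \<open>f\<close> in place of the unit. If the left ideal \<open>L0\<close> missed
  \<open>f\<close>, a maximal left ideal \<open>L\<close> above it and avoiding \<open>f\<close>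
  would give a simple module \<open>A/L\<close> killed by \<open>x\<close>. Then
  \<open>x = x f\<close> lies in \<open>L\<close>, and so does
  \<open>f = f x + (f - f x)\<close>.\<close>

lemma jacobson_left_inverse:
  assumes x: "x \<in> J" and f: "f \<in> carrier A" "f \<otimes> f = f" and xf: "x \<otimes> f = x"
  shows "\<exists>w \<in> carrier A. w \<otimes> (f \<ominus> x) = f"
proof -
  have xc: "x \<in> carrier A" using x by (rule jacobson_carrier)
  define L0 where "L0 = {a \<otimes> (f \<ominus> x) \<oplus> (b \<ominus> b \<otimes> f) | a b. a \<in> carrier A \<and> b \<in> carrier A}"
  have L0I: "a \<otimes> (f \<ominus> x) \<oplus> (b \<ominus> b \<otimes> f) \<in> L0" if "a \<in> carrier A" "b \<in> carrier A" for a b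
    using that unfolding L0_def by blast
  have "left_ideal A L0"
    unfolding left_ideal_def additive_subgroup_iff
  proof (intro conjI ballI)
    show "L0 \<subseteq> carrier A" using xc f by (auto simp: L0_def)
    show "\<zero> \<in> L0" using L0I[of \<zero> \<zero>] xc f by simp
    fix u assume "u \<in> L0"
    then obtain a b where u: "u = a \<otimes> (f \<ominus> x) \<oplus> (b \<ominus> b \<otimes> f)" and ab: "a \<in> carrier A" "b \<in> carrier A"
      unfolding L0_def by blast
    have "\<ominus> u = (\<ominus> a) \<otimes> (f \<ominus> x) \<oplus> ((\<ominus> b) \<ominus> (\<ominus> b) \<otimes> f)"
      using ab xc f by (simp add: u minus_add minus_mult_left a_minus_def)
    then show "\<ominus> u \<in> L0" using L0I[of "\<ominus> a" "\<ominus> b"] ab by simp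
    show "u \<oplus> u' \<in> L0" if u': "u' \<in> L0" for u'
    proof -
      obtain a' b' where u': "u' = a' \<otimes> (f \<ominus> x) \<oplus> (b' \<ominus> b' \<otimes> f)" and ab': "a' \<in> carrier A" "b' \<in> carrier A"
        using u' unfolding L0_def by blast
      have "u \<oplus> u' = (a \<oplus> a') \<otimes> (f \<ominus> x) \<oplus> ((b \<oplus> b') \<ominus> (b \<oplus> b') \<otimes> f)"
        using ab ab' xc f by (simp add: u u' distr_right a_minus_def minus_add a_ac)
      then show ?thesis using L0I[of "a \<oplus> a'" "b \<oplus> b'"] ab ab' by simp
    qed
    show "c \<otimes> u \<in> L0" if c: "c \<in> carrier A" for c
    proof -
      have "c \<otimes> u = (c \<otimes> a) \<otimes> (f \<ominus> x) \<oplus> ((c \<otimes> b) \<ominus> (c \<otimes> b) \<otimes> f)"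
        using ab xc f c by (simp add: u distr_left mult_diff mult_assoc)
      then show ?thesis using L0I[of "c \<otimes> a" "c \<otimes> b"] ab c by simp
    qed
  qed
  note L0 = this
  have "f \<in> L0"
  proof (rule ccontr)
    assume "f \<notin> L0"
    then obtain L where L: "left_ideal A L" "L0 \<subseteq> L" "f \<notin> L"
      and maxL: "\<And>L'. \<lbrakk>left_ideal A L'; L \<subseteq> L'; f \<notin> L'\<rbrakk> \<Longrightarrow> L' = L"
      using maximal_left_ideal[of L0 "\<lambda>_. True" f] L0 by metis
    let ?M = "quotient_module A L"
    have eL: "b \<ominus> b \<otimes> f \<in> L" if "b \<in> carrier A" for b
      using L0I[of \<zero> b] L(2) that f xc by (simp add: subsetD)
    have "carrier ?M \<noteq> {\<zero>\<^bsub>?M\<^esub>}"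
    proof
      assume "carrier ?M = {\<zero>\<^bsub>?M\<^esub>}"
      then have "L +> f = \<zero>\<^bsub>?M\<^esub>" using coset_in_quotient[OF L(1), of f] f by simp
      then show False using coset_eq_zero[OF L(1), of f] L f by simp
    qed
    moreover have "N = {\<zero>\<^bsub>?M\<^esub>} \<or> N = carrier ?M" if "left_submodule A ?M N" for N
      by (rule quotient_simple_aux[OF L(1), where Q = "\<lambda>_. True" and e = f])
        (use f eL maxL that in simp_all)
    ultimately have "simple_module A ?M"
      using quotient_unital[OF L(1), of f] eL f by (simp add: simple_module_def)
    then have "x \<in> annihilator A ?M" using x by (simp add: jacobson_iff)
    then have "x \<odot>\<^bsub>?M\<^esub> (L +> f) = \<zero>\<^bsub>?M\<^esub>" using coset_in_quotient[OF L(1), of f] f by (simp add: annihilator_def)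
    then have xL: "x \<in> L" using quotient_smult[OF L(1), of x f] coset_eq_zero[OF L(1), of x] xc f xf by simp
    have "f \<otimes> (f \<ominus> x) \<in> L" using L0I[of f \<zero>] L(2) f xc by (simp add: subsetD)
    then have "f \<ominus> f \<otimes> x \<in> L" using f xc by (simp add: mult_diff)
    moreover have "f \<otimes> x \<in> L" using L(1) xL f by (simp add: left_ideal_def)
    ultimately have "f \<otimes> x \<oplus> (f \<ominus> f \<otimes> x) \<in> L" using L(1) by (simp add: left_ideal_def additive_subgroup_iff)
    then show False using L(3) f xc by (simp add: add_diff_cancel)
  qed
  then obtain a b where ab: "f = a \<otimes> (f \<ominus> x) \<oplus> (b \<ominus> b \<otimes> f)" "a \<in> carrier A" "b \<in> carrier A"
    unfolding L0_def by blast
  \<comment> \<open>Right multiplication by \<open>f\<close> annihilates \<open>b - b f\<close> and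
    fixes \<open>f - x\<close>.\<close>
  have "f = (a \<otimes> (f \<ominus> x) \<oplus> (b \<ominus> b \<otimes> f)) \<otimes> f" using ab(1) f by simp
  also have "\<dots> = a \<otimes> (f \<ominus> x)"
    using ab(2,3) f xc xf by (simp add: distr_right diff_mult mult_assoc)
  finally show ?thesis using ab(2) by metis
qed

text \<open>Only \<open>pos\<close>-extreme terms of \<open>w\<close> and \<open>z\<close> can contribute to the extreme term of \<open>w \<otimes> z\<close>.\<close>

lemma pr_mult_extreme:
  fixes pos :: "'g \<Rightarrow> bool"
  assumes pos: "\<And>m. pos m \<Longrightarrow> \<not> pos (- m)"
    and w: "w \<in> carrier A" "\<And>i. i \<in> supp w \<Longrightarrow> i \<noteq> a \<Longrightarrow> pos (i - a)"
    and z: "z \<in> carrier A" "\<And>j. j \<in> supp z \<Longrightarrow> j \<noteq> c \<Longrightarrow> pos (j - c)"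
  shows "pr (a + c) (w \<otimes> z) = pr a w \<otimes> pr c z"
proof -
  let ?S = "insert c (supp z)"
  have fin: "finite ?S" using finite_supp[OF z(1)] by simp
  have zc: "(\<lambda>j. pr j z) \<in> ?S \<rightarrow> carrier A" using z(1) by simp
  have "w \<otimes> z = w \<otimes> finsum A (\<lambda>j. pr j z) ?S" using decomposition[OF z(1) fin] by (metis subset_insertI)
  also have "\<dots> = finsum A (\<lambda>j. w \<otimes> pr j z) ?S"
    by (rule additive_map_finsum[of "\<lambda>y. w \<otimes> y", OF _ _ fin zc]) (simp_all add: w distr_left)
  finally have "pr (a + c) (w \<otimes> z) = finsum A (\<lambda>j. pr (a + c) (w \<otimes> pr j z)) ?S"
    using pr_finsum[OF fin, of "\<lambda>j. w \<otimes> pr j z"] w z by simp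
  also have "\<dots> = finsum A (\<lambda>j. pr (a + c - j) w \<otimes> pr j z) ?S"
    using pr_mult_hom[OF w(1) pr_closed[OF z(1)]] by simp
  also have "\<dots> = pr (a + c - c) w \<otimes> pr c z"
  proof (rule finsum_single[OF fin])
    fix j assume j: "j \<in> ?S" "j \<noteq> c"
    then have "pos (j - c)" using z(2) by simp
    \<comment> \<open>A component of \<open>z\<close> in a degree \<open>j\<close> above
      \<open>c\<close> would need a partner in \<open>w\<close> below the extreme degree
      \<open>a\<close>.\<close>
    then have "\<not> pos (a + c - j - a)" using pos[of "j - c"] by (simp add: algebra_simps)
    moreover have "a + c - j \<noteq> a" using j by (simp add: algebra_simps)
    ultimately have "a + c - j \<notin> supp w" using w(2)[of "a + c - j"] by blast
    then have "pr (a + c - j) w = \<zero>" by (simp add: supp_def)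
    then show "pr (a + c - j) w \<otimes> pr j z = \<zero>" using z(1) by simp
  qed (use w z in simp_all)
  finally show ?thesis by simp
qed

end

text \<open>A least element when \<open>m < n\<close> stands for \<open>pos (n - m)\<close>; the
  reversed cone gives a greatest one. Each new \<open>x\<close> either leaves the old minimum in
  place or lies below it and hence below everything.\<close>

lemma finite_extreme:
  fixes pos :: "'g::ab_group_add \<Rightarrow> bool"
  assumes add: "\<And>m n. \<lbrakk>pos m; pos n\<rbrakk> \<Longrightarrow> pos (m + n)"
    and total: "\<And>m. m \<noteq> 0 \<Longrightarrow> pos m \<or> pos (- m)"
    and S: "finite S" "S \<noteq> {}"
  shows "\<exists>l\<in>S. \<forall>n\<in>S. n \<noteq> l \<longrightarrow> pos (n - l)"
  using S
proof (induction S rule: finite_ne_induct)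
  case (singleton x)
  then show ?case by simp
next
  case (insert x S)
  then obtain l where l: "l \<in> S" "\<And>n. n \<in> S \<Longrightarrow> n \<noteq> l \<Longrightarrow> pos (n - l)" by blast
  have "x \<noteq> l" using insert l by blast
  then consider "pos (x - l)" | "pos (l - x)" using total[of "x - l"] by auto
  then show ?case
  proof cases
    case 1
    then show ?thesis using l by (intro bexI[of _ l]) auto
  next
    case 2
    have "pos (n - x)" if "n \<in> S" for n
    proof (cases "n = l")
      case True
      then show ?thesis using 2 by simp
    next
      case False
      then have "pos ((n - l) + (l - x))" using add 2 l(2) that by blast
      then show ?thesis by simp
    qed
    then show ?thesis by (intro bexI[of _ x]) auto
  qed
qed

context graded_regular_ring
begin

text \<open>Multiplying by the quasi-inverse \<open>y\<close> of the lowest term moves that term to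
  degree 0 and turns it into \<open>e\<close>; compressing by \<open>e\<close> on both sides places
  the element in \<open>eAe\<close>. Homogeneous factors merely shift the support and may shrink it,
  so its size remains minimal, and the component \<open>e\<close> keeps the result nonzero.\<close>

lemma jacobson_normal_form:
  fixes pos :: "'g \<Rightarrow> bool"
  assumes add: "\<And>m n. \<lbrakk>pos m; pos n\<rbrakk> \<Longrightarrow> pos (m + n)"
    and total: "\<And>m. m \<noteq> 0 \<Longrightarrow> pos m \<or> pos (- m)"
    and J: "J \<noteq> {\<zero>}"
  shows "\<exists>x e. x \<in> J \<and> e \<in> G 0 \<and> e \<noteq> \<zero> \<and> e \<otimes> e = e \<and>
    e \<otimes> x = x \<and> x \<otimes> e = x \<and> pr 0 x = e \<and> (\<forall>m\<in>supp x. m \<noteq> 0 \<longrightarrow> pos m) \<and>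
    (\<forall>z\<in>J. z \<noteq> \<zero> \<longrightarrow> card (supp x) \<le> card (supp z))"
proof -
  obtain x0 where "x0 \<in> J" "x0 \<noteq> \<zero>" using J jacobson_zero by blast
  then obtain x where x: "x \<in> J" "x \<noteq> \<zero>"
    and min: "\<And>z. \<lbrakk>z \<in> J; z \<noteq> \<zero>\<rbrakk> \<Longrightarrow> card (supp x) \<le> card (supp z)"
    using ex_has_least_nat[of "\<lambda>x. x \<in> J \<and> x \<noteq> \<zero>" x0 "\<lambda>x. card (supp x)"] by auto
  have xc: "x \<in> carrier A" using x(1) by (rule jacobson_carrier)
  obtain n where n: "n \<in> supp x" and low: "\<And>m. \<lbrakk>m \<in> supp x; m \<noteq> n\<rbrakk> \<Longrightarrow> pos (m - n)"
    using finite_extreme[of pos "supp x", OF add total finite_supp[OF xc] supp_empty[OF xc x(2)]] by blast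
  have p: "pr n x \<in> G n" using xc by (rule pr_closed)
  obtain y where y: "y \<in> G (- n)" "pr n x \<otimes> y \<otimes> pr n x = pr n x" using regular[OF p] by blast
  define e where "e = y \<otimes> pr n x"
  have e: "e \<in> G 0" using G_mult[OF y(1) p] by (simp add: e_def)
  have [simp]: "y \<in> carrier A" "e \<in> carrier A" "x \<in> carrier A" using y(1) e xc G_carrier by simp_all
  have pe: "pr n x \<otimes> e = pr n x" using y(2) by (simp add: e_def mult_assoc)
  have ee: "e \<otimes> e = e" using pe by (simp add: e_def mult_assoc)
  have e0: "e \<noteq> \<zero>" using pe n by (auto simp: supp_def)
  define x' where "x' = e \<otimes> (y \<otimes> x) \<otimes> e"
  have pr': "pr m x' = e \<otimes> (y \<otimes> pr (m + n) x) \<otimes> e" for m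
    using pr_mult_hom[OF _ e, of "e \<otimes> (y \<otimes> x)" m] pr_hom_mult[OF _ e, of "y \<otimes> x" m]
      pr_hom_mult[OF xc y(1), of m] by (simp add: x'_def)
  have sub: "m + n \<in> supp x" if "m \<in> supp x'" for m
    using that by (auto simp: supp_def pr')
  have "x' \<in> J" using x(1) by (simp add: x'_def jacobson_mult)
  moreover have "pr 0 x' = e" using ee by (simp add: pr' e_def[symmetric])
  moreover have "e \<otimes> x' = x'" "x' \<otimes> e = x'"
    by (simp_all add: x'_def mult_assoc[symmetric] ee) (simp_all add: mult_assoc ee)
  moreover have "\<forall>m\<in>supp x'. m \<noteq> 0 \<longrightarrow> pos m"
    using low[OF sub] by auto
  moreover have "card (supp x') \<le> card (supp x)"
    using sub finite_supp[OF xc] by (intro card_inj_on_le[of "\<lambda>m. m + n"]) (auto simp: inj_on_def)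
  ultimately show ?thesis using e ee e0 min order_trans by blast
qed

theorem jacobson_radical_zero:
  fixes pos :: "'g \<Rightarrow> bool"
  assumes add: "\<And>m n. \<lbrakk>pos m; pos n\<rbrakk> \<Longrightarrow> pos (m + n)"
    and total: "\<And>m. m \<noteq> 0 \<Longrightarrow> pos m \<or> pos (- m)"
    and irrefl: "\<not> pos 0"
  shows "J = {\<zero>}"
proof (rule ccontr)
  assume "J \<noteq> {\<zero>}"
  from jacobson_normal_form[of pos, OF add total this] obtain x e
    where xJ: "x \<in> J" and e: "e \<in> G 0" "e \<noteq> \<zero>" "e \<otimes> e = e" "e \<otimes> x = x" "x \<otimes> e = x"
      and x0: "pr 0 x = e" and low: "\<And>m. \<lbrakk>m \<in> supp x; m \<noteq> 0\<rbrakk> \<Longrightarrow> pos m"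
      and min: "\<And>z. \<lbrakk>z \<in> J; z \<noteq> \<zero>\<rbrakk> \<Longrightarrow> card (supp x) \<le> card (supp z)"
    by blast
  have asym: "\<not> pos (- m)" if "pos m" for m using add[OF that, of "- m"] irrefl by auto
  have xc [simp]: "x \<in> carrier A" and ec [simp]: "e \<in> carrier A" using xJ e(1) jacobson_carrier by simp_all
  have z_supp: "0 \<in> supp x" using x0 e(2) by (simp add: supp_def)
  \<comment> \<open>The support of the commutator \<open>c\<close> lies in that of \<open>x\<close>
    shifted by \<open>d\<close>, and in degree \<open>d\<close> its component is
    \<open>e r - r e = 0\<close>. Having fewer terms than \<open>x\<close>, the commutator vanishes;
    comparing degrees gives the claim for each component.\<close>
  have commute: "pr m x \<otimes> r = r \<otimes> pr m x" if r: "r \<in> G d" "e \<otimes> r = r" "r \<otimes> e = r" for m d r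
  proof -
    have rc [simp]: "r \<in> carrier A" using r(1) by simp
    define c where "c = x \<otimes> r \<ominus> r \<otimes> x"
    have prc: "pr k c = pr (k - d) x \<otimes> r \<ominus> r \<otimes> pr (k - d) x" for k
      by (simp add: c_def pr_diff pr_mult_hom[OF xc r(1)] pr_hom_mult[OF xc r(1)])
    have cJ: "c \<in> J" using xJ by (simp add: c_def jacobson_diff jacobson_mult)
    have "supp c \<subseteq> (\<lambda>k. k + d) ` (supp x - {0})"
    proof
      fix k assume k: "k \<in> supp c"
      have "k - d \<noteq> 0" using k r x0 by (auto simp: supp_def prc)
      moreover have "k - d \<in> supp x" using k by (auto simp: supp_def prc)
      ultimately show "k \<in> (\<lambda>k. k + d) ` (supp x - {0})" by (intro image_eqI[of _ _ "k - d"]) auto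
    qed
    then have "card (supp c) \<le> card ((\<lambda>k. k + d) ` (supp x - {0}))"
      using finite_supp[OF xc] by (intro card_mono) auto
    also have "\<dots> \<le> card (supp x - {0})" using finite_supp[OF xc] by (intro card_image_le) auto
    also have "\<dots> < card (supp x)" using z_supp finite_supp[OF xc] by (rule card_Diff1_less[rotated])
    finally have "c = \<zero>" using min[OF cJ] by auto
    then have "pr (m + d) c = \<zero>" by simp
    then have "pr m x \<otimes> r \<ominus> r \<otimes> pr m x = \<zero>" by (simp add: prc)
    then show ?thesis by (rule diff_eq_zeroD) simp_all
  qed
  obtain l where l: "l \<in> supp x" and high: "\<And>m. \<lbrakk>m \<in> supp x; m \<noteq> l\<rbrakk> \<Longrightarrow> pos (- (m - l))"
    using finite_extreme[of "\<lambda>m. pos (- m)" "supp x"] add total finite_supp[OF xc] z_supp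
    by (smt (verit) add.inverse_inverse empty_iff minus_add_distrib)
  show False
  proof (cases "l = 0")
    case True
    have prx: "pr m x = pr m e" for m
    proof (cases "m = 0")
      case True
      then show ?thesis using x0 pr_hom[OF e(1)] by simp
    next
      case False
      have "m \<notin> supp x"
      proof
        assume m: "m \<in> supp x"
        then have "pos m" using False by (rule low)
        moreover have "pos (- m)" using high[OF m] False \<open>l = 0\<close> by simp
        ultimately show False using asym by blast
      qed
      then show ?thesis using pr_hom[OF e(1)] False by (simp add: supp_def)
    qed
    have "x = e" by (rule pr_eqI[OF xc ec prx])
    \<comment> \<open>With \<open>x = e\<close>, the radical would provide a left inverse for
      \<open>e - e = 0\<close>.\<close>
    then obtain w where "w \<in> carrier A" "w \<otimes> (e \<ominus> e) = e"
      using jacobson_left_inverse[OF xJ ec e(3) e(5)] by blast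
    then show False using e(2) by simp
  next
    case False
    then have pl: "pos l" using low l by blast
    define u where "u = pr l x"
    have u: "u \<in> G l" "u \<noteq> \<zero>" using l pr_closed[OF xc] by (simp_all add: u_def supp_def)
    have uc [simp]: "u \<in> carrier A" using u(1) by simp
    have eu: "e \<otimes> u = u" "u \<otimes> e = u"
      using pr_hom_mult[OF xc e(1), of l] pr_mult_hom[OF xc e(1), of l] e(4,5) by (simp_all add: u_def)
    obtain y0 where y0: "y0 \<in> G (- l)" "u \<otimes> y0 \<otimes> u = u" using regular[OF u(1)] by blast
    have y0c [simp]: "y0 \<in> carrier A" using y0(1) by simp
    \<comment> \<open>The quasi-inverse is compressed into \<open>eAe\<close> so that
      \<open>commute\<close> applies to it; it remains a quasi-inverse because \<open>e\<close>
      fixes \<open>u\<close> on both sides.\<close>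
    define y where "y = e \<otimes> y0 \<otimes> e"
    have y: "y \<in> G (- l)" using G_mult[OF G_mult[OF e(1) y0(1)] e(1)] by (simp add: y_def)
    have yc [simp]: "y \<in> carrier A" using y by simp
    have ey: "e \<otimes> y = y" "y \<otimes> e = y"
      by (simp_all add: y_def mult_assoc[symmetric] e(3)) (simp_all add: mult_assoc e(3))
    have uyu: "u \<otimes> y \<otimes> u = u"
    proof -
      have "u \<otimes> y \<otimes> u = (u \<otimes> e) \<otimes> y0 \<otimes> (e \<otimes> u)" by (simp add: y_def mult_assoc)
      then show ?thesis using y0(2) eu by simp
    qed
    \<comment> \<open>Commutation upgrades the quasi-inverse: \<open>f = u y = y u\<close> fixes
      \<open>u\<close> from both sides.\<close>
    have uy: "u \<otimes> y = y \<otimes> u" unfolding u_def by (rule commute[OF y ey])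
    define f where "f = u \<otimes> y"
    have f: "f \<in> G 0" using G_mult[OF u(1) y] by (simp add: f_def)
    have fc [simp]: "f \<in> carrier A" using f by simp
    have fu: "f \<otimes> u = u" using uyu by (simp add: f_def)
    have uf: "u \<otimes> f = u" using uyu by (simp add: f_def uy mult_assoc[symmetric])
    have ff: "f \<otimes> f = f" using fu by (simp add: f_def mult_assoc[symmetric])
    have f0: "f \<noteq> \<zero>" using fu u(2) by auto
    have ef: "e \<otimes> f = f" "f \<otimes> e = f" using eu ey by (simp_all add: f_def mult_assoc[symmetric]) (simp add: mult_assoc)
    \<comment> \<open>Multiplying by \<open>u\<close> moves \<open>x\<close> into degrees from
      \<open>l\<close> upwards, all positive, so the lowest term of \<open>f + v\<close> is exactly
      \<open>f\<close>. With \<open>e + x\<close> or \<open>e - x\<close> instead, the component of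
      degree 0 would be \<open>e + e\<close>, which may vanish, or zero.\<close>
    define v where "v = x \<otimes> u"
    have vc [simp]: "v \<in> carrier A" by (simp add: v_def)
    have vf: "v \<otimes> f = v" using uf by (simp add: v_def mult_assoc)
    have prv: "pr k v = pr (k - l) x \<otimes> u" for k by (simp add: v_def pr_mult_hom[OF xc u(1)])
    have mJ: "\<ominus> v \<in> J" using xJ by (simp add: v_def jacobson_minus jacobson_mult)
    obtain w0 where w0: "w0 \<in> carrier A" "w0 \<otimes> (f \<ominus> \<ominus> v) = f"
      using jacobson_left_inverse[OF mJ fc ff] vf by (auto simp: minus_mult_left)
    define z where "z = f \<oplus> v"
    have zc [simp]: "z \<in> carrier A" by (simp add: z_def)
    \<comment> \<open>As a homogeneous element of \<open>eAe\<close>, \<open>f\<close> commutes past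
      the components of \<open>x\<close> and reaches \<open>u\<close>, which it fixes.\<close>
    have fv: "f \<otimes> v = v"
    proof (rule pr_eqI)
      fix k
      have "f \<otimes> (pr (k - l) x \<otimes> u) = (pr (k - l) x \<otimes> f) \<otimes> u"
        using commute[OF f ef, of "k - l"] by (simp add: mult_assoc)
      then show "pr k (f \<otimes> v) = pr k v" using pr_hom_mult[OF vc f, of k] fu by (simp add: prv mult_assoc)
    qed simp_all
    have fz: "f \<otimes> z = z" by (simp add: z_def distr_left ff fv)
    \<comment> \<open>Since \<open>f z = z\<close>, this is still a left inverse of
      \<open>z\<close>, and \<open>w f = w\<close> guarantees that \<open>f\<close> kills no nonzero
      component of \<open>w\<close> from the right.\<close>
    define w where "w = w0 \<otimes> f"
    have wc [simp]: "w \<in> carrier A" using w0(1) by (simp add: w_def)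
    have wz: "w \<otimes> z = f"
      using w0 fz by (simp add: w_def mult_assoc) (simp add: z_def a_minus_def)
    have wf: "w \<otimes> f = w" using w0(1) by (simp add: w_def mult_assoc ff)
    have prwf: "pr k w \<otimes> f = pr k w" for k using pr_mult_hom[OF wc f, of k] wf by simp
    have prz: "pr k z = (if k = 0 then f else \<zero>) \<oplus> pr (k - l) x \<otimes> u" for k
      by (simp add: z_def pr_add prv pr_hom[OF f])
    \<comment> \<open>All degrees of \<open>x\<close> are 0 or positive, so \<open>x u\<close>
      contributes nothing in degree 0.\<close>
    have nl: "- l \<notin> supp x"
      using low[of "- l"] asym[OF pl] False by (metis neg_equal_0_iff_equal)
    have zsupp: "k = 0 \<or> k - l \<in> supp x" if "k \<in> supp z" for k
      using that by (auto simp: supp_def prz split: if_splits)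
    have z0: "pr 0 z = f" using nl by (simp add: prz supp_def)
    have zl: "pr (l + l) z = u \<otimes> u"
    proof -
      have "l + l \<noteq> 0" using add[OF pl pl] irrefl by auto
      then show ?thesis by (simp add: prz u_def)
    qed
    have zlow: "pos (k - 0)" if "k \<in> supp z" "k \<noteq> 0" for k
    proof -
      have "k - l \<in> supp x" using zsupp that by blast
      then have "k - l = 0 \<or> pos (k - l)" using low by blast
      then have "k = l \<or> pos ((k - l) + l)" using add[OF _ pl] by (metis eq_iff_diff_eq_0)
      then show ?thesis using pl by (elim disjE) simp_all
    qed
    have zhigh: "pos (- (k - (l + l)))" if k: "k \<in> supp z" "k \<noteq> l + l" for k
    proof (cases "k = 0")
      case True
      then show ?thesis using add[OF pl pl] by simp
    next
      case False
      then have "k - l \<in> supp x" "k - l \<noteq> l" using zsupp k by (auto simp: algebra_simps)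
      then have "pos (- (k - l - l))" by (rule high)
      then show ?thesis by (simp add: algebra_simps)
    qed
    have "w \<noteq> \<zero>" using wz f0 by auto
    then have ws: "finite (supp w)" "supp w \<noteq> {}" using finite_supp[OF wc] supp_empty[OF wc] by blast+
    obtain a where a: "a \<in> supp w" "\<And>k. \<lbrakk>k \<in> supp w; k \<noteq> a\<rbrakk> \<Longrightarrow> pos (k - a)"
      using finite_extreme[of pos "supp w", OF add total ws] by blast
    obtain b where b: "b \<in> supp w" "\<And>k. \<lbrakk>k \<in> supp w; k \<noteq> b\<rbrakk> \<Longrightarrow> pos (- (k - b))"
      using finite_extreme[of "\<lambda>m. pos (- m)" "supp w", OF _ _ ws] add total
      by (smt (verit) add.inverse_inverse minus_add_distrib)
    \<comment> \<open>The lowest term of \<open>w z\<close> is the lowest term of \<open>w\<close>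
      times \<open>f\<close>, hence nonzero. As \<open>w z = f\<close> has degree 0, the lowest term
      of \<open>w\<close> has degree 0 too.\<close>
    have "pr (a + 0) (w \<otimes> z) = pr a w \<otimes> pr 0 z"
      by (rule pr_mult_extreme[of pos, OF asym wc a(2) zc zlow])
    then have "pr a f \<noteq> \<zero>" using a(1) by (simp add: wz z0 prwf supp_def)
    then have a0: "a = 0" using pr_hom[OF f, of a] by (auto split: if_splits)
    have asym': "\<not> pos (- (- m))" if "pos (- m)" for m using asym[OF that] by simp
    have "pr (b + (l + l)) (w \<otimes> z) = pr b w \<otimes> pr (l + l) z"
      by (rule pr_mult_extreme[of "\<lambda>m. pos (- m)", OF asym' wc b(2) zc zhigh])
    then have bf: "pr (b + (l + l)) f = pr b w \<otimes> (u \<otimes> u)" by (simp add: wz zl)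
    \<comment> \<open>Right multiplication by \<open>y y\<close> cancels \<open>u u\<close> down to
      \<open>f\<close>, which fixes the components of \<open>w\<close>.\<close>
    have "pr b w \<otimes> (u \<otimes> u) \<noteq> \<zero>"
    proof
      assume "pr b w \<otimes> (u \<otimes> u) = \<zero>"
      then have "pr b w \<otimes> (u \<otimes> u) \<otimes> (y \<otimes> y) = \<zero>" by simp
      moreover have "u \<otimes> u \<otimes> (y \<otimes> y) = f"
      proof -
        have "u \<otimes> u \<otimes> (y \<otimes> y) = u \<otimes> (f \<otimes> y)" by (simp add: f_def mult_assoc)
        also have "\<dots> = (u \<otimes> f) \<otimes> y" by (simp add: mult_assoc)
        also have "\<dots> = f" unfolding uf by (simp add: f_def)
        finally show ?thesis .
      qed
      ultimately have "pr b w \<otimes> f = \<zero>" by (simp add: mult_assoc)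
      then show False using b(1) by (simp add: prwf supp_def)
    qed
    \<comment> \<open>The top degree of \<open>w\<close> would be \<open>- (l + l)\<close>, below
      its lowest degree 0.\<close>
    then have "b + (l + l) = 0" using bf pr_hom[OF f, of "b + (l + l)"] by (auto split: if_splits)
    moreover have "b = 0 \<or> pos b" using a(2)[OF b(1)] a0 by auto
    ultimately show False using add[OF pl pl] add[of b "l + l"] irrefl by auto
  qed
qed

end


section \<open>The free algebra modulo the Kumjian--Pask relations\<close>

text \<open>The monomial \<open>single 0 c\<close> is \<open>c\<close> times the empty word, the
  unit of the ambient word algebra, so scaling becomes a ring product and obeys ring laws. The empty
  word lies outside the carrier of the free algebra; closure under \<open>scale\<close> is therefore
  a separate fact.\<close>

abbreviation scale :: "'f::field \<Rightarrow> ('a, 'f) free_elem \<Rightarrow> ('a, 'f) free_elem" where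
  "scale c p \<equiv> Poly_Mapping.single 0 c * p"

lemma poly_mapping_sum_single:
  fixes p :: "'w \<Rightarrow>\<^sub>0 'f::comm_monoid_add"
  shows "p = (\<Sum>w\<in>Poly_Mapping.keys p. Poly_Mapping.single w (Poly_Mapping.lookup p w))"
proof (rule poly_mapping_eqI)
  fix k
  have "(\<Sum>w\<in>Poly_Mapping.keys p. Poly_Mapping.lookup (Poly_Mapping.single w (Poly_Mapping.lookup p w)) k)
      = (\<Sum>w\<in>Poly_Mapping.keys p. if k = w then Poly_Mapping.lookup p w else 0)"
    by (rule sum.cong) (auto simp: lookup_single when_def)
  then show "Poly_Mapping.lookup p k = Poly_Mapping.lookup
      (\<Sum>w\<in>Poly_Mapping.keys p. Poly_Mapping.single w (Poly_Mapping.lookup p w)) k"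
    by (simp add: lookup_sum sum.delta in_keys_iff)
qed

text \<open>Additive maps are compared on monomials, where the product is concatenation of words.
  Centrality of scalars and the degree shifts of \<open>proj\<close> are obtained this way.\<close>

lemma poly_mapping_additive_eq:
  fixes f g :: "('w \<Rightarrow>\<^sub>0 'f::comm_monoid_add) \<Rightarrow> 'b::cancel_comm_monoid_add"
  assumes f: "\<And>p q. f (p + q) = f p + f q" and g: "\<And>p q. g (p + q) = g p + g q"
    and fg: "\<And>w c. f (Poly_Mapping.single w c) = g (Poly_Mapping.single w c)"
  shows "f p = g p"
proof -
  have f0: "f 0 = 0" and g0: "g 0 = 0" using f[of 0 0] g[of 0 0] by simp_all
  have "f (\<Sum>w\<in>S. Poly_Mapping.single w (c w)) = g (\<Sum>w\<in>S. Poly_Mapping.single w (c w))"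
    if "finite S" for S :: "'w set" and c
    using that by induction (simp_all add: f g fg f0 g0)
  then show ?thesis using poly_mapping_sum_single[of p] finite_keys by metis
qed

lemma scale_commute: "p * Poly_Mapping.single 0 c = scale c p"
  by (rule poly_mapping_additive_eq[where p = p])
    (simp_all add: distrib_right distrib_left mult_single mult.commute)

lemma mult_scale: "p * scale c q = scale c (p * q)"
  by (simp add: scale_commute flip: mult.assoc)

lemma scale_mult: "scale c p * q = scale c (p * q)"
  by (rule mult.assoc)

lemma scale_scale: "scale c (scale d p) = scale (c * d) p"
  by (simp add: mult_single flip: mult.assoc)

lemma scale_minus_one: "scale (-1) p = - p"
  by (metis mult_minus_left mult_1 single_one single_uminus)

lemma scale_add_left: "scale (c + d) p = scale c p + scale d p"
  by (simp add: single_add distrib_right)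

lemma scale_diff_left: "scale (c - d) p = scale c p - scale d p"
  by (simp add: single_diff left_diff_distrib)

context
  fixes \<Lambda> :: "('a, 'k::finite) kgraph"
begin

abbreviation free_carrier :: "('a, 'f::field) free_elem set" where
  "free_carrier \<equiv> carrier (free_algebra \<Lambda>)"

lemma free_carrier_iff: "p \<in> free_carrier \<longleftrightarrow> (\<forall>w \<in> Poly_Mapping.keys p.
    letters w \<noteq> [] \<and> set (letters w) \<subseteq> Path ` Mor \<Lambda> \<union> Ghost ` Mor \<Lambda>)"
  by (simp add: free_algebra_def)

lemma free_algebra_simps [simp]:
  "ring.add (free_algebra \<Lambda>) = (+)" "monoid.mult (free_algebra \<Lambda>) = (*)"
  "ring.zero (free_algebra \<Lambda>) = 0" "smult (free_algebra \<Lambda>) c p = scale c p"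
  by (simp_all add: free_algebra_def mult_map_scale_conv_mult)

lemma free_zero [simp]: "0 \<in> free_carrier"
  by (simp add: free_carrier_iff)

lemma free_add [simp]: "\<lbrakk>p \<in> free_carrier; q \<in> free_carrier\<rbrakk> \<Longrightarrow> p + q \<in> free_carrier"
  using keys_add[of p q] unfolding free_carrier_iff by blast

lemma free_uminus [simp]: "p \<in> free_carrier \<Longrightarrow> - p \<in> free_carrier"
  by (simp add: free_carrier_iff in_keys_iff)

lemma free_diff [simp]: "\<lbrakk>p \<in> free_carrier; q \<in> free_carrier\<rbrakk> \<Longrightarrow> p - q \<in> free_carrier"
  using free_add[of p "- q"] by simp

lemma letters_plus [simp]: "letters (u + w) = letters u @ letters w"
  by (simp add: plus_word_def)

lemma free_mult [simp]:
  assumes "p \<in> free_carrier" "q \<in> free_carrier"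
  shows "p * q \<in> free_carrier"
  unfolding free_carrier_iff
proof (rule ballI)
  fix w assume "w \<in> Poly_Mapping.keys (p * q)"
  then obtain a b where "w = a + b" "a \<in> Poly_Mapping.keys p" "b \<in> Poly_Mapping.keys q"
    using keys_mult[of p q] by blast
  then show "letters w \<noteq> [] \<and> set (letters w) \<subseteq> Path ` Mor \<Lambda> \<union> Ghost ` Mor \<Lambda>"
    using assms by (simp add: free_carrier_iff)
qed

lemma free_scale [simp]:
  assumes "p \<in> free_carrier"
  shows "scale c p \<in> free_carrier"
proof -
  have "Poly_Mapping.keys (scale c p) \<subseteq> {a + b |a b. a \<in> Poly_Mapping.keys (Poly_Mapping.single 0 c) \<and> b \<in> Poly_Mapping.keys p}"
    by (rule keys_mult)
  also have "\<dots> \<subseteq> Poly_Mapping.keys p" by (auto split: if_splits)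
  finally show ?thesis using assms by (auto simp: free_carrier_iff)
qed

lemma free_sum: "(\<And>i. i \<in> S \<Longrightarrow> f i \<in> free_carrier) \<Longrightarrow> sum f S \<in> free_carrier"
  by (induction S rule: infinite_finite_induct) simp_all

lemma free_pth [simp]: "\<mu> \<in> Mor \<Lambda> \<Longrightarrow> pth \<mu> \<in> free_carrier"
  by (simp add: free_carrier_iff pth_def)

lemma free_gst [simp]: "\<mu> \<in> Mor \<Lambda> \<Longrightarrow> gst \<mu> \<in> free_carrier"
  by (simp add: free_carrier_iff gst_def)

lemma free_induct [consumes 1, case_names zero add single]:
  assumes p: "p \<in> free_carrier"
    and "P 0" and add: "\<And>p q. \<lbrakk>p \<in> free_carrier; q \<in> free_carrier; P p; P q\<rbrakk> \<Longrightarrow> P (p + q)"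
    and single: "\<And>w c. \<lbrakk>letters w \<noteq> []; set (letters w) \<subseteq> Path ` Mor \<Lambda> \<union> Ghost ` Mor \<Lambda>\<rbrakk>
      \<Longrightarrow> P (Poly_Mapping.single w c)"
  shows "P p"
proof -
  let ?s = "\<lambda>w. Poly_Mapping.single w (Poly_Mapping.lookup p w)"
  have "P (sum ?s S) \<and> sum ?s S \<in> free_carrier" if "finite S" "S \<subseteq> Poly_Mapping.keys p" for S
    using that
  proof induction
    case empty
    then show ?case using \<open>P 0\<close> by simp
  next
    case (insert w S)
    then have w: "letters w \<noteq> []" "set (letters w) \<subseteq> Path ` Mor \<Lambda> \<union> Ghost ` Mor \<Lambda>"
      using p by (auto simp: free_carrier_iff)
    then have "?s w \<in> free_carrier" by (simp add: free_carrier_iff)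
    then show ?case using insert single[OF w] add by simp
  qed
  then have "P (sum ?s (Poly_Mapping.keys p))" by simp
  then show ?thesis using poly_mapping_sum_single[of p] by simp
qed

lemma free_abelian_group: "abelian_group (free_algebra \<Lambda> :: ('f::field, ('a, 'f) free_elem) module)"
  by (rule abelian_groupI) (auto simp: add.assoc add.commute intro: bexI[of _ "- x" for x])

text \<open>Additive inverses need no clause of their own, since \<open>scale (-1)\<close> produces
  them.\<close>

definition two_sided :: "('a, 'f::field) free_elem set \<Rightarrow> bool" where
  "two_sided V \<longleftrightarrow> V \<subseteq> free_carrier \<and> 0 \<in> V \<and> (\<forall>p\<in>V. \<forall>q\<in>V. p + q \<in> V) \<and>
     (\<forall>p\<in>V. \<forall>a\<in>free_carrier. p * a \<in> V \<and> a * p \<in> V) \<and> (\<forall>c. \<forall>p\<in>V. scale c p \<in> V)"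

lemma two_sided_iff:
  "twosided_ideal (free_algebra \<Lambda>) V \<and> scalar_closed (free_algebra \<Lambda>) V \<longleftrightarrow> two_sided V"
proof -
  have inv: "\<ominus>\<^bsub>free_algebra \<Lambda>\<^esub> p = - p" if "p \<in> free_carrier" for p :: "('a, 'f::field) free_elem"
    using abelian_group.minus_equality[OF free_abelian_group, of "- p" p] that by simp
  have neg: "- p \<in> V" if "\<forall>c. \<forall>p\<in>V. scale c p \<in> V" "p \<in> V" for p
    using that(1)[rule_format, of p "-1"] that(2) by (simp only: scale_minus_one)
  have "(\<forall>p\<in>V. \<ominus>\<^bsub>free_algebra \<Lambda>\<^esub> p \<in> V)" if "V \<subseteq> free_carrier" "\<forall>c. \<forall>p\<in>V. scale c p \<in> V"
    using that neg inv by (metis subsetD)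
  note minus = this
  show ?thesis
    unfolding two_sided_def twosided_ideal_def right_ideal_def left_ideal_def scalar_closed_def
      subgroup_add_monoid_iff[OF free_abelian_group] free_algebra_simps
  proof (intro iffI, goal_cases)
    case 1
    then show ?case by simp
  next
    case 2
    then show ?case using minus by simp
  qed
qed

end

context k_graph
begin

section \<open>Congruence modulo the Kumjian-Pask ideal\<close>

abbreviation FA :: "('a, 'f::field) free_elem set" where "FA \<equiv> carrier (free_algebra \<Lambda>)"

lemma Obj_Mor [simp]: "v \<in> Obj \<Lambda> \<Longrightarrow> v \<in> Mor \<Lambda>"
  using Obj_subset by blast

lemma src_Mor [simp]: "\<mu> \<in> Mor \<Lambda> \<Longrightarrow> src \<Lambda> \<mu> \<in> Mor \<Lambda>"
  using src_Obj by simp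

lemma rng_Mor [simp]: "\<mu> \<in> Mor \<Lambda> \<Longrightarrow> rng \<Lambda> \<mu> \<in> Mor \<Lambda>"
  using rng_Obj by simp

lemma paths_intoD: "\<mu> \<in> paths_into \<Lambda> v n \<Longrightarrow> \<mu> \<in> Mor \<Lambda> \<and> rng \<Lambda> \<mu> = v \<and> deg \<Lambda> \<mu> = n"
  by (simp add: paths_into_def)

lemma relations_free: "kp_relations \<Lambda> \<subseteq> FA"
proof
  fix r assume "r \<in> kp_relations \<Lambda>"
  then show "r \<in> FA"
  proof cases
    case (KP4 v n)
    show ?thesis
      unfolding KP4(1) using KP4(2) by (intro free_diff free_sum) (simp_all add: paths_into_def)
  qed (auto simp: cmp_closed)
qed

abbreviation KI :: "('a, 'f::field) free_elem set" where "KI \<equiv> kp_ideal \<Lambda>"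

lemma kp_ideal_eq: "kp_ideal \<Lambda> = \<Inter>{V. two_sided \<Lambda> V \<and> kp_relations \<Lambda> \<subseteq> V}"
  unfolding kp_ideal_def algebra_ideal_gen_def using two_sided_iff[of \<Lambda>] by (metis (no_types, lifting))

lemma two_sided_free: "two_sided \<Lambda> FA"
  by (simp add: two_sided_def)

lemma two_sided_KI: "two_sided \<Lambda> KI"
proof -
  have "KI \<subseteq> FA"
    using two_sided_free relations_free unfolding kp_ideal_eq by blast
  then show ?thesis unfolding kp_ideal_eq two_sided_def by simp
qed

lemma KI_least: "\<lbrakk>two_sided \<Lambda> V; kp_relations \<Lambda> \<subseteq> V\<rbrakk> \<Longrightarrow> KI \<subseteq> V"
  unfolding kp_ideal_eq by blast

lemma KI_relations: "kp_relations \<Lambda> \<subseteq> KI"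
  unfolding kp_ideal_eq by blast

lemma KI_free: "p \<in> KI \<Longrightarrow> p \<in> FA"
  and KI_zero [simp]: "0 \<in> KI"
  and KI_add: "\<lbrakk>p \<in> KI; q \<in> KI\<rbrakk> \<Longrightarrow> p + q \<in> KI"
  and KI_mult_right: "\<lbrakk>p \<in> KI; a \<in> FA\<rbrakk> \<Longrightarrow> p * a \<in> KI"
  and KI_mult_left: "\<lbrakk>p \<in> KI; a \<in> FA\<rbrakk> \<Longrightarrow> a * p \<in> KI"
  and KI_scale: "p \<in> KI \<Longrightarrow> scale c p \<in> KI"
  using two_sided_KI unfolding two_sided_def by blast+

lemma KI_uminus: "p \<in> KI \<Longrightarrow> - p \<in> KI"
  using KI_scale[of p "-1"] by (simp only: scale_minus_one)

lemma KI_diff: "\<lbrakk>p \<in> KI; q \<in> KI\<rbrakk> \<Longrightarrow> p - q \<in> KI"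
  using KI_add[of p "- q"] KI_uminus[of q] by simp

text \<open>Computations with the relations run on representatives, as chains of congruences; cosets
  enter only when the results are transferred to \<open>KP\<close>.\<close>

definition eqv :: "('a, 'f::field) free_elem \<Rightarrow> ('a, 'f) free_elem \<Rightarrow> bool" (infix \<open>\<doteq>\<close> 50) where
  "p \<doteq> q \<longleftrightarrow> p - q \<in> KI"

lemma eqv_refl [simp]: "p \<doteq> p"
  by (simp add: eqv_def)

lemma eqv_sym: "p \<doteq> q \<Longrightarrow> q \<doteq> p"
  using KI_uminus[of "p - q"] by (simp add: eqv_def)

lemma eqv_trans [trans]: "\<lbrakk>p \<doteq> q; q \<doteq> r\<rbrakk> \<Longrightarrow> p \<doteq> r"
  using KI_add[of "p - q" "q - r"] by (simp add: eqv_def)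

lemma eqv_add: "\<lbrakk>p \<doteq> p'; q \<doteq> q'\<rbrakk> \<Longrightarrow> p + q \<doteq> p' + q'"
  using KI_add[of "p - p'" "q - q'"] by (simp add: eqv_def algebra_simps)

lemma eqv_diff: "\<lbrakk>p \<doteq> p'; q \<doteq> q'\<rbrakk> \<Longrightarrow> p - q \<doteq> p' - q'"
  using KI_diff[of "p - p'" "q - q'"] by (simp add: eqv_def algebra_simps)

lemma eqv_scale: "p \<doteq> q \<Longrightarrow> scale c p \<doteq> scale c q"
  using KI_scale[of "p - q" c] by (simp add: eqv_def algebra_simps)

lemma eqv_sum: "(\<And>i. i \<in> S \<Longrightarrow> f i \<doteq> g i) \<Longrightarrow> sum f S \<doteq> sum g S"
  by (induction S rule: infinite_finite_induct) (simp_all add: eqv_add)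

lemma eqv_mult_left: "\<lbrakk>p \<doteq> q; a \<in> FA\<rbrakk> \<Longrightarrow> a * p \<doteq> a * q"
  using KI_mult_left[of "p - q" a] by (simp add: eqv_def algebra_simps)

lemma eqv_mult_right: "\<lbrakk>p \<doteq> q; a \<in> FA\<rbrakk> \<Longrightarrow> p * a \<doteq> q * a"
  using KI_mult_right[of "p - q" a] by (simp add: eqv_def algebra_simps)

text \<open>The difference is \<open>(p - p') q + p' (q - q')\<close>. The ideal absorbs elements of
  the free algebra, not of the whole word algebra, which is why \<open>q\<close> and
  \<open>p'\<close> are required to lie in \<open>FA\<close>.\<close>

lemma eqv_mult: "\<lbrakk>p \<doteq> p'; q \<doteq> q'; q \<in> FA; p' \<in> FA\<rbrakk>
    \<Longrightarrow> p * q \<doteq> p' * q'"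
  using eqv_trans[OF eqv_mult_right eqv_mult_left] by blast

lemma KI_rel: "p - q \<in> kp_relations \<Lambda> \<Longrightarrow> p \<doteq> q"
  using KI_relations by (auto simp: eqv_def)

text \<open>Both \<open>\<mu> s(\<mu>)\<close> and \<open>r(\<mu>) \<mu>\<close> factor
  \<open>\<mu>\<close> into two paths of degree 0, and such a factorisation is unique.\<close>

lemma deg0_Obj:
  assumes "\<mu> \<in> Mor \<Lambda>" "deg \<Lambda> \<mu> = 0"
  shows "\<mu> = rng \<Lambda> \<mu>"
proof -
  let ?P = "\<lambda>(\<nu>, \<xi>). \<nu> \<in> Mor \<Lambda> \<and> \<xi> \<in> Mor \<Lambda> \<and> src \<Lambda> \<nu> = rng \<Lambda> \<xi> \<and>
      deg \<Lambda> \<nu> = 0 \<and> deg \<Lambda> \<xi> = 0 \<and> \<mu> = cmp \<Lambda> \<nu> \<xi>"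
  have "deg \<Lambda> \<mu> = 0 + 0" using assms by simp
  from factorization[OF assms(1) this] obtain p where "?P p" and p: "\<forall>q. ?P q \<longrightarrow> q = p"
    by (rule ex1E)
  have "?P (\<mu>, src \<Lambda> \<mu>)" using assms by (simp add: deg_id src_Obj rng_id cmp_id_right)
  then have "(\<mu>, src \<Lambda> \<mu>) = p" using p by blast
  moreover have "?P (rng \<Lambda> \<mu>, \<mu>)" using assms by (simp add: deg_id rng_Obj src_id cmp_id_left)
  then have "(rng \<Lambda> \<mu>, \<mu>) = p" using p by blast
  ultimately have "(\<mu>, src \<Lambda> \<mu>) = (rng \<Lambda> \<mu>, \<mu>)" by metis
  then show ?thesis unfolding prod.inject by (rule conjunct1)
qed

lemma paths_into_zero: "v \<in> Obj \<Lambda> \<Longrightarrow> paths_into \<Lambda> v 0 = {v}"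
  unfolding paths_into_def using deg0_Obj by (auto simp: rng_id deg_id)

lemma rel_star: "v \<in> Obj \<Lambda> \<Longrightarrow> pth v \<doteq> gst v"
  by (rule KI_rel) (rule KP1_star)

lemma rel_path: "\<lbrakk>\<mu> \<in> Mor \<Lambda>; \<nu> \<in> Mor \<Lambda>; src \<Lambda> \<mu> = rng \<Lambda> \<nu>\<rbrakk> \<Longrightarrow> pth \<mu> * pth \<nu> \<doteq> pth (cmp \<Lambda> \<mu> \<nu>)"
  by (rule KI_rel) (rule KP2_path; simp)

lemma rel_ghost: "\<lbrakk>\<mu> \<in> Mor \<Lambda>; \<nu> \<in> Mor \<Lambda>; src \<Lambda> \<mu> = rng \<Lambda> \<nu>\<rbrakk> \<Longrightarrow> gst \<nu> * gst \<mu> \<doteq> gst (cmp \<Lambda> \<mu> \<nu>)"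
  by (rule KI_rel) (rule KP2_ghost; simp)

lemma rel_path_src: "\<mu> \<in> Mor \<Lambda> \<Longrightarrow> pth \<mu> * pth (src \<Lambda> \<mu>) \<doteq> pth \<mu>"
  by (rule KI_rel) (rule KP2_path_src)

lemma rel_src_ghost: "\<mu> \<in> Mor \<Lambda> \<Longrightarrow> pth (src \<Lambda> \<mu>) * gst \<mu> \<doteq> gst \<mu>"
  by (rule KI_rel) (rule KP2_src_ghost)

lemma rel_ghost_path: "\<lbrakk>\<mu> \<in> Mor \<Lambda>; \<nu> \<in> Mor \<Lambda>; deg \<Lambda> \<mu> = deg \<Lambda> \<nu>\<rbrakk>
    \<Longrightarrow> gst \<mu> * pth \<nu> \<doteq> (if \<mu> = \<nu> then pth (src \<Lambda> \<mu>) else 0)"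
  by (rule KI_rel) (rule KP3)

text \<open>Extends (KP4) to \<open>n = 0\<close>, where the only path is \<open>v\<close> itself
  and the claim is \<open>v = v v = v v*\<close>.\<close>

lemma rel_expand:
  assumes "v \<in> Obj \<Lambda>"
  shows "pth v \<doteq> (\<Sum>\<mu>\<in>paths_into \<Lambda> v n. pth \<mu> * gst \<mu>)"
proof (cases "n = 0")
  case True
  have "pth v * pth v \<doteq> pth v" using KI_rel[OF KP1_orth[OF assms assms]] by simp
  moreover have "pth v * pth v \<doteq> pth v * gst v" using assms by (intro eqv_mult_left rel_star) simp_all
  ultimately have "pth v \<doteq> pth v * gst v" using eqv_sym eqv_trans by blast
  then show ?thesis using True assms by (simp add: paths_into_zero)
next
  case False
  with assms show ?thesis by (intro KI_rel KP4)
qed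

end


section \<open>Homogeneous elements are regular\<close>

lemma deg_diff_zero [simp]: "deg_diff m m = 0"
  by (simp add: deg_diff_def vec_eq_iff)

lemma deg_diff_add: "deg_diff (a + c) (b + d) = deg_diff a b + deg_diff c d"
  by (simp add: deg_diff_def vec_eq_iff)

lemma deg_diff_uminus: "- deg_diff a b = deg_diff b a"
  by (simp add: deg_diff_def vec_eq_iff)

lemma deg_diff_eq_iff: "deg_diff a b = deg_diff c d \<longleftrightarrow> a + d = c + b"
proof -
  have "int (a $ i) - int (b $ i) = int (c $ i) - int (d $ i) \<longleftrightarrow> a $ i + d $ i = c $ i + b $ i" for i
    by linarith
  then show ?thesis by (simp add: deg_diff_def vec_eq_iff)
qed

text \<open>The witnesses are the coordinatewise positive and negative parts of
  \<open>n\<close>.\<close>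

lemma deg_diff_surj: "\<exists>a b. deg_diff a b = n"
  by (rule exI[of _ "\<chi> i. nat (n $ i)"], rule exI[of _ "\<chi> i. nat (- n $ i)"])
    (simp add: deg_diff_def vec_eq_iff)

lemma scale_mult_scale: "scale c p * scale d q = scale (c * d) (p * q)"
  using scale_mult[of c p "scale d q"] by (simp only: mult_scale[of p d q] scale_scale)

context k_graph
begin

section \<open>Linear spans modulo the ideal\<close>

text \<open>Everything congruent to a linear combination of elements of \<open>S\<close>; for
  \<open>S \<subseteq> FA\<close> this is the preimage of a span in the quotient. Adding one term at
  a time turns arguments by linearity into inductions.\<close>

inductive_set mspan :: "('a, 'f::field) free_elem set \<Rightarrow> ('a, 'f) free_elem set"
  for S :: "('a, 'f) free_elem set"
where
  mspan_KI: "p \<in> KI \<Longrightarrow> p \<in> mspan S"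
| mspan_step: "\<lbrakk>p \<in> mspan S; s \<in> S\<rbrakk> \<Longrightarrow> p + scale c s \<in> mspan S"

lemma mspan_zero [simp]: "0 \<in> mspan S"
  by (rule mspan_KI) simp

lemma mspan_free: "\<lbrakk>p \<in> mspan S; S \<subseteq> FA\<rbrakk> \<Longrightarrow> p \<in> FA"
  by (induction rule: mspan.induct) (auto simp: KI_free subsetD)

lemma mspan_add_KI: "\<lbrakk>p \<in> mspan S; k \<in> KI\<rbrakk> \<Longrightarrow> p + k \<in> mspan S"
proof (induction rule: mspan.induct)
  case (mspan_KI p)
  then show ?case by (intro mspan.mspan_KI KI_add)
next
  case (mspan_step p s c)
  then have "p + k + scale c s \<in> mspan S" by (intro mspan.mspan_step) simp_all
  then show ?case by (simp add: ac_simps)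
qed

lemma mspan_add: "\<lbrakk>q \<in> mspan S; p \<in> mspan S\<rbrakk> \<Longrightarrow> p + q \<in> mspan S"
proof (induction rule: mspan.induct)
  case (mspan_KI k)
  then show ?case by (intro mspan_add_KI)
next
  case (mspan_step q s c)
  then have "p + q + scale c s \<in> mspan S" by (intro mspan.mspan_step) simp_all
  then show ?case by (simp add: ac_simps)
qed

lemma mspan_incl: "s \<in> S \<Longrightarrow> s \<in> mspan S"
  using mspan_step[OF mspan_zero, of s S 1] by simp

lemma mspan_scale: "p \<in> mspan S \<Longrightarrow> scale c p \<in> mspan S"
proof (induction rule: mspan.induct)
  case (mspan_KI k)
  then show ?case by (intro mspan.mspan_KI KI_scale)
next
  case (mspan_step p s d)
  then have "scale c p + scale (c * d) s \<in> mspan S" by (intro mspan.mspan_step) simp_all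
  then show ?case by (simp add: distrib_left scale_scale)
qed

lemma mspan_uminus: "p \<in> mspan S \<Longrightarrow> - p \<in> mspan S"
  using mspan_scale[of p S "-1"] by (simp only: scale_minus_one)

lemma mspan_diff: "\<lbrakk>p \<in> mspan S; q \<in> mspan S\<rbrakk> \<Longrightarrow> p - q \<in> mspan S"
  using mspan_add[OF mspan_uminus[of q]] by simp

lemma mspan_eqv: "\<lbrakk>p \<in> mspan S; p \<doteq> q\<rbrakk> \<Longrightarrow> q \<in> mspan S"
  using mspan_add_KI[of p S "q - p"] eqv_sym[of p q] by (simp add: eqv_def)

lemma mspan_sum: "(\<And>i. i \<in> I \<Longrightarrow> f i \<in> mspan S) \<Longrightarrow> sum f I \<in> mspan S"
  by (induction I rule: infinite_finite_induct) (simp_all add: mspan_add)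

lemma mspan_subset: "\<lbrakk>p \<in> mspan S; S \<subseteq> mspan U\<rbrakk> \<Longrightarrow> p \<in> mspan U"
  by (induction rule: mspan.induct) (auto intro: mspan_KI mspan_add mspan_scale)

lemma mspan_sandwich:
  assumes "p \<in> mspan S" "a \<in> FA" "b \<in> FA"
    and "\<And>s. s \<in> S \<Longrightarrow> a * s * b \<in> mspan U"
  shows "a * p * b \<in> mspan U"
  using assms(1)
proof (induction rule: mspan.induct)
  case (mspan_KI p)
  then show ?case using assms(2,3) by (intro mspan.mspan_KI KI_mult_left KI_mult_right)
next
  case (mspan_step p s c)
  have "a * (p + scale c s) * b = a * p * b + scale c (a * s * b)"
    by (simp add: distrib_left distrib_right mult_scale scale_mult)
  then show ?case using mspan_step assms(4) by (simp add: mspan_add mspan_scale)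
qed

lemma mspan_mult:
  assumes p: "p \<in> mspan S" and q: "q \<in> mspan T"
    and S: "S \<subseteq> FA" and T: "T \<subseteq> FA"
    and ST: "\<And>s t. \<lbrakk>s \<in> S; t \<in> T\<rbrakk> \<Longrightarrow> s * t \<in> mspan U"
  shows "p * q \<in> mspan U"
  using p
proof (induction rule: mspan.induct)
  case (mspan_KI p)
  then show ?case using mspan_free[OF q T] by (intro mspan.mspan_KI KI_mult_right)
next
  case (mspan_step p s c)
  have "s * q \<in> mspan U"
    using q
  proof (induction rule: mspan.induct)
    case (mspan_KI q)
    then show ?case using S mspan_step(2) by (intro mspan.mspan_KI KI_mult_left) auto
  next
    case step: (mspan_step q t d)
    then show ?case using ST[OF mspan_step(2) step(2)]
      by (simp add: distrib_left mult_scale mspan_add mspan_scale)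
  qed
  then show ?case using mspan_step(3) by (simp add: distrib_right scale_mult mspan_add mspan_scale)
qed

definition gens :: "int ^ 'k \<Rightarrow> ('a, 'f::field) free_elem set" where
  "gens n = {pth \<mu> * gst \<nu> |\<mu> \<nu>. \<mu> \<in> Mor \<Lambda> \<and> \<nu> \<in> Mor \<Lambda> \<and> src \<Lambda> \<mu> = src \<Lambda> \<nu> \<and>
     deg_diff (deg \<Lambda> \<mu>) (deg \<Lambda> \<nu>) = n}"

text \<open>While \<open>gens\<close> fixes the difference of the two degrees only, both are fixed
  here; at a single level (KP3) decides every product of a ghost path with a path.\<close>

definition level_gens :: "nat ^ 'k \<Rightarrow> nat ^ 'k \<Rightarrow> ('a, 'f::field) free_elem set" where
  "level_gens m n = {pth \<mu> * gst \<nu> |\<mu> \<nu>. \<mu> \<in> Mor \<Lambda> \<and> \<nu> \<in> Mor \<Lambda> \<and> src \<Lambda> \<mu> = src \<Lambda> \<nu> \<and>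
     deg \<Lambda> \<mu> = m \<and> deg \<Lambda> \<nu> = n}"

lemma gensI: "\<lbrakk>\<mu> \<in> Mor \<Lambda>; \<nu> \<in> Mor \<Lambda>; src \<Lambda> \<mu> = src \<Lambda> \<nu>; deg_diff (deg \<Lambda> \<mu>) (deg \<Lambda> \<nu>) = n\<rbrakk>
    \<Longrightarrow> pth \<mu> * gst \<nu> \<in> gens n"
  unfolding gens_def by (intro CollectI exI[of _ \<mu>] exI[of _ \<nu>] conjI refl)

lemma gensE:
  assumes "s \<in> gens n"
  obtains \<mu> \<nu> where "s = pth \<mu> * gst \<nu>" "\<mu> \<in> Mor \<Lambda>" "\<nu> \<in> Mor \<Lambda>" "src \<Lambda> \<mu> = src \<Lambda> \<nu>"
    "deg_diff (deg \<Lambda> \<mu>) (deg \<Lambda> \<nu>) = n"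
  using assms unfolding gens_def by (elim CollectE exE conjE)

lemma level_gensI: "\<lbrakk>\<mu> \<in> Mor \<Lambda>; \<nu> \<in> Mor \<Lambda>; src \<Lambda> \<mu> = src \<Lambda> \<nu>; deg \<Lambda> \<mu> = m; deg \<Lambda> \<nu> = n\<rbrakk>
    \<Longrightarrow> pth \<mu> * gst \<nu> \<in> level_gens m n"
  unfolding level_gens_def by (intro CollectI exI[of _ \<mu>] exI[of _ \<nu>] conjI refl)

lemma level_gensE:
  assumes "s \<in> level_gens m n"
  obtains \<mu> \<nu> where "s = pth \<mu> * gst \<nu>" "\<mu> \<in> Mor \<Lambda>" "\<nu> \<in> Mor \<Lambda>" "src \<Lambda> \<mu> = src \<Lambda> \<nu>"
    "deg \<Lambda> \<mu> = m" "deg \<Lambda> \<nu> = n"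
  using assms unfolding level_gens_def by (elim CollectE exE conjE)

lemma gens_free: "gens n \<subseteq> FA"
  by (auto simp: gens_def)

text \<open>This is \<open>\<nu> = \<nu> s(\<nu>)\<close> with the source vertex expanded in degree
  \<open>n\<close>. The choice of \<open>n\<close> is free, so paths can be lengthened by any
  prescribed degree.\<close>

lemma pth_mult_expand:
  assumes "\<nu> \<in> Mor \<Lambda>"
  shows "pth \<nu> \<doteq> (\<Sum>\<eta>\<in>paths_into \<Lambda> (src \<Lambda> \<nu>) n. pth (cmp \<Lambda> \<nu> \<eta>) * gst \<eta>)"
proof -
  have "pth \<nu> \<doteq> pth \<nu> * pth (src \<Lambda> \<nu>)"
    using assms by (intro eqv_sym[OF rel_path_src])
  also have "\<dots> \<doteq> pth \<nu> * (\<Sum>\<eta>\<in>paths_into \<Lambda> (src \<Lambda> \<nu>) n. pth \<eta> * gst \<eta>)"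
    using assms by (intro eqv_mult_left rel_expand src_Obj) simp_all
  also have "\<dots> = (\<Sum>\<eta>\<in>paths_into \<Lambda> (src \<Lambda> \<nu>) n. pth \<nu> * pth \<eta> * gst \<eta>)"
    by (simp add: sum_distrib_left mult.assoc)
  also have "\<dots> \<doteq> (\<Sum>\<eta>\<in>paths_into \<Lambda> (src \<Lambda> \<nu>) n. pth (cmp \<Lambda> \<nu> \<eta>) * gst \<eta>)"
    using assms by (intro eqv_sum eqv_mult_right rel_path) (simp_all add: paths_into_def)
  finally show ?thesis .
qed

lemma gst_mult_expand:
  assumes "\<mu> \<in> Mor \<Lambda>"
  shows "gst \<mu> \<doteq> (\<Sum>\<xi>\<in>paths_into \<Lambda> (src \<Lambda> \<mu>) n. pth \<xi> * gst (cmp \<Lambda> \<mu> \<xi>))"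
proof -
  have "gst \<mu> \<doteq> pth (src \<Lambda> \<mu>) * gst \<mu>"
    using assms by (intro eqv_sym[OF rel_src_ghost])
  also have "\<dots> \<doteq> (\<Sum>\<xi>\<in>paths_into \<Lambda> (src \<Lambda> \<mu>) n. pth \<xi> * gst \<xi>) * gst \<mu>"
    using assms by (intro eqv_mult_right rel_expand src_Obj) simp_all
  also have "\<dots> = (\<Sum>\<xi>\<in>paths_into \<Lambda> (src \<Lambda> \<mu>) n. pth \<xi> * (gst \<xi> * gst \<mu>))"
    by (simp add: sum_distrib_right mult.assoc)
  also have "\<dots> \<doteq> (\<Sum>\<xi>\<in>paths_into \<Lambda> (src \<Lambda> \<mu>) n. pth \<xi> * gst (cmp \<Lambda> \<mu> \<xi>))"
    using assms by (intro eqv_sum eqv_mult_left rel_ghost) (simp_all add: paths_into_def)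
  finally show ?thesis .
qed

text \<open>Both factors are lengthened to the common degree \<open>deg \<mu> + deg \<nu>\<close>,
  after which (KP3) leaves only the terms with \<open>\<mu> \<xi> = \<nu> \<eta>\<close>. The ranges
  of \<open>\<xi>\<close> and \<open>\<eta>\<close> are recorded so that they can be composed with
  further paths later.\<close>

lemma ghost_path_span:
  assumes \<mu>: "\<mu> \<in> Mor \<Lambda>" and \<nu>: "\<nu> \<in> Mor \<Lambda>"
  shows "gst \<mu> * pth \<nu> \<in> mspan {pth \<xi> * gst \<eta> |\<xi> \<eta>. \<xi> \<in> Mor \<Lambda> \<and> \<eta> \<in> Mor \<Lambda> \<and>
     src \<Lambda> \<xi> = src \<Lambda> \<eta> \<and> rng \<Lambda> \<xi> = src \<Lambda> \<mu> \<and> rng \<Lambda> \<eta> = src \<Lambda> \<nu> \<and>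
     deg \<Lambda> \<xi> = deg \<Lambda> \<nu> \<and> deg \<Lambda> \<eta> = deg \<Lambda> \<mu>}" (is "_ \<in> mspan ?U")
proof -
  let ?P = "paths_into \<Lambda> (src \<Lambda> \<mu>) (deg \<Lambda> \<nu>)" and ?Q = "paths_into \<Lambda> (src \<Lambda> \<nu>) (deg \<Lambda> \<mu>)"
  have P: "\<xi> \<in> Mor \<Lambda>" "rng \<Lambda> \<xi> = src \<Lambda> \<mu>" "deg \<Lambda> \<xi> = deg \<Lambda> \<nu>" if "\<xi> \<in> ?P" for \<xi>
    using paths_intoD[OF that] by simp_all
  have Q: "\<eta> \<in> Mor \<Lambda>" "rng \<Lambda> \<eta> = src \<Lambda> \<nu>" "deg \<Lambda> \<eta> = deg \<Lambda> \<mu>" if "\<eta> \<in> ?Q" for \<eta>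
    using paths_intoD[OF that] by simp_all
  have Pc: "cmp \<Lambda> \<mu> \<xi> \<in> Mor \<Lambda>" "src \<Lambda> (cmp \<Lambda> \<mu> \<xi>) = src \<Lambda> \<xi>" "deg \<Lambda> (cmp \<Lambda> \<mu> \<xi>) = deg \<Lambda> \<mu> + deg \<Lambda> \<nu>"
    if "\<xi> \<in> ?P" for \<xi> using P[OF that] \<mu> by (simp_all add: cmp_closed src_cmp deg_cmp)
  have Qc: "cmp \<Lambda> \<nu> \<eta> \<in> Mor \<Lambda>" "src \<Lambda> (cmp \<Lambda> \<nu> \<eta>) = src \<Lambda> \<eta>" "deg \<Lambda> (cmp \<Lambda> \<nu> \<eta>) = deg \<Lambda> \<mu> + deg \<Lambda> \<nu>"
    if "\<eta> \<in> ?Q" for \<eta> using Q[OF that] \<nu> by (simp_all add: cmp_closed src_cmp deg_cmp add.commute)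
  have "gst \<mu> * pth \<nu> \<doteq> (\<Sum>\<xi>\<in>?P. pth \<xi> * gst (cmp \<Lambda> \<mu> \<xi>)) * (\<Sum>\<eta>\<in>?Q. pth (cmp \<Lambda> \<nu> \<eta>) * gst \<eta>)"
    using \<mu> \<nu> P Pc by (intro eqv_mult gst_mult_expand pth_mult_expand free_sum) simp_all
  also have "\<dots> = (\<Sum>\<xi>\<in>?P. \<Sum>\<eta>\<in>?Q. pth \<xi> * (gst (cmp \<Lambda> \<mu> \<xi>) * pth (cmp \<Lambda> \<nu> \<eta>)) * gst \<eta>)"
    by (simp only: sum_product mult.assoc)
  finally have eq: "gst \<mu> * pth \<nu> \<doteq> \<dots>" .
  have "pth \<xi> * (gst (cmp \<Lambda> \<mu> \<xi>) * pth (cmp \<Lambda> \<nu> \<eta>)) * gst \<eta> \<in> mspan ?U" if \<xi>: "\<xi> \<in> ?P" and \<eta>: "\<eta> \<in> ?Q" for \<xi> \<eta>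
  proof -
    let ?x = "pth \<xi> * (gst (cmp \<Lambda> \<mu> \<xi>) * pth (cmp \<Lambda> \<nu> \<eta>)) * gst \<eta>"
    have x: "?x \<doteq> pth \<xi> * (if cmp \<Lambda> \<mu> \<xi> = cmp \<Lambda> \<nu> \<eta> then pth (src \<Lambda> (cmp \<Lambda> \<mu> \<xi>)) else 0) * gst \<eta>"
      using P[OF \<xi>] Q[OF \<eta>] Pc[OF \<xi>] Qc[OF \<eta>]
      by (intro eqv_mult_right eqv_mult_left rel_ghost_path) simp_all
    show ?thesis
    proof (cases "cmp \<Lambda> \<mu> \<xi> = cmp \<Lambda> \<nu> \<eta>")
      case True
      then have s: "src \<Lambda> \<xi> = src \<Lambda> \<eta>" using Pc(2)[OF \<xi>] Qc(2)[OF \<eta>] by simp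
      note x
      also have "pth \<xi> * (if cmp \<Lambda> \<mu> \<xi> = cmp \<Lambda> \<nu> \<eta> then pth (src \<Lambda> (cmp \<Lambda> \<mu> \<xi>)) else 0) * gst \<eta>
          = pth \<xi> * pth (src \<Lambda> \<xi>) * gst \<eta>" using True Pc(2)[OF \<xi>] by simp
      also have "\<dots> \<doteq> pth \<xi> * gst \<eta>"
        using P[OF \<xi>] Q[OF \<eta>] by (intro eqv_mult_right rel_path_src) simp_all
      finally have e: "pth \<xi> * gst \<eta> \<doteq> ?x" by (rule eqv_sym)
      have m: "pth \<xi> * gst \<eta> \<in> ?U"
        using P[OF \<xi>] Q[OF \<eta>] s by (intro CollectI exI[of _ \<xi>] exI[of _ \<eta>] conjI) simp_all
      show ?thesis by (rule mspan_eqv[OF mspan_incl[OF m] e])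
    next
      case False
      with x have "?x \<doteq> 0" by simp
      then have "0 \<doteq> ?x" by (rule eqv_sym)
      then show ?thesis by (rule mspan_eqv[OF mspan_zero])
    qed
  qed
  then have "(\<Sum>\<xi>\<in>?P. \<Sum>\<eta>\<in>?Q. pth \<xi> * (gst (cmp \<Lambda> \<mu> \<xi>) * pth (cmp \<Lambda> \<nu> \<eta>)) * gst \<eta>) \<in> mspan ?U"
    by (intro mspan_sum)
  then show ?thesis by (rule mspan_eqv[OF _ eqv_sym[OF eq]])
qed

text \<open>The inner product of a ghost path and a path is rewritten as a combination of terms
  \<open>\<xi> \<eta>*\<close>. The outer factors then compose with \<open>\<xi>\<close> and
  \<open>\<eta>\<close>, and the degrees add up.\<close>

lemma gens_mult:
  fixes s t :: "('a, 'f::field) free_elem"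
  assumes s: "s \<in> gens m" and t: "t \<in> gens n"
  shows "s * t \<in> mspan (gens (m + n))"
proof -
  obtain \<mu> \<nu> where s: "s = pth \<mu> * gst \<nu>" "\<mu> \<in> Mor \<Lambda>" "\<nu> \<in> Mor \<Lambda>" "src \<Lambda> \<mu> = src \<Lambda> \<nu>"
    "deg_diff (deg \<Lambda> \<mu>) (deg \<Lambda> \<nu>) = m" using s by (rule gensE)
  obtain \<mu>' \<nu>' where t: "t = pth \<mu>' * gst \<nu>'" "\<mu>' \<in> Mor \<Lambda>" "\<nu>' \<in> Mor \<Lambda>" "src \<Lambda> \<mu>' = src \<Lambda> \<nu>'"
    "deg_diff (deg \<Lambda> \<mu>') (deg \<Lambda> \<nu>') = n" using t by (rule gensE)
  have "(pth \<mu> :: ('a, 'f) free_elem) * (gst \<nu> * pth \<mu>') * gst \<nu>' \<in> mspan (gens (m + n))"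
  proof (rule mspan_sandwich[OF ghost_path_span[OF s(3) t(2)]])
    fix u :: "('a, 'f) free_elem"
    assume "u \<in> {pth \<xi> * gst \<eta> |\<xi> \<eta>. \<xi> \<in> Mor \<Lambda> \<and> \<eta> \<in> Mor \<Lambda> \<and>
     src \<Lambda> \<xi> = src \<Lambda> \<eta> \<and> rng \<Lambda> \<xi> = src \<Lambda> \<nu> \<and> rng \<Lambda> \<eta> = src \<Lambda> \<mu>' \<and>
     deg \<Lambda> \<xi> = deg \<Lambda> \<mu>' \<and> deg \<Lambda> \<eta> = deg \<Lambda> \<nu>}"
    then obtain \<xi> \<eta> where u: "u = pth \<xi> * gst \<eta>" "\<xi> \<in> Mor \<Lambda>" "\<eta> \<in> Mor \<Lambda>" "src \<Lambda> \<xi> = src \<Lambda> \<eta>"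
      "rng \<Lambda> \<xi> = src \<Lambda> \<nu>" "rng \<Lambda> \<eta> = src \<Lambda> \<mu>'" "deg \<Lambda> \<xi> = deg \<Lambda> \<mu>'" "deg \<Lambda> \<eta> = deg \<Lambda> \<nu>"
      by (elim CollectE exE conjE)
    have c: "cmp \<Lambda> \<mu> \<xi> \<in> Mor \<Lambda>" "src \<Lambda> (cmp \<Lambda> \<mu> \<xi>) = src \<Lambda> \<xi>" "deg \<Lambda> (cmp \<Lambda> \<mu> \<xi>) = deg \<Lambda> \<mu> + deg \<Lambda> \<mu>'"
      "cmp \<Lambda> \<nu>' \<eta> \<in> Mor \<Lambda>" "src \<Lambda> (cmp \<Lambda> \<nu>' \<eta>) = src \<Lambda> \<eta>" "deg \<Lambda> (cmp \<Lambda> \<nu>' \<eta>) = deg \<Lambda> \<nu>' + deg \<Lambda> \<nu>"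
      using s t u by (simp_all add: cmp_closed src_cmp deg_cmp)
    have "pth \<mu> * u * gst \<nu>' = (pth \<mu> * pth \<xi>) * (gst \<eta> * gst \<nu>')" by (simp add: u mult.assoc)
    also have "\<dots> \<doteq> pth (cmp \<Lambda> \<mu> \<xi>) * gst (cmp \<Lambda> \<nu>' \<eta>)"
      using s t u c by (intro eqv_mult rel_path rel_ghost) simp_all
    finally have e: "pth (cmp \<Lambda> \<mu> \<xi>) * gst (cmp \<Lambda> \<nu>' \<eta>) \<doteq> pth \<mu> * u * gst \<nu>'" by (rule eqv_sym)
    have "deg_diff (deg \<Lambda> \<mu> + deg \<Lambda> \<mu>') (deg \<Lambda> \<nu>' + deg \<Lambda> \<nu>) = m + n"
      using s(5) t(5) deg_diff_add[of "deg \<Lambda> \<mu>" "deg \<Lambda> \<mu>'" "deg \<Lambda> \<nu>" "deg \<Lambda> \<nu>'"] by (simp add: add.commute)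
    then have "pth (cmp \<Lambda> \<mu> \<xi>) * gst (cmp \<Lambda> \<nu>' \<eta>) \<in> gens (m + n)"
      using c u(4) by (intro gensI) simp_all
    then show "pth \<mu> * u * gst \<nu>' \<in> mspan (gens (m + n))" by (rule mspan_eqv[OF mspan_incl e])
  qed (use s t in simp_all)
  then show ?thesis by (simp add: s t mult.assoc)
qed

lemma span_mult: "\<lbrakk>p \<in> mspan (gens m); q \<in> mspan (gens n)\<rbrakk> \<Longrightarrow> p * q \<in> mspan (gens (m + n))"
  by (rule mspan_mult[OF _ _ gens_free gens_free gens_mult])

text \<open>Expanding the common source of \<open>\<mu>\<close> and \<open>\<nu>\<close> in degree
  \<open>r\<close> lengthens both paths by the same \<open>\<xi>\<close>.\<close>

lemma level_gens_shift:
  assumes "s \<in> level_gens m n"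
  shows "s \<in> mspan (level_gens (m + r) (n + r))"
proof -
  obtain \<mu> \<nu> where s: "s = pth \<mu> * gst \<nu>" "\<mu> \<in> Mor \<Lambda>" "\<nu> \<in> Mor \<Lambda>" "src \<Lambda> \<mu> = src \<Lambda> \<nu>"
    "deg \<Lambda> \<mu> = m" "deg \<Lambda> \<nu> = n" using assms by (rule level_gensE)
  let ?P = "paths_into \<Lambda> (src \<Lambda> \<mu>) r"
  have P: "\<xi> \<in> Mor \<Lambda>" "rng \<Lambda> \<xi> = src \<Lambda> \<mu>" "deg \<Lambda> \<xi> = r" if "\<xi> \<in> ?P" for \<xi>
    using paths_intoD[OF that] by simp_all
  have "s \<doteq> (\<Sum>\<xi>\<in>?P. pth (cmp \<Lambda> \<mu> \<xi>) * gst \<xi>) * gst \<nu>"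
    unfolding s(1) using s(2,3) by (intro eqv_mult_right pth_mult_expand) simp_all
  also have "\<dots> = (\<Sum>\<xi>\<in>?P. pth (cmp \<Lambda> \<mu> \<xi>) * (gst \<xi> * gst \<nu>))"
    by (simp add: sum_distrib_right mult.assoc)
  also have "\<dots> \<doteq> (\<Sum>\<xi>\<in>?P. pth (cmp \<Lambda> \<mu> \<xi>) * gst (cmp \<Lambda> \<nu> \<xi>))"
    using s by (intro eqv_sum eqv_mult_left rel_ghost) (simp_all add: P cmp_closed)
  finally have e: "(\<Sum>\<xi>\<in>?P. pth (cmp \<Lambda> \<mu> \<xi>) * gst (cmp \<Lambda> \<nu> \<xi>)) \<doteq> s" by (rule eqv_sym)
  have "pth (cmp \<Lambda> \<mu> \<xi>) * gst (cmp \<Lambda> \<nu> \<xi>) \<in> level_gens (m + r) (n + r)" if "\<xi> \<in> ?P" for \<xi>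
    using s P[OF that] by (intro level_gensI) (simp_all add: cmp_closed src_cmp deg_cmp)
  then show ?thesis by (intro mspan_eqv[OF _ e] mspan_sum mspan_incl)
qed

lemma mspan_level_shift: "p \<in> mspan (level_gens m n) \<Longrightarrow> p \<in> mspan (level_gens (m + r) (n + r))"
  by (erule mspan_subset) (intro subsetI level_gens_shift)

text \<open>Two levels with the same difference meet after each is raised by the second degree of
  the other: \<open>m + n'\<close> and \<open>m' + n\<close> agree exactly because the differences
  do.\<close>

lemma common_level: "p \<in> mspan (gens d) \<Longrightarrow> \<exists>m n. deg_diff m n = d \<and> p \<in> mspan (level_gens m n)"
proof (induction rule: mspan.induct)
  case (mspan_KI p)
  obtain m n :: "nat ^ 'k" where "deg_diff m n = d" using deg_diff_surj[of d] by (elim exE)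
  with mspan_KI show ?case by (intro exI[of _ m] exI[of _ n] conjI mspan.mspan_KI)
next
  case (mspan_step p s c)
  obtain m n where mn: "deg_diff m n = d" "p \<in> mspan (level_gens m n)"
    using mspan_step(3) by (elim exE conjE)
  obtain \<mu> \<nu> where s: "s = pth \<mu> * gst \<nu>" "\<mu> \<in> Mor \<Lambda>" "\<nu> \<in> Mor \<Lambda>" "src \<Lambda> \<mu> = src \<Lambda> \<nu>"
    "deg_diff (deg \<Lambda> \<mu>) (deg \<Lambda> \<nu>) = d" using mspan_step(2) by (rule gensE)
  let ?m = "deg \<Lambda> \<mu>" and ?n = "deg \<Lambda> \<nu>"
  have eq: "m + ?n = ?m + n" using mn s deg_diff_eq_iff[of m n ?m ?n] by simp
  have 1: "p \<in> mspan (level_gens (m + ?n) (n + ?n))" using mn(2) by (rule mspan_level_shift)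
  have "s \<in> level_gens ?m ?n" unfolding s(1) using s by (intro level_gensI refl)
  then have "s \<in> mspan (level_gens (?m + n) (?n + n))" by (rule level_gens_shift)
  then have "p + scale c s \<in> mspan (level_gens (m + ?n) (n + ?n))"
    using 1 eq by (intro mspan_add mspan_scale) (simp_all add: add.commute)
  moreover have "deg_diff (m + ?n) (n + ?n) = d" using mn(1) by (simp add: deg_diff_add)
  ultimately show ?case by (intro exI[of _ "m + ?n"] exI[of _ "n + ?n"] conjI)
qed

section \<open>Elements given by coefficient matrices\<close>

definition comb :: "'a set \<Rightarrow> 'a set \<Rightarrow> ('a \<Rightarrow> 'a \<Rightarrow> 'f::field) \<Rightarrow> ('a, 'f) free_elem" where
  "comb P Q c = (\<Sum>\<mu>\<in>P. \<Sum>\<nu>\<in>Q. scale (c \<mu> \<nu>) (pth \<mu> * gst \<nu>))"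

lemma comb_mono:
  assumes "finite P'" "finite Q'" "P \<subseteq> P'" "Q \<subseteq> Q'" "\<And>\<mu> \<nu>. c \<mu> \<nu> \<noteq> 0 \<Longrightarrow> \<mu> \<in> P \<and> \<nu> \<in> Q"
  shows "comb P' Q' c = comb P Q c"
proof -
  have "comb P' Q' c = (\<Sum>\<mu>\<in>P'. \<Sum>\<nu>\<in>Q. scale (c \<mu> \<nu>) (pth \<mu> * gst \<nu>))"
    unfolding comb_def
  proof (rule sum.cong[OF refl])
    fix \<mu>
    have "\<forall>\<nu>\<in>Q' - Q. scale (c \<mu> \<nu>) (pth \<mu> * gst \<nu>) = 0"
      using assms(5)[of \<mu>] by (metis DiffD2 mult_zero_left single_zero)
    then show "(\<Sum>\<nu>\<in>Q'. scale (c \<mu> \<nu>) (pth \<mu> * gst \<nu>)) = (\<Sum>\<nu>\<in>Q. scale (c \<mu> \<nu>) (pth \<mu> * gst \<nu>))"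
      using assms by (intro sum.mono_neutral_right)
  qed
  also have "\<dots> = comb P Q c"
  proof -
    have "\<forall>\<mu>\<in>P' - P. (\<Sum>\<nu>\<in>Q. scale (c \<mu> \<nu>) (pth \<mu> * gst \<nu>)) = 0"
      using assms(5) by (metis (no_types, lifting) DiffD2 mult_zero_left single_zero sum.neutral)
    then show ?thesis unfolding comb_def using assms by (intro sum.mono_neutral_right)
  qed
  finally show ?thesis .
qed

lemma comb_add: "comb P Q (\<lambda>\<mu> \<nu>. c \<mu> \<nu> + d \<mu> \<nu>) = comb P Q c + comb P Q d"
  by (simp add: comb_def scale_add_left sum.distrib)

lemma comb_diff: "comb P Q (\<lambda>\<mu> \<nu>. c \<mu> \<nu> - d \<mu> \<nu>) = comb P Q c - comb P Q d"
  by (simp add: comb_def scale_diff_left sum_subtractf)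

lemma comb_single:
  assumes "finite P" "finite Q" "\<mu> \<in> P" "\<nu> \<in> Q"
  shows "comb P Q (\<lambda>\<mu>' \<nu>'. if \<mu>' = \<mu> then (if \<nu>' = \<nu> then d else 0) else 0) = scale d (pth \<mu> * gst \<nu>)"
proof -
  have "(\<Sum>\<nu>'\<in>Q. scale (if \<mu>' = \<mu> then (if \<nu>' = \<nu> then d else 0) else 0) (pth \<mu>' * gst \<nu>'))
      = (if \<mu>' = \<mu> then scale d (pth \<mu> * gst \<nu>) else 0)" for \<mu>'
  proof (cases "\<mu>' = \<mu>")
    case True
    have "(\<Sum>\<nu>'\<in>Q. scale (if \<nu>' = \<nu> then d else 0) (pth \<mu> * gst \<nu>'))
        = (\<Sum>\<nu>'\<in>Q. if \<nu>' = \<nu> then scale d (pth \<mu> * gst \<nu>') else 0)"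
      by (rule sum.cong) simp_all
    then show ?thesis using True assms by simp
  qed simp
  then show ?thesis using assms unfolding comb_def by simp
qed

text \<open>The coefficients vanish on pairs with different sources, since only the other pairs give
  generators. The elimination depends on this: \<open>\<mu> s(\<nu>)\<close> may be replaced by
  \<open>\<mu>\<close> only if the sources agree.\<close>

lemma level_comb:
  assumes "p \<in> mspan (level_gens m n)"
  shows "\<exists>P Q c. finite P \<and> finite Q \<and> P \<subseteq> {\<mu> \<in> Mor \<Lambda>. deg \<Lambda> \<mu> = m} \<and> Q \<subseteq> {\<nu> \<in> Mor \<Lambda>. deg \<Lambda> \<nu> = n} \<and>
    (\<forall>\<mu> \<nu>. c \<mu> \<nu> \<noteq> 0 \<longrightarrow> \<mu> \<in> P \<and> \<nu> \<in> Q \<and> src \<Lambda> \<mu> = src \<Lambda> \<nu>) \<and> p \<doteq> comb P Q c"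
  using assms
proof (induction rule: mspan.induct)
  case (mspan_KI p)
  then show ?case
    by (intro exI[of _ "{}"] exI[of _ "\<lambda>_ _. 0"]) (simp add: comb_def eqv_def)
next
  case (mspan_step p s d)
  then obtain P Q c where c: "finite P" "finite Q" "P \<subseteq> {\<mu> \<in> Mor \<Lambda>. deg \<Lambda> \<mu> = m}"
    "Q \<subseteq> {\<nu> \<in> Mor \<Lambda>. deg \<Lambda> \<nu> = n}"
    "\<forall>\<mu> \<nu>. c \<mu> \<nu> \<noteq> 0 \<longrightarrow> \<mu> \<in> P \<and> \<nu> \<in> Q \<and> src \<Lambda> \<mu> = src \<Lambda> \<nu>" "p \<doteq> comb P Q c"
    by (elim exE conjE)
  obtain \<mu> \<nu> where s: "s = pth \<mu> * gst \<nu>" "\<mu> \<in> Mor \<Lambda>" "\<nu> \<in> Mor \<Lambda>" "src \<Lambda> \<mu> = src \<Lambda> \<nu>"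
    "deg \<Lambda> \<mu> = m" "deg \<Lambda> \<nu> = n" using mspan_step(2) by (rule level_gensE)
  let ?e = "\<lambda>\<mu>' \<nu>'. if \<mu>' = \<mu> then (if \<nu>' = \<nu> then d else 0) else 0"
  let ?c = "\<lambda>\<mu>' \<nu>'. c \<mu>' \<nu>' + ?e \<mu>' \<nu>'"
  have "comb (insert \<mu> P) (insert \<nu> Q) c = comb P Q c"
    using c(1,2) by (intro comb_mono) (simp_all add: subset_insertI c(5)[rule_format])
  then have "comb (insert \<mu> P) (insert \<nu> Q) ?c = comb P Q c + scale d s"
    using c(1,2) comb_single[of "insert \<mu> P" "insert \<nu> Q" \<mu> \<nu> d] by (simp only: comb_add s(1)) simp
  then have "p + scale d s \<doteq> comb (insert \<mu> P) (insert \<nu> Q) ?c"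
    using eqv_add[OF c(6) eqv_refl, of "scale d s"] by simp
  moreover have "\<forall>\<mu>' \<nu>'. ?c \<mu>' \<nu>' \<noteq> 0 \<longrightarrow> \<mu>' \<in> insert \<mu> P \<and> \<nu>' \<in> insert \<nu> Q \<and> src \<Lambda> \<mu>' = src \<Lambda> \<nu>'"
  proof (intro allI impI)
    fix \<mu>' \<nu>' assume "?c \<mu>' \<nu>' \<noteq> 0"
    then have "c \<mu>' \<nu>' \<noteq> 0 \<or> (\<mu>' = \<mu> \<and> \<nu>' = \<nu>)" by (auto split: if_splits)
    then show "\<mu>' \<in> insert \<mu> P \<and> \<nu>' \<in> insert \<nu> Q \<and> src \<Lambda> \<mu>' = src \<Lambda> \<nu>'"
      using c(5)[rule_format, of \<mu>' \<nu>'] s(4) by auto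
  qed
  moreover have "insert \<mu> P \<subseteq> {\<mu> \<in> Mor \<Lambda>. deg \<Lambda> \<mu> = m}" "insert \<nu> Q \<subseteq> {\<nu> \<in> Mor \<Lambda>. deg \<Lambda> \<nu> = n}"
    using c(3,4) s by auto
  ultimately show ?case
    using c(1,2) by (intro exI[of _ "insert \<mu> P"] exI[of _ "insert \<nu> Q"] exI[of _ ?c]) simp
qed

text \<open>Von Neumann's lemma; the witness comes from expanding \<open>(p - p x p) y (p - p x p)\<close>.\<close>

lemma regular_correction:
  assumes p': "p' \<doteq> p - p * x * p" and reg: "p' \<doteq> p' * y * p'"
    and F: "p \<in> FA" "p' \<in> FA"
      "x \<in> FA" "y \<in> FA"
  shows "p \<doteq> p * (x + y - y * p * x - x * p * y + x * p * y * p * x) * p"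
proof -
  let ?r = "p - p * x * p"
  have "?r \<doteq> p'" using p' by (rule eqv_sym)
  also have "\<dots> \<doteq> p' * y * p'" by (rule reg)
  also have "\<dots> \<doteq> ?r * y * ?r"
    using F by (intro eqv_mult[OF eqv_mult_right[OF p'] p']) simp_all
  finally have "p * x * p + ?r \<doteq> p * x * p + ?r * y * ?r" by (intro eqv_add eqv_refl)
  then show ?thesis by (simp add: algebra_simps)
qed

lemma comb_free:
  "\<lbrakk>P \<subseteq> Mor \<Lambda>; Q \<subseteq> Mor \<Lambda>\<rbrakk> \<Longrightarrow> comb P Q c \<in> FA"
  unfolding comb_def by (intro free_sum free_scale free_mult free_pth free_gst) auto

text \<open>Extracts column \<open>b\<close> of the matrix: (KP3) leaves the terms with
  \<open>\<nu> = b\<close>, and the remaining vertex \<open>s(b)\<close> is absorbed by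
  \<open>\<mu>\<close>.\<close>

lemma comb_mult_pth:
  fixes c :: "'a \<Rightarrow> 'a \<Rightarrow> 'f::field"
  assumes P: "P \<subseteq> Mor \<Lambda>" and Q: "finite Q" "Q \<subseteq> {\<nu> \<in> Mor \<Lambda>. deg \<Lambda> \<nu> = n}" and b: "b \<in> Q"
    and src: "\<And>\<mu> \<nu>. c \<mu> \<nu> \<noteq> 0 \<Longrightarrow> src \<Lambda> \<mu> = src \<Lambda> \<nu>"
  shows "comb P Q c * pth b \<doteq> (\<Sum>\<mu>\<in>P. scale (c \<mu> b) (pth \<mu>))"
proof -
  have b': "b \<in> Mor \<Lambda>" "deg \<Lambda> b = n" using b Q by auto
  have "comb P Q c * pth b = (\<Sum>\<mu>\<in>P. \<Sum>\<nu>\<in>Q. scale (c \<mu> \<nu>) (pth \<mu> * (gst \<nu> * pth b)))"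
    by (simp add: comb_def sum_distrib_right mult.assoc)
  also have "\<dots> \<doteq> (\<Sum>\<mu>\<in>P. \<Sum>\<nu>\<in>Q. if \<nu> = b then scale (c \<mu> b) (pth \<mu>) else 0)"
  proof (intro eqv_sum)
    fix \<mu> \<nu> assume \<mu>: "\<mu> \<in> P" and \<nu>: "\<nu> \<in> Q"
    have m: "\<mu> \<in> Mor \<Lambda>" "\<nu> \<in> Mor \<Lambda>" "deg \<Lambda> \<nu> = n" using \<mu> \<nu> P Q by auto
    have e: "scale (c \<mu> \<nu>) (pth \<mu> * (gst \<nu> * pth b)) \<doteq>
        scale (c \<mu> \<nu>) (pth \<mu> * (if \<nu> = b then pth (src \<Lambda> \<nu>) else 0))"
      using m b' by (intro eqv_scale eqv_mult_left rel_ghost_path) simp_all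
    show "scale (c \<mu> \<nu>) (pth \<mu> * (gst \<nu> * pth b)) \<doteq> (if \<nu> = b then scale (c \<mu> b) (pth \<mu>) else 0)"
    proof (rule eqv_trans[OF e], cases "\<nu> = b \<and> c \<mu> \<nu> \<noteq> 0")
      case True
      then have "src \<Lambda> \<mu> = src \<Lambda> \<nu>" using src by blast
      then show "scale (c \<mu> \<nu>) (pth \<mu> * (if \<nu> = b then pth (src \<Lambda> \<nu>) else 0)) \<doteq>
          (if \<nu> = b then scale (c \<mu> b) (pth \<mu>) else 0)"
        using eqv_scale[OF rel_path_src[OF m(1)], of "c \<mu> b"] True by simp
    qed auto
  qed
  also have "\<dots> = (\<Sum>\<mu>\<in>P. scale (c \<mu> b) (pth \<mu>))"
    using Q(1) b by simp
  finally show ?thesis .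
qed

text \<open>Dually, a ghost path on the left extracts row \<open>a\<close>.\<close>

lemma gst_mult_comb:
  fixes c :: "'a \<Rightarrow> 'a \<Rightarrow> 'f::field"
  assumes P: "finite P" "P \<subseteq> {\<mu> \<in> Mor \<Lambda>. deg \<Lambda> \<mu> = m}" and Q: "Q \<subseteq> Mor \<Lambda>" and a: "a \<in> P"
    and src: "\<And>\<mu> \<nu>. c \<mu> \<nu> \<noteq> 0 \<Longrightarrow> src \<Lambda> \<mu> = src \<Lambda> \<nu>"
  shows "gst a * comb P Q c \<doteq> (\<Sum>\<nu>\<in>Q. scale (c a \<nu>) (gst \<nu>))"
proof -
  have a': "a \<in> Mor \<Lambda>" "deg \<Lambda> a = m" using a P by auto
  have "gst a * comb P Q c = (\<Sum>\<mu>\<in>P. \<Sum>\<nu>\<in>Q. scale (c \<mu> \<nu>) (gst a * pth \<mu> * gst \<nu>))"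
    by (simp add: comb_def sum_distrib_left mult.assoc mult_scale)
  also have "\<dots> \<doteq> (\<Sum>\<mu>\<in>P. \<Sum>\<nu>\<in>Q. if \<mu> = a then scale (c a \<nu>) (gst \<nu>) else 0)"
  proof (intro eqv_sum)
    fix \<mu> \<nu> assume \<mu>: "\<mu> \<in> P" and \<nu>: "\<nu> \<in> Q"
    have m: "\<mu> \<in> Mor \<Lambda>" "\<nu> \<in> Mor \<Lambda>" "deg \<Lambda> \<mu> = m" using \<mu> \<nu> P Q by auto
    have e: "scale (c \<mu> \<nu>) (gst a * pth \<mu> * gst \<nu>) \<doteq>
        scale (c \<mu> \<nu>) ((if a = \<mu> then pth (src \<Lambda> a) else 0) * gst \<nu>)"
      using m a' by (intro eqv_scale eqv_mult_right rel_ghost_path) simp_all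
    show "scale (c \<mu> \<nu>) (gst a * pth \<mu> * gst \<nu>) \<doteq> (if \<mu> = a then scale (c a \<nu>) (gst \<nu>) else 0)"
    proof (rule eqv_trans[OF e], cases "\<mu> = a \<and> c \<mu> \<nu> \<noteq> 0")
      case True
      then have "src \<Lambda> a = src \<Lambda> \<nu>" using src by blast
      then show "scale (c \<mu> \<nu>) ((if a = \<mu> then pth (src \<Lambda> a) else 0) * gst \<nu>) \<doteq>
          (if \<mu> = a then scale (c a \<nu>) (gst \<nu>) else 0)"
        using eqv_scale[OF rel_src_ghost[OF m(2)], of "c a \<nu>"] True by simp
    qed auto
  qed
  also have "\<dots> = (\<Sum>\<nu>\<in>Q. scale (c a \<nu>) (gst \<nu>))"
    using P(1) a by (subst sum.swap) simp
  finally show ?thesis .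
qed

text \<open>Gaussian elimination, one row of the coefficient matrix \<open>c\<close> at a time.\<close>

lemma comb_regular:
  assumes P: "finite P" "P \<subseteq> {\<mu> \<in> Mor \<Lambda>. deg \<Lambda> \<mu> = m}" and Q: "finite Q" "Q \<subseteq> {\<nu> \<in> Mor \<Lambda>. deg \<Lambda> \<nu> = n}"
    and src: "\<And>\<mu> \<nu>. c \<mu> \<nu> \<noteq> 0 \<Longrightarrow> src \<Lambda> \<mu> = src \<Lambda> \<nu>"
  shows "\<exists>q \<in> mspan (gens (- deg_diff m n)). comb P Q c \<doteq> comb P Q c * q * comb P Q c"
  using P src
proof (induction P arbitrary: c rule: finite_induct)
  case empty
  then show ?case by (intro bexI[of _ 0]) (simp_all add: comb_def)
next
  case (insert a P)
  let ?P = "insert a P"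
  show ?case
  proof (cases "\<forall>\<nu>\<in>Q. c a \<nu> = 0")
    case True
    then have "comb ?P Q c = comb P Q c" using insert(1,2) by (simp add: comb_def)
    then show ?thesis using insert.IH[of c] insert.prems by simp
  next
    case False
    then obtain b where b: "b \<in> Q" "c a b \<noteq> 0" by blast
    define d where "d = c a b"
    \<comment> \<open>The Schur complement of the pivot \<open>d\<close>. With \<open>x\<close>
      equal to \<open>b a*\<close> divided by \<open>d\<close>, the rank-one matrix subtracted from
      \<open>c\<close> is that of \<open>p x p\<close>, the product of column \<open>b\<close> and
      row \<open>a\<close>. Row \<open>a\<close> of \<open>c'\<close> is zero, so
      \<open>p - p x p\<close> is indexed by \<open>P\<close> alone.\<close>
    define c' where "c' = (\<lambda>\<mu> \<nu>. c \<mu> \<nu> - c \<mu> b * c a \<nu> / d)"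
    let ?p = "comb ?P Q c" and ?x = "scale (1 / d) (pth b * gst a)" and ?p' = "comb P Q c'"
    have am: "a \<in> Mor \<Lambda>" "deg \<Lambda> a = m" and bm: "b \<in> Mor \<Lambda>" "deg \<Lambda> b = n"
      using insert.prems(1) b Q by auto
    have PM: "?P \<subseteq> Mor \<Lambda>" and QM: "Q \<subseteq> Mor \<Lambda>" using insert.prems(1) Q by auto
    have ab: "src \<Lambda> a = src \<Lambda> b" using insert.prems(2) b(2) by blast
    have x: "?x \<in> mspan (gens (- deg_diff m n))"
      using am bm ab by (intro mspan_scale mspan_incl gensI) (simp_all add: deg_diff_uminus)
    have "?p * ?x * ?p = scale (1 / d) ((?p * pth b) * (gst a * ?p))"
      by (simp add: mult_scale scale_mult mult.assoc)
    also have "\<dots> \<doteq> scale (1 / d) ((\<Sum>\<mu>\<in>?P. scale (c \<mu> b) (pth \<mu>)) * (\<Sum>\<nu>\<in>Q. scale (c a \<nu>) (gst \<nu>)))"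
    proof (intro eqv_scale eqv_mult)
      show "?p * pth b \<doteq> (\<Sum>\<mu>\<in>?P. scale (c \<mu> b) (pth \<mu>))"
        using insert.prems(2) by (intro comb_mult_pth[OF PM Q b(1)])
      show "gst a * ?p \<doteq> (\<Sum>\<nu>\<in>Q. scale (c a \<nu>) (gst \<nu>))"
        using insert.prems insert.hyps(1) by (intro gst_mult_comb[of ?P m, OF _ _ QM]) simp_all
      show "gst a * ?p \<in> FA" using comb_free[OF PM QM, of c] am by simp
      show "(\<Sum>\<mu>\<in>?P. scale (c \<mu> b) (pth \<mu>)) \<in> FA"
        using PM by (intro free_sum free_scale free_pth) auto
    qed
    also have "\<dots> = comb ?P Q (\<lambda>\<mu> \<nu>. c \<mu> b * c a \<nu> / d)"
      unfolding comb_def sum_product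
      unfolding sum_distrib_left
      by (intro sum.cong refl) (simp only: scale_mult_scale scale_scale, simp add: mult.commute)
    finally have "?p - ?p * ?x * ?p \<doteq> ?p - comb ?P Q (\<lambda>\<mu> \<nu>. c \<mu> b * c a \<nu> / d)"
      by (intro eqv_diff eqv_refl)
    also have "\<dots> = comb ?P Q c'" unfolding c'_def by (rule comb_diff[symmetric])
    also have "\<dots> = ?p'"
    proof -
      have "c' a \<nu> = 0" for \<nu> using b(2) by (simp add: c'_def d_def)
      then show ?thesis using insert.hyps by (simp add: comb_def)
    qed
    finally have p': "?p' \<doteq> ?p - ?p * ?x * ?p" by (rule eqv_sym)
    \<comment> \<open>A new nonzero entry requires nonzero entries in column \<open>b\<close> and
      row \<open>a\<close>; the pivot joins their sources.\<close>
    have src': "src \<Lambda> \<mu> = src \<Lambda> \<nu>" if "c' \<mu> \<nu> \<noteq> 0" for \<mu> \<nu>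
    proof (cases "c \<mu> \<nu> = 0")
      case True
      then have "c \<mu> b \<noteq> 0" "c a \<nu> \<noteq> 0" using that by (auto simp: c'_def)
      then have "src \<Lambda> \<mu> = src \<Lambda> b" "src \<Lambda> a = src \<Lambda> \<nu>" using insert.prems(2) by blast+
      then show ?thesis using ab by simp
    next
      case False
      then show ?thesis using insert.prems(2) by blast
    qed
    obtain y where y: "y \<in> mspan (gens (- deg_diff m n))" "?p' \<doteq> ?p' * y * ?p'"
    proof -
      have "\<exists>q \<in> mspan (gens (- deg_diff m n)). ?p' \<doteq> ?p' * q * ?p'"
        using insert.prems(1) src' by (intro insert.IH) simp_all
      then show ?thesis using that by (elim bexE)
    qed
    let ?z = "?x + y - y * ?p * ?x - ?x * ?p * y + ?x * ?p * y * ?p * ?x"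
    have pz: "?p \<doteq> ?p * ?z * ?p"
      using y(2) comb_free[OF PM QM, of c] comb_free[OF _ QM, of P c'] PM
        mspan_free[OF x gens_free] mspan_free[OF y(1) gens_free]
      by (intro regular_correction[OF p']) simp_all
    have ps: "?p \<in> mspan (gens (deg_diff m n))"
      unfolding comb_def
    proof (intro mspan_sum)
      fix \<mu> \<nu> assume "\<mu> \<in> ?P" "\<nu> \<in> Q"
      then have m: "\<mu> \<in> Mor \<Lambda>" "deg \<Lambda> \<mu> = m" "\<nu> \<in> Mor \<Lambda>" "deg \<Lambda> \<nu> = n" using insert.prems(1) Q by auto
      show "scale (c \<mu> \<nu>) (pth \<mu> * gst \<nu>) \<in> mspan (gens (deg_diff m n))"
      proof (cases "c \<mu> \<nu> = 0")
        case True
        then show ?thesis by simp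
      next
        case False
        then have "src \<Lambda> \<mu> = src \<Lambda> \<nu>" using insert.prems(2) by blast
        then have "pth \<mu> * gst \<nu> \<in> gens (deg_diff m n)" using m by (intro gensI) simp_all
        then show ?thesis by (intro mspan_scale mspan_incl)
      qed
    qed
    \<comment> \<open>Each \<open>p\<close> between two factors of the opposite degree cancels one
      of them, so every summand of the witness stays in degree
      \<open>- deg_diff m n\<close>.\<close>
    have s: "u * ?p * v \<in> mspan (gens (- deg_diff m n))"
      if "u \<in> mspan (gens (- deg_diff m n))" "v \<in> mspan (gens (- deg_diff m n))" for u v
      using span_mult[OF span_mult[OF that(1) ps] that(2)] by simp
    have "?z \<in> mspan (gens (- deg_diff m n))"
      using x y(1) s[OF s[OF x y(1)] x] s[OF x y(1)] s[OF y(1) x] by (intro mspan_add mspan_diff)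
    with pz show ?thesis by (rule bexI)
  qed
qed

theorem span_regular:
  assumes "p \<in> mspan (gens d)"
  shows "\<exists>q \<in> mspan (gens (- d)). p \<doteq> p * q * p"
proof -
  obtain m n where mn: "deg_diff m n = d" "p \<in> mspan (level_gens m n)" using common_level[OF assms] by (elim exE conjE)
  obtain P Q c where c: "finite P" "finite Q" "P \<subseteq> {\<mu> \<in> Mor \<Lambda>. deg \<Lambda> \<mu> = m}"
    "Q \<subseteq> {\<nu> \<in> Mor \<Lambda>. deg \<Lambda> \<nu> = n}"
    "\<forall>\<mu> \<nu>. c \<mu> \<nu> \<noteq> 0 \<longrightarrow> \<mu> \<in> P \<and> \<nu> \<in> Q \<and> src \<Lambda> \<mu> = src \<Lambda> \<nu>" "p \<doteq> comb P Q c"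
    using level_comb[OF mn(2)] by (elim exE conjE)
  let ?p = "comb P Q c"
  obtain q where q: "q \<in> mspan (gens (- d))" "?p \<doteq> ?p * q * ?p"
  proof -
    have "\<exists>q \<in> mspan (gens (- deg_diff m n)). ?p \<doteq> ?p * q * ?p"
      using c(5) by (intro comb_regular[OF c(1,3,2,4)]) simp
    then show ?thesis using that unfolding mn(1) by (elim bexE)
  qed
  have F: "p \<in> FA" "?p \<in> FA" "q \<in> FA"
    using mspan_free[OF assms gens_free] mspan_free[OF q(1) gens_free] comb_free[of P Q c] c(3,4) by auto
  have "p \<doteq> ?p * q * ?p" using c(6) q(2) by (rule eqv_trans)
  also have "\<dots> \<doteq> p * q * p"
    using F eqv_sym[OF c(6)] by (intro eqv_mult eqv_refl) simp_all
  finally show ?thesis using q(1) by (rule bexI)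
qed

end


section \<open>The Kumjian--Pask algebra as a graded ring\<close>

fun letter_degree :: "('a, 'k::finite) kgraph \<Rightarrow> 'a kp_gen \<Rightarrow> int ^ 'k" where
  "letter_degree \<Lambda> (Path \<mu>) = deg_diff (deg \<Lambda> \<mu>) 0"
| "letter_degree \<Lambda> (Ghost \<mu>) = deg_diff 0 (deg \<Lambda> \<mu>)"

definition word_degree :: "('a, 'k::finite) kgraph \<Rightarrow> 'a kp_gen word \<Rightarrow> int ^ 'k" where
  "word_degree \<Lambda> w = sum_list (map (letter_degree \<Lambda>) (letters w))"

lemma word_degree_add [simp]: "word_degree \<Lambda> (u + w) = word_degree \<Lambda> u + word_degree \<Lambda> w"
  by (simp add: word_degree_def)

lemma word_degree_zero [simp]: "word_degree \<Lambda> 0 = 0"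
  by (simp add: word_degree_def zero_word_def)

text \<open>The homogeneous part of degree \<open>n\<close> before any relation is imposed, where
  directness is evident because words form a basis.\<close>

definition proj :: "('a, 'k::finite) kgraph \<Rightarrow> int ^ 'k \<Rightarrow> ('a, 'f::field) free_elem \<Rightarrow> ('a, 'f) free_elem" where
  "proj \<Lambda> n = Poly_Mapping.mapp (\<lambda>w c. if word_degree \<Lambda> w = n then c else 0)"

lemma lookup_proj [simp]:
  "Poly_Mapping.lookup (proj \<Lambda> n p) w = (if word_degree \<Lambda> w = n then Poly_Mapping.lookup p w else 0)"
  by (simp add: proj_def lookup_mapp when_def in_keys_iff)

lemma proj_zero [simp]: "proj \<Lambda> n 0 = 0"
  by (rule poly_mapping_eqI) simp

lemma proj_add: "proj \<Lambda> n (p + q) = proj \<Lambda> n p + proj \<Lambda> n q"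
  by (rule poly_mapping_eqI) (simp add: lookup_add)

lemma proj_diff: "proj \<Lambda> n (p - q) = proj \<Lambda> n p - proj \<Lambda> n q"
  by (rule poly_mapping_eqI) (simp add: lookup_minus)

lemma proj_single:
  "proj \<Lambda> n (Poly_Mapping.single w c) = (if word_degree \<Lambda> w = n then Poly_Mapping.single w c else 0)"
  by (rule poly_mapping_eqI) (auto simp: lookup_single when_def)

lemma proj_mult_single:
  "proj \<Lambda> n (p * Poly_Mapping.single w c) = proj \<Lambda> (n - word_degree \<Lambda> w) p * Poly_Mapping.single w c"
  by (rule poly_mapping_additive_eq[where p = p])
    (auto simp: proj_add distrib_right mult_single proj_single algebra_simps)

lemma proj_single_mult:
  "proj \<Lambda> n (Poly_Mapping.single w c * p) = Poly_Mapping.single w c * proj \<Lambda> (n - word_degree \<Lambda> w) p"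
  by (rule poly_mapping_additive_eq[where p = p])
    (auto simp: proj_add distrib_left mult_single proj_single algebra_simps)

lemma proj_scale: "proj \<Lambda> n (scale c p) = scale c (proj \<Lambda> n p)"
  by (simp add: proj_single_mult)

definition of_degree :: "('a, 'k::finite) kgraph \<Rightarrow> int ^ 'k \<Rightarrow> ('a, 'f::field) free_elem \<Rightarrow> bool" where
  "of_degree \<Lambda> d p \<longleftrightarrow> (\<forall>w \<in> Poly_Mapping.keys p. word_degree \<Lambda> w = d)"

lemma proj_of_degree:
  assumes "of_degree \<Lambda> d p"
  shows "proj \<Lambda> n p = (if n = d then p else 0)"
proof (rule poly_mapping_eqI)
  fix w
  have "Poly_Mapping.lookup p w = 0 \<or> word_degree \<Lambda> w = d"
    using assms by (auto simp: of_degree_def in_keys_iff)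
  then show "Poly_Mapping.lookup (proj \<Lambda> n p) w = Poly_Mapping.lookup (if n = d then p else 0) w"
    by auto
qed

lemma of_degree_zero: "of_degree \<Lambda> d 0"
  by (simp add: of_degree_def)

lemma of_degree_diff: "\<lbrakk>of_degree \<Lambda> d p; of_degree \<Lambda> d q\<rbrakk> \<Longrightarrow> of_degree \<Lambda> d (p - q)"
  using keys_diff[of p q] unfolding of_degree_def by (meson Un_iff subsetD)

lemma of_degree_mult:
  assumes "of_degree \<Lambda> a p" "of_degree \<Lambda> b q" "a + b = d"
  shows "of_degree \<Lambda> d (p * q)"
  unfolding of_degree_def
proof (rule ballI)
  fix w assume "w \<in> Poly_Mapping.keys (p * q)"
  then obtain u v where "w = u + v" "u \<in> Poly_Mapping.keys p" "v \<in> Poly_Mapping.keys q"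
    using keys_mult[of p q] by blast
  then show "word_degree \<Lambda> w = d" using assms by (simp add: of_degree_def)
qed

lemma of_degree_sum: "(\<And>i. i \<in> I \<Longrightarrow> of_degree \<Lambda> d (f i)) \<Longrightarrow> of_degree \<Lambda> d (sum f I)"
  using keys_sum[of f I] unfolding of_degree_def by (meson UN_iff subsetD)

lemma of_degree_pth: "deg_diff (deg \<Lambda> \<mu>) 0 = d \<Longrightarrow> of_degree \<Lambda> d (pth \<mu>)"
  by (simp add: of_degree_def pth_def word_degree_def)

lemma of_degree_gst: "deg_diff 0 (deg \<Lambda> \<mu>) = d \<Longrightarrow> of_degree \<Lambda> d (gst \<mu>)"
  by (simp add: of_degree_def gst_def word_degree_def)

context k_graph
begin

text \<open>In (KP1), (KP3) and (KP4) every term has degree 0, as paths and ghost paths of equal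
  degree cancel; in (KP2) additivity of \<open>deg\<close> under composition gives both sides the
  same degree.\<close>

lemma relations_homogeneous:
  fixes r :: "('a, 'f::field) free_elem"
  shows "r \<in> kp_relations \<Lambda> \<Longrightarrow> \<exists>d. of_degree \<Lambda> d r"
proof (induction rule: kp_relations.induct)
  case (KP1_orth v w)
  have "of_degree \<Lambda> 0 (pth v :: ('a, 'f) free_elem)" "of_degree \<Lambda> 0 (pth w :: ('a, 'f) free_elem)"
    using KP1_orth by (simp_all add: of_degree_pth deg_id)
  then have "of_degree \<Lambda> 0 (pth v * pth w - (if v = w then pth v else 0) :: ('a, 'f) free_elem)"
    by (intro of_degree_diff of_degree_mult[of _ 0 _ 0]) (simp_all add: of_degree_zero)
  then show ?case by (rule exI)
next
  case (KP1_star v)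
  then have "of_degree \<Lambda> 0 (pth v - gst v)"
    by (intro of_degree_diff of_degree_pth of_degree_gst) (simp_all add: deg_id)
  then show ?case by (rule exI)
next
  case (KP2_path \<mu> \<nu>)
  then have "of_degree \<Lambda> (deg_diff (deg \<Lambda> \<mu> + deg \<Lambda> \<nu>) 0) (pth \<mu> * pth \<nu> - pth (cmp \<Lambda> \<mu> \<nu>))"
    by (intro of_degree_diff of_degree_mult[of _ "deg_diff (deg \<Lambda> \<mu>) 0" _ "deg_diff (deg \<Lambda> \<nu>) 0"]
      of_degree_pth of_degree_gst)
      (simp_all add: deg_cmp deg_diff_add[of _ _ 0 0, simplified])
  then show ?case by (rule exI)
next
  case (KP2_ghost \<mu> \<nu>)
  then have "of_degree \<Lambda> (deg_diff 0 (deg \<Lambda> \<nu> + deg \<Lambda> \<mu>)) (gst \<nu> * gst \<mu> - gst (cmp \<Lambda> \<mu> \<nu>))"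
    by (intro of_degree_diff of_degree_mult[of _ "deg_diff 0 (deg \<Lambda> \<nu>)" _ "deg_diff 0 (deg \<Lambda> \<mu>)"]
      of_degree_pth of_degree_gst)
      (simp_all add: deg_cmp deg_diff_add[of 0 0, simplified] add.commute)
  then show ?case by (rule exI)
next
  case (KP2_rng_path \<mu>)
  then have "of_degree \<Lambda> (deg_diff (deg \<Lambda> \<mu>) 0) (pth (rng \<Lambda> \<mu>) * pth \<mu> - pth \<mu>)"
    by (intro of_degree_diff of_degree_mult[of _ 0 _ "deg_diff (deg \<Lambda> \<mu>) 0"]
      of_degree_pth of_degree_gst) (simp_all add: deg_id rng_Obj)
  then show ?case by (rule exI)
next
  case (KP2_path_src \<mu>)
  then have "of_degree \<Lambda> (deg_diff (deg \<Lambda> \<mu>) 0) (pth \<mu> * pth (src \<Lambda> \<mu>) - pth \<mu>)"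
    by (intro of_degree_diff of_degree_mult[of _ "deg_diff (deg \<Lambda> \<mu>) 0" _ 0]
      of_degree_pth of_degree_gst) (simp_all add: deg_id src_Obj)
  then show ?case by (rule exI)
next
  case (KP2_src_ghost \<mu>)
  then have "of_degree \<Lambda> (deg_diff 0 (deg \<Lambda> \<mu>)) (pth (src \<Lambda> \<mu>) * gst \<mu> - gst \<mu>)"
    by (intro of_degree_diff of_degree_mult[of _ 0 _ "deg_diff 0 (deg \<Lambda> \<mu>)"]
      of_degree_pth of_degree_gst) (simp_all add: deg_id src_Obj)
  then show ?case by (rule exI)
next
  case (KP2_ghost_rng \<mu>)
  then have "of_degree \<Lambda> (deg_diff 0 (deg \<Lambda> \<mu>)) (gst \<mu> * pth (rng \<Lambda> \<mu>) - gst \<mu>)"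
    by (intro of_degree_diff of_degree_mult[of _ "deg_diff 0 (deg \<Lambda> \<mu>)" _ 0]
      of_degree_pth of_degree_gst) (simp_all add: deg_id rng_Obj)
  then show ?case by (rule exI)
next
  case (KP3 \<mu> \<nu>)
  have "of_degree \<Lambda> 0 (gst \<mu> * pth \<nu> - (if \<mu> = \<nu> then pth (src \<Lambda> \<mu>) else 0))"
  proof (intro of_degree_diff of_degree_mult of_degree_pth of_degree_gst refl)
    show "of_degree \<Lambda> 0 (if \<mu> = \<nu> then pth (src \<Lambda> \<mu>) else 0)"
      using KP3 by (simp add: deg_id src_Obj of_degree_pth of_degree_zero)
    show "deg_diff 0 (deg \<Lambda> \<mu>) + deg_diff (deg \<Lambda> \<nu>) 0 = 0"
      using KP3 by (simp add: deg_diff_add[symmetric])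
  qed simp_all
  then show ?case by (rule exI)
next
  case (KP4 v n)
  have "of_degree \<Lambda> 0 (pth v - (\<Sum>\<mu>\<in>paths_into \<Lambda> v n. pth \<mu> * gst \<mu>))"
  proof (intro of_degree_diff of_degree_sum of_degree_mult of_degree_gst refl)
    show "of_degree \<Lambda> 0 (pth v)" using KP4 by (intro of_degree_pth) (simp add: deg_id)
    fix \<mu>
    show "of_degree \<Lambda> (deg_diff (deg \<Lambda> \<mu>) 0) (pth \<mu>)" by (intro of_degree_pth refl)
    show "deg_diff (deg \<Lambda> \<mu>) 0 + deg_diff 0 (deg \<Lambda> \<mu>) = 0"
      by (simp add: deg_diff_add[symmetric])
  qed simp_all
  then show ?case by (rule exI)
qed

text \<open>The elements of the ideal all of whose homogeneous parts lie in it form a two-sided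
  ideal containing the relations, hence the whole ideal. Absorption is checked on monomials, which
  only shift degrees.\<close>

lemma KI_proj:
  fixes p :: "('a, 'f::field) free_elem"
  assumes "p \<in> KI"
  shows "proj \<Lambda> n p \<in> KI"
proof -
  define V :: "('a, 'f) free_elem set" where "V = {p \<in> KI. \<forall>n. proj \<Lambda> n p \<in> KI}"
  have VI: "p \<in> KI" "\<And>n. proj \<Lambda> n p \<in> KI" if "p \<in> V" for p
    using that by (simp_all add: V_def)
  have mult: "p * a \<in> V \<and> a * p \<in> V" if p: "p \<in> V" and a: "a \<in> FA" for p a
    using a
  proof (induction rule: free_induct)
    case zero
    then show ?case by (simp add: V_def)
  next
    case (add a b)
    then show ?case by (simp add: V_def distrib_left distrib_right proj_add KI_add)
  next
    case (single w c)
    then have "Poly_Mapping.single w c \<in> FA" by (simp add: free_carrier_iff)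
    then show ?case using VI[OF p] by (simp add: V_def proj_mult_single proj_single_mult KI_mult_left KI_mult_right)
  qed
  have "two_sided \<Lambda> V"
    unfolding two_sided_def
  proof (intro conjI ballI allI)
    show "V \<subseteq> FA" by (rule subsetI) (rule KI_free[OF VI(1)])
    show "0 \<in> V" by (simp add: V_def)
    show "p + q \<in> V" if "p \<in> V" "q \<in> V" for p q using that by (simp add: V_def proj_add KI_add)
    show "scale c p \<in> V" if "p \<in> V" for c p using that by (simp add: V_def proj_scale KI_scale)
    show "p * a \<in> V" "a * p \<in> V" if "p \<in> V" "a \<in> FA" for p a
      using mult[OF that] by simp_all
  qed
  moreover have "kp_relations \<Lambda> \<subseteq> V"
  proof
    fix r :: "('a, 'f) free_elem" assume r: "r \<in> kp_relations \<Lambda>"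
    obtain d where "of_degree \<Lambda> d r" using relations_homogeneous[OF r] by (elim exE)
    then show "r \<in> V" using subsetD[OF KI_relations r] by (simp add: V_def proj_of_degree)
  qed
  ultimately have "KI \<subseteq> V" by (rule KI_least)
  then show ?thesis using assms VI(2) by (meson subsetD)
qed

text \<open>A path is a generator in disguise: \<open>\<mu> = \<mu> s(\<mu>)*\<close>, since
  vertices equal their ghosts.\<close>

lemma pth_span:
  assumes "\<mu> \<in> Mor \<Lambda>"
  shows "pth \<mu> \<in> mspan (gens (deg_diff (deg \<Lambda> \<mu>) 0))"
proof -
  have "pth \<mu> * gst (src \<Lambda> \<mu>) \<in> mspan (gens (deg_diff (deg \<Lambda> \<mu>) 0))"
    using assms by (intro mspan_incl gensI) (simp_all add: src_Obj src_id deg_id)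
  moreover have "pth \<mu> * gst (src \<Lambda> \<mu>) \<doteq> pth \<mu>"
    using assms by (intro eqv_trans[OF eqv_mult_left[OF eqv_sym[OF rel_star]] rel_path_src]) (simp_all add: src_Obj)
  ultimately show ?thesis by (rule mspan_eqv)
qed

lemma gst_span:
  assumes "\<mu> \<in> Mor \<Lambda>"
  shows "gst \<mu> \<in> mspan (gens (deg_diff 0 (deg \<Lambda> \<mu>)))"
proof -
  have "pth (src \<Lambda> \<mu>) * gst \<mu> \<in> mspan (gens (deg_diff 0 (deg \<Lambda> \<mu>)))"
    using assms by (intro mspan_incl gensI) (simp_all add: src_Obj src_id deg_id)
  then show ?thesis using rel_src_ghost[OF assms] by (rule mspan_eqv)
qed

lemma letter_span:
  "x \<in> Path ` Mor \<Lambda> \<union> Ghost ` Mor \<Lambda> \<Longrightarrow>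
    Poly_Mapping.single (Word [x]) 1 \<in> mspan (gens (letter_degree \<Lambda> x))"
  by (elim UnE imageE) (simp_all add: pth_span[unfolded pth_def] gst_span[unfolded gst_def])

text \<open>Letters lie in the span of their own degree, and spans multiply according to degrees.
  The induction starts at single letters because the empty word is excluded.\<close>

lemma word_span:
  fixes c :: "'f::field"
  assumes "letters w \<noteq> []" "set (letters w) \<subseteq> Path ` Mor \<Lambda> \<union> Ghost ` Mor \<Lambda>"
  shows "Poly_Mapping.single w c \<in> mspan (gens (word_degree \<Lambda> w))"
proof -
  have "Poly_Mapping.single (Word xs) (1 :: 'f) \<in> mspan (gens (sum_list (map (letter_degree \<Lambda>) xs)))"
    if "xs \<noteq> []" "set xs \<subseteq> Path ` Mor \<Lambda> \<union> Ghost ` Mor \<Lambda>" for xs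
    using that
  proof (induction xs rule: list_nonempty_induct)
    case (single x)
    then show ?case using letter_span[of x] by simp
  next
    case (cons x xs)
    have "Word (x # xs) = Word [x] + Word xs" by (simp add: plus_word_def)
    then have "Poly_Mapping.single (Word (x # xs)) (1 :: 'f) =
        Poly_Mapping.single (Word [x]) (1 :: 'f) * Poly_Mapping.single (Word xs) (1 :: 'f)"
      by (simp add: mult_single)
    then show ?case using span_mult[OF letter_span[of x] cons.IH] cons.prems by simp
  qed
  then have "Poly_Mapping.single w (1 :: 'f) \<in> mspan (gens (word_degree \<Lambda> w))"
    using assms by (cases w) (simp add: word_degree_def)
  then have "scale c (Poly_Mapping.single w (1 :: 'f)) \<in> mspan (gens (word_degree \<Lambda> w))" by (rule mspan_scale)
  then show ?thesis by (simp add: mult_single)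
qed

lemma proj_span:
  "p \<in> FA \<Longrightarrow> proj \<Lambda> n p \<in> mspan (gens n)"
proof (induction rule: free_induct)
  case zero
  then show ?case by simp
next
  case (add p q)
  then show ?case by (simp add: proj_add mspan_add)
next
  case (single w c)
  have "Poly_Mapping.single w c \<in> mspan (gens (word_degree \<Lambda> w))" using single by (rule word_span)
  then show ?case by (auto simp: proj_single)
qed

text \<open>This is the source of directness: on the span of degree \<open>m\<close> the projections
  act, modulo the ideal, as the identity in degree \<open>m\<close> and as zero in all
  others.\<close>

lemma span_proj:
  "p \<in> mspan (gens m) \<Longrightarrow> proj \<Lambda> n p \<doteq> (if n = m then p else 0)"
proof (induction rule: mspan.induct)
  case (mspan_KI p)
  then show ?case using KI_proj[of p] by (simp add: eqv_def KI_diff)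
next
  case (mspan_step p s c)
  obtain \<mu> \<nu> where s: "s = pth \<mu> * gst \<nu>" "\<mu> \<in> Mor \<Lambda>" "\<nu> \<in> Mor \<Lambda>" "src \<Lambda> \<mu> = src \<Lambda> \<nu>"
    "deg_diff (deg \<Lambda> \<mu>) (deg \<Lambda> \<nu>) = m" using mspan_step(2) by (rule gensE)
  have "of_degree \<Lambda> m s"
    unfolding s(1) using deg_diff_add[of "deg \<Lambda> \<mu>" 0 0 "deg \<Lambda> \<nu>"] s(5)
    by (intro of_degree_mult[of _ "deg_diff (deg \<Lambda> \<mu>) 0" _ "deg_diff 0 (deg \<Lambda> \<nu>)"]
      of_degree_pth of_degree_gst) simp_all
  then have "proj \<Lambda> n (scale c s) = (if n = m then scale c s else 0)"
    by (simp add: proj_scale proj_of_degree)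
  then show ?case using eqv_add[OF mspan_step(3) eqv_refl, of "proj \<Lambda> n (scale c s)"]
    by (simp add: proj_add split: if_splits)
qed

lemma eqv_proj: "p \<doteq> q \<Longrightarrow> proj \<Lambda> n p \<doteq> proj \<Lambda> n q"
  using KI_proj[of "p - q"] by (simp add: eqv_def proj_diff)

section \<open>Transfer from representatives to cosets\<close>

definition cls :: "('a, 'f::field) free_elem \<Rightarrow> ('a, 'f) kp_elem" where
  "cls p = KI +>\<^bsub>free_algebra \<Lambda>\<^esub> p"

lemma cls_eq: "cls p = {x. x \<doteq> p}"
proof -
  have "x \<in> cls p \<longleftrightarrow> x - p \<in> KI" for x
  proof -
    have "x \<in> cls p \<longleftrightarrow> (\<exists>k\<in>KI. x = k + p)" by (simp add: cls_def a_r_coset_def r_coset_def)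
    also have "\<dots> \<longleftrightarrow> x - p \<in> KI"
      by (metis add_diff_cancel diff_add_cancel)
    finally show ?thesis .
  qed
  then show ?thesis by (auto simp: eqv_def)
qed

lemma cls_eq_iff: "cls p = cls q \<longleftrightarrow> p \<doteq> q"
proof
  assume "cls p = cls q"
  moreover have "p \<in> cls p" by (simp add: cls_eq)
  ultimately show "p \<doteq> q" by (simp add: cls_eq)
next
  assume e: "p \<doteq> q"
  have "x \<doteq> p \<longleftrightarrow> x \<doteq> q" for x
    using eqv_trans[OF _ e, of x] eqv_trans[OF _ eqv_sym[OF e], of x] by (rule iffI)
  then show "cls p = cls q" by (simp add: cls_eq)
qed

lemma KP_record:
  "carrier (KP \<Lambda>) = a_rcosets\<^bsub>free_algebra \<Lambda>\<^esub> KI" "\<zero>\<^bsub>KP \<Lambda>\<^esub> = KI"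
  "monoid.mult (KP \<Lambda>) = rcoset_mult (free_algebra \<Lambda>) KI" "ring.add (KP \<Lambda>) = set_add (free_algebra \<Lambda>)"
  "smult (KP \<Lambda>) = (\<lambda>c C. \<Union>x\<in>C. cls (scale c x))"
  by (simp_all add: KP_def FactRing_def ring.defs module.defs cls_def)

lemma KP_carrier: "carrier (KP \<Lambda>) = cls ` FA"
  unfolding KP_record(1) A_RCOSETS_def RCOSETS_def cls_def a_r_coset_def by (simp add: image_def) blast

lemma cls_closed [simp]: "p \<in> FA \<Longrightarrow> cls p \<in> carrier (KP \<Lambda>)"
  by (simp add: KP_carrier)

lemma KP_E:
  assumes "x \<in> carrier (KP \<Lambda>)"
  obtains p where "x = cls p" "p \<in> FA"
  using assms unfolding KP_carrier by (rule imageE)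

lemma KP_zero: "\<zero>\<^bsub>KP \<Lambda>\<^esub> = cls 0"
  by (simp add: KP_record cls_eq eqv_def)

lemma KP_add: "cls p \<oplus>\<^bsub>KP \<Lambda>\<^esub> cls q = cls (p + q)"
proof -
  have mem: "x \<in> cls p \<oplus>\<^bsub>KP \<Lambda>\<^esub> cls q \<longleftrightarrow> x \<doteq> p + q" for x
  proof -
    have "x \<in> cls p \<oplus>\<^bsub>KP \<Lambda>\<^esub> cls q \<longleftrightarrow> (\<exists>u v. u \<doteq> p \<and> v \<doteq> q \<and> x = u + v)"
      by (auto simp: KP_record set_add_def set_mult_def cls_eq)
    also have "\<dots> \<longleftrightarrow> x \<doteq> p + q"
    proof
      assume "\<exists>u v. u \<doteq> p \<and> v \<doteq> q \<and> x = u + v"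
      then show "x \<doteq> p + q" by (elim exE conjE) (simp add: eqv_add)
    next
      assume "x \<doteq> p + q"
      then have "x - q \<doteq> p" by (simp add: eqv_def algebra_simps)
      then show "\<exists>u v. u \<doteq> p \<and> v \<doteq> q \<and> x = u + v"
        by (intro exI[of _ "x - q"] exI[of _ q]) simp
    qed
    finally show ?thesis .
  qed
  show ?thesis by (rule Set.set_eqI) (simp only: mem cls_eq[of "p + q"] mem_Collect_eq)
qed

lemma KP_mult:
  assumes "p \<in> FA" "q \<in> FA"
  shows "cls p \<otimes>\<^bsub>KP \<Lambda>\<^esub> cls q = cls (p * q)"
proof -
  \<comment> \<open>The ideal lies in the free algebra, so all members of a coset do once one does;
    this licenses multiplying arbitrary representatives.\<close>
  have F: "u \<in> FA" if "u \<doteq> v" "v \<in> FA" for u v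
    using free_add[OF KI_free[of "u - v"] that(2)] that(1) by (simp add: eqv_def)
  have c: "cls (u * v) = cls (p * q)" if "u \<in> cls p" "v \<in> cls q" for u v
    using that assms F[of v q] unfolding cls_eq_iff by (intro eqv_mult) (simp_all add: cls_eq)
  have "p \<in> cls p" "q \<in> cls q" by (simp_all add: cls_eq)
  then have ne: "cls p \<noteq> {}" "cls q \<noteq> {}" by (metis empty_iff)+
  have "cls p \<otimes>\<^bsub>KP \<Lambda>\<^esub> cls q = (\<Union>u\<in>cls p. \<Union>v\<in>cls q. cls (u * v))"
    by (simp add: KP_record rcoset_mult_def cls_def)
  also have "\<dots> = (\<Union>u\<in>cls p. cls (p * q))"
    by (intro SUP_cong refl SUP_eq_const[OF ne(2)] c)
  also have "\<dots> = cls (p * q)" by (rule SUP_eq_const[OF ne(1) refl])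
  finally show ?thesis .
qed

lemma KP_smult: "c \<odot>\<^bsub>KP \<Lambda>\<^esub> cls p = cls (scale c p)"
proof -
  have "p \<in> cls p" by (simp add: cls_eq)
  then have "cls p \<noteq> {}" by (metis empty_iff)
  then have "(\<Union>x\<in>cls p. cls (scale c x)) = cls (scale c p)"
    by (rule SUP_eq_const) (simp add: cls_eq_iff eqv_scale cls_eq[of p])
  then show ?thesis by (simp add: KP_record)
qed

lemma KP_ring: "nonunital_ring (KP \<Lambda> :: ('f::field, ('a, 'f) kp_elem) module)"
proof (intro nonunital_ring.intro nonunital_ring_axioms.intro)
  show "abelian_group (KP \<Lambda> :: ('f, ('a, 'f) kp_elem) module)"
  proof (rule abelian_groupI)
    fix x y :: "('a, 'f) kp_elem" assume x: "x \<in> carrier (KP \<Lambda>)" and y: "y \<in> carrier (KP \<Lambda>)"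
    obtain p where p: "x = cls p" "p \<in> FA" using x by (rule KP_E)
    obtain q where q: "y = cls q" "q \<in> FA" using y by (rule KP_E)
    show "x \<oplus>\<^bsub>KP \<Lambda>\<^esub> y \<in> carrier (KP \<Lambda>)" using p q by (simp add: KP_add)
    show "x \<oplus>\<^bsub>KP \<Lambda>\<^esub> y = y \<oplus>\<^bsub>KP \<Lambda>\<^esub> x" by (simp add: p q KP_add add.commute)
    show "\<zero>\<^bsub>KP \<Lambda>\<^esub> \<oplus>\<^bsub>KP \<Lambda>\<^esub> x = x" by (simp add: p KP_add KP_zero)
    show "\<exists>y\<in>carrier (KP \<Lambda>). y \<oplus>\<^bsub>KP \<Lambda>\<^esub> x = \<zero>\<^bsub>KP \<Lambda>\<^esub>"
      using p by (intro bexI[of _ "cls (- p)"]) (simp_all add: KP_add KP_zero)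
    fix z :: "('a, 'f) kp_elem" assume z: "z \<in> carrier (KP \<Lambda>)"
    obtain r where r: "z = cls r" "r \<in> FA" using z by (rule KP_E)
    show "x \<oplus>\<^bsub>KP \<Lambda>\<^esub> y \<oplus>\<^bsub>KP \<Lambda>\<^esub> z = x \<oplus>\<^bsub>KP \<Lambda>\<^esub> (y \<oplus>\<^bsub>KP \<Lambda>\<^esub> z)"
      by (simp add: p q r KP_add add.assoc)
  qed (simp add: KP_zero)
  fix x y :: "('a, 'f) kp_elem" assume x: "x \<in> carrier (KP \<Lambda>)" and y: "y \<in> carrier (KP \<Lambda>)"
  obtain p where p: "x = cls p" "p \<in> FA" using x by (rule KP_E)
  obtain q where q: "y = cls q" "q \<in> FA" using y by (rule KP_E)
  show "x \<otimes>\<^bsub>KP \<Lambda>\<^esub> y \<in> carrier (KP \<Lambda>)" using p q by (simp add: KP_mult)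
  fix z :: "('a, 'f) kp_elem" assume z: "z \<in> carrier (KP \<Lambda>)"
  obtain r where r: "z = cls r" "r \<in> FA" using z by (rule KP_E)
  show "x \<otimes>\<^bsub>KP \<Lambda>\<^esub> y \<otimes>\<^bsub>KP \<Lambda>\<^esub> z = x \<otimes>\<^bsub>KP \<Lambda>\<^esub> (y \<otimes>\<^bsub>KP \<Lambda>\<^esub> z)"
    using p q r by (simp add: KP_mult mult.assoc)
  show "(x \<oplus>\<^bsub>KP \<Lambda>\<^esub> y) \<otimes>\<^bsub>KP \<Lambda>\<^esub> z = x \<otimes>\<^bsub>KP \<Lambda>\<^esub> z \<oplus>\<^bsub>KP \<Lambda>\<^esub> y \<otimes>\<^bsub>KP \<Lambda>\<^esub> z"
    using p q r by (simp add: KP_mult KP_add distrib_right)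
  show "z \<otimes>\<^bsub>KP \<Lambda>\<^esub> (x \<oplus>\<^bsub>KP \<Lambda>\<^esub> y) = z \<otimes>\<^bsub>KP \<Lambda>\<^esub> x \<oplus>\<^bsub>KP \<Lambda>\<^esub> z \<otimes>\<^bsub>KP \<Lambda>\<^esub> y"
    using p q r by (simp add: KP_mult KP_add distrib_left)
qed

lemma KP_abelian_group: "abelian_group (KP \<Lambda> :: ('f::field, ('a, 'f) kp_elem) module)"
  using KP_ring by (rule nonunital_ring.axioms)

lemma KP_minus: "p \<in> FA \<Longrightarrow> \<ominus>\<^bsub>KP \<Lambda>\<^esub> cls p = cls (- p)"
  using abelian_group.minus_equality[OF KP_abelian_group, of "cls (- p)" "cls p"]
  by (simp add: KP_add KP_zero)

lemma cls_span_subgroup: "additive_subgroup (cls ` mspan (gens n) :: ('a, 'f::field) kp_elem set) (KP \<Lambda>)"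
  unfolding subgroup_add_monoid_iff[OF KP_abelian_group]
proof (intro conjI ballI)
  show "cls ` mspan (gens n) \<subseteq> carrier (KP \<Lambda>)"
    by (intro image_subsetI cls_closed) (rule mspan_free[OF _ gens_free])
  show "\<zero>\<^bsub>KP \<Lambda>\<^esub> \<in> cls ` mspan (gens n)" unfolding KP_zero by (intro imageI mspan_zero)
  fix x :: "('a, 'f) kp_elem" assume "x \<in> cls ` mspan (gens n)"
  then obtain p where p: "x = cls p" "p \<in> mspan (gens n)" by (rule imageE)
  have "\<ominus>\<^bsub>KP \<Lambda>\<^esub> x = cls (- p)" using p mspan_free[OF p(2) gens_free] by (simp add: KP_minus)
  then show "\<ominus>\<^bsub>KP \<Lambda>\<^esub> x \<in> cls ` mspan (gens n)" using mspan_uminus[OF p(2)] by simp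
  fix y :: "('a, 'f) kp_elem" assume "y \<in> cls ` mspan (gens n)"
  then obtain q where q: "y = cls q" "q \<in> mspan (gens n)" by (rule imageE)
  show "x \<oplus>\<^bsub>KP \<Lambda>\<^esub> y \<in> cls ` mspan (gens n)"
    unfolding p(1) q(1) KP_add using mspan_add[OF q(2) p(2)] by (rule imageI)
qed

lemma KP_gens:
  "{kp_path \<Lambda> \<mu> \<otimes>\<^bsub>KP \<Lambda>\<^esub> kp_ghost \<Lambda> \<nu> | \<mu> \<nu>.
      \<mu> \<in> Mor \<Lambda> \<and> \<nu> \<in> Mor \<Lambda> \<and> src \<Lambda> \<mu> = src \<Lambda> \<nu> \<and> deg_diff (deg \<Lambda> \<mu>) (deg \<Lambda> \<nu>) = n}
    = (cls ` gens n :: ('a, 'f::field) kp_elem set)"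
proof -
  have "kp_path \<Lambda> \<mu> \<otimes>\<^bsub>KP \<Lambda>\<^esub> kp_ghost \<Lambda> \<nu> = (cls (pth \<mu> * gst \<nu>) :: ('a, 'f) kp_elem)"
    if "\<mu> \<in> Mor \<Lambda>" "\<nu> \<in> Mor \<Lambda>" for \<mu> \<nu>
    using KP_mult[of "pth \<mu>" "gst \<nu>"] that by (simp add: kp_path_def kp_ghost_def cls_def)
  then show ?thesis unfolding gens_def by (simp add: image_def set_eq_iff) metis
qed

text \<open>The span as an intersection is matched with the inductive one: the classes of
  \<open>mspan (gens n)\<close> form one of the sets intersected, and induction over
  \<open>mspan\<close> puts them into each of the others.\<close>

lemma KP_component_eq:
  "KP_component \<Lambda> n = (cls ` mspan (gens n) :: ('a, 'f::field) kp_elem set)"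
proof
  have "scalar_closed (KP \<Lambda>) (cls ` mspan (gens n) :: ('a, 'f) kp_elem set)"
    unfolding scalar_closed_def
  proof (intro allI ballI)
    fix c and x :: "('a, 'f) kp_elem" assume "x \<in> cls ` mspan (gens n)"
    then obtain p where p: "x = cls p" "p \<in> mspan (gens n)" by (rule imageE)
    show "c \<odot>\<^bsub>KP \<Lambda>\<^esub> x \<in> cls ` mspan (gens n)"
      unfolding p(1) KP_smult using mspan_scale[OF p(2)] by (rule imageI)
  qed
  moreover have "cls ` gens n \<subseteq> (cls ` mspan (gens n) :: ('a, 'f) kp_elem set)"
    by (intro image_mono subsetI mspan_incl)
  ultimately show "KP_component \<Lambda> n \<subseteq> (cls ` mspan (gens n) :: ('a, 'f) kp_elem set)"
    unfolding KP_component_def linear_span_def KP_gens 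
    by (intro Inter_lower CollectI conjI cls_span_subgroup)
  show "(cls ` mspan (gens n) :: ('a, 'f) kp_elem set) \<subseteq> KP_component \<Lambda> n"
    unfolding KP_component_def linear_span_def KP_gens
  proof (intro Inter_greatest image_subsetI)
    fix V :: "('a, 'f) kp_elem set" and p :: "('a, 'f) free_elem"
    assume "V \<in> {V. additive_subgroup V (KP \<Lambda>) \<and> scalar_closed (KP \<Lambda>) V \<and> cls ` gens n \<subseteq> V}"
    then have V: "additive_subgroup V (KP \<Lambda>)" "scalar_closed (KP \<Lambda>) V" "cls ` gens n \<subseteq> V" by simp_all
    note V1 = V(1)[unfolded subgroup_add_monoid_iff[OF KP_abelian_group]]
    assume "p \<in> mspan (gens n)"
    then show "cls p \<in> V"
    proof (induction rule: mspan.induct)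
      case (mspan_KI p)
      then have "cls p = \<zero>\<^bsub>KP \<Lambda>\<^esub>" by (simp add: KP_zero cls_eq_iff eqv_def)
      then show ?case using V1 by simp
    next
      case (mspan_step p s c)
      have "cls s \<in> V" using V(3) mspan_step(2) by (rule image_subset_iff[THEN iffD1, rule_format])
      then have "cls (scale c s) \<in> V" using V(2) by (simp add: scalar_closed_def flip: KP_smult)
      then show ?case using V1 mspan_step(3) by (simp flip: KP_add)
    qed
  qed
qed

text \<open>The choice of representative is harmless, because \<open>proj\<close> respects
  congruence modulo the ideal.\<close>

definition KP_proj :: "int ^ 'k \<Rightarrow> ('a, 'f::field) kp_elem \<Rightarrow> ('a, 'f) kp_elem" where
  "KP_proj n C = cls (proj \<Lambda> n (SOME p. p \<in> C))"

lemma KP_proj_cls: "KP_proj n (cls p) = cls (proj \<Lambda> n p)"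
proof -
  have "p \<in> cls p" by (simp add: cls_eq)
  then have "(SOME q. q \<in> cls p) \<in> cls p" by (rule someI)
  then show ?thesis by (simp add: KP_proj_def cls_eq_iff cls_eq[of p] eqv_proj)
qed

theorem KP_graded_regular:
  "graded_regular_ring (KP \<Lambda> :: ('f::field, ('a, 'f) kp_elem) module) (KP_component \<Lambda>) KP_proj"
proof (intro graded_regular_ring.intro graded_regular_ring_axioms.intro KP_ring)
  fix n m :: "int ^ 'k"
  show "additive_subgroup (KP_component \<Lambda> n) (KP \<Lambda> :: ('f, ('a, 'f) kp_elem) module)"
    unfolding KP_component_eq by (rule cls_span_subgroup)
  fix x y :: "('a, 'f) kp_elem"
  show "KP_proj n x \<in> KP_component \<Lambda> n" if x: "x \<in> carrier (KP \<Lambda>)"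
  proof -
    obtain p where p: "x = cls p" "p \<in> FA" using x by (rule KP_E)
    show ?thesis unfolding p(1) KP_proj_cls KP_component_eq using proj_span[OF p(2)] by (rule imageI)
  qed
  show "KP_proj n (x \<oplus>\<^bsub>KP \<Lambda>\<^esub> y) = KP_proj n x \<oplus>\<^bsub>KP \<Lambda>\<^esub> KP_proj n y"
    if x: "x \<in> carrier (KP \<Lambda>)" and y: "y \<in> carrier (KP \<Lambda>)"
  proof -
    obtain p where p: "x = cls p" using x by (rule KP_E)
    obtain q where q: "y = cls q" using y by (rule KP_E)
    show ?thesis by (simp add: p q KP_add KP_proj_cls proj_add)
  qed
  show "KP_proj n x = (if n = m then x else \<zero>\<^bsub>KP \<Lambda>\<^esub>)" if x: "x \<in> KP_component \<Lambda> m"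
  proof -
    obtain p where p: "x = cls p" "p \<in> mspan (gens m)" using x unfolding KP_component_eq by (rule imageE)
    have "cls (proj \<Lambda> n p) = cls (if n = m then p else 0)"
      using span_proj[OF p(2), of n] by (simp add: cls_eq_iff)
    then show ?thesis by (simp add: p(1) KP_proj_cls KP_zero split: if_splits)
  qed
  show "x \<otimes>\<^bsub>KP \<Lambda>\<^esub> y \<in> KP_component \<Lambda> (m + n)"
    if x: "x \<in> KP_component \<Lambda> m" and y: "y \<in> KP_component \<Lambda> n"
  proof -
    obtain p where p: "x = cls p" "p \<in> mspan (gens m)" using x unfolding KP_component_eq by (rule imageE)
    obtain q where q: "y = cls q" "q \<in> mspan (gens n)" using y unfolding KP_component_eq by (rule imageE)
    have "x \<otimes>\<^bsub>KP \<Lambda>\<^esub> y = cls (p * q)"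
      using p q mspan_free[OF p(2) gens_free] mspan_free[OF q(2) gens_free] by (simp add: KP_mult)
    then show ?thesis unfolding KP_component_eq using span_mult[OF p(2) q(2)] by simp
  qed
  show "\<exists>y\<in>KP_component \<Lambda> (- n). x \<otimes>\<^bsub>KP \<Lambda>\<^esub> y \<otimes>\<^bsub>KP \<Lambda>\<^esub> x = x" if x: "x \<in> KP_component \<Lambda> n"
  proof -
    obtain p where p: "x = cls p" "p \<in> mspan (gens n)" using x unfolding KP_component_eq by (rule imageE)
    obtain q where q: "q \<in> mspan (gens (- n))" "p \<doteq> p * q * p" using span_regular[OF p(2)] by (rule bexE)
    have "x \<otimes>\<^bsub>KP \<Lambda>\<^esub> cls q \<otimes>\<^bsub>KP \<Lambda>\<^esub> x = cls (p * q * p)"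
      using p mspan_free[OF p(2) gens_free] mspan_free[OF q(1) gens_free] by (simp add: KP_mult)
    also have "\<dots> = x" using eqv_sym[OF q(2)] by (simp add: p cls_eq_iff)
    finally show ?thesis unfolding KP_component_eq using q(1) by (intro bexI[of _ "cls q"] imageI)
  qed
next
  let ?H = "\<Union>n. KP_component \<Lambda> n" and ?A = "add_monoid (KP \<Lambda> :: ('f, ('a, 'f) kp_elem) module)"
  show "carrier (KP \<Lambda>) \<subseteq> generate ?A ?H"
  proof
    fix x :: "('a, 'f) kp_elem" assume "x \<in> carrier (KP \<Lambda>)"
    then obtain p where p: "x = cls p" "p \<in> FA" by (rule KP_E)
    have "cls p \<in> generate ?A ?H"
      using p(2)
    proof (induction rule: free_induct)
      case zero
      then show ?case using generate.one[of ?A ?H] by (simp add: KP_zero)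
    next
      case (add p q)
      then show ?case using generate.eng[OF add(3,4)] by (simp add: KP_add)
    next
      case (single w c)
      then have "cls (Poly_Mapping.single w c) \<in> KP_component \<Lambda> (word_degree \<Lambda> w)"
        unfolding KP_component_eq by (intro imageI word_span)
      then show ?case by (intro generate.incl UN_I) simp_all
    qed
    then show "x \<in> generate ?A ?H" unfolding p(1) .
  qed
qed

end

text \<open>An injection \<open>f\<close> of the index type into the naturals orders the
  coordinates, and a vector counts as positive if its first nonzero coordinate is positive.\<close>

lemma lexicographic_positive_cone:
  "\<exists>pos :: int ^ 'k::finite \<Rightarrow> bool. (\<forall>m n. pos m \<longrightarrow> pos n \<longrightarrow> pos (m + n)) \<and>
     (\<forall>m. m \<noteq> 0 \<longrightarrow> pos m \<or> pos (- m)) \<and> \<not> pos 0"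
proof -
  obtain f :: "'k \<Rightarrow> nat" where f: "inj f" using finite_imp_inj_to_nat_seg[of "UNIV :: 'k set"] by auto
  define pos :: "int ^ 'k \<Rightarrow> bool" where
    "pos m \<longleftrightarrow> (\<exists>i. m $ i > 0 \<and> (\<forall>j. f j < f i \<longrightarrow> m $ j = 0))" for m
  have "pos (m + n)" if "pos m" "pos n" for m n
  proof -
    obtain i where i: "m $ i > 0" "\<And>j. f j < f i \<Longrightarrow> m $ j = 0" using \<open>pos m\<close> unfolding pos_def by blast
    obtain i' where i': "n $ i' > 0" "\<And>j. f j < f i' \<Longrightarrow> n $ j = 0" using \<open>pos n\<close> unfolding pos_def by blast
    \<comment> \<open>The leading coordinate of the sum is the earlier of the two leading
      coordinates, where the other vector contributes zero unless both positions coincide.\<close>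
    consider "f i < f i'" | "f i' < f i" | "i = i'" using f by (metis injD linorder_neqE_nat)
    then show ?thesis
    proof cases
      case 1
      then show ?thesis unfolding pos_def using i i' by (intro exI[of _ i]) simp
    next
      case 2
      then show ?thesis unfolding pos_def using i i' by (intro exI[of _ i']) simp
    next
      case 3
      then show ?thesis unfolding pos_def using i i' by (intro exI[of _ i]) simp
    qed
  qed
  moreover have "pos m \<or> pos (- m)" if m: "m \<noteq> 0" for m
  proof -
    obtain i0 where "m $ i0 \<noteq> 0" using m by (auto simp: vec_eq_iff)
    then obtain i where i: "m $ i \<noteq> 0" "\<And>j. m $ j \<noteq> 0 \<Longrightarrow> f i \<le> f j"
      using ex_has_least_nat[of "\<lambda>i. m $ i \<noteq> 0" i0 f] by blast
    then have "\<forall>j. f j < f i \<longrightarrow> m $ j = 0" by (metis not_less)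
    then show ?thesis using i(1) unfolding pos_def by (cases "m $ i > 0") (auto intro!: exI[of _ i])
  qed
  moreover have "\<not> pos 0" by (simp add: pos_def)
  ultimately show ?thesis by (intro exI[of _ pos]) simp
qed

theorem theorem6p5:
  fixes \<Lambda> :: "('a, 'k::finite) kgraph"
    and A :: "('f::field, ('a, 'f) kp_elem) module"
    and G :: "int ^ 'k \<Rightarrow> ('a, 'f) kp_elem set"
    and A\<^sub>0 :: "('f, ('a, 'f) kp_elem) module"
  assumes "k_graph \<Lambda>" and "row_finite \<Lambda>" and "no_sources \<Lambda>"
    and "A = KP \<Lambda>" and "G = KP_component \<Lambda>" and "A\<^sub>0 = A\<lparr>carrier := G 0\<rparr>"
  shows
    "(\<forall>I. graded_right_ideal A G I \<and> (\<exists>S. finite S \<and> S \<subseteq> carrier A \<and> I = right_ideal_gen A S)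
        \<longrightarrow> (\<exists>e \<in> homogeneous G. e \<otimes>\<^bsub>A\<^esub> e = e \<and> I = right_ideal_gen A {e})) \<and>
     (\<forall>I. graded_left_ideal A G I \<and> (\<exists>S. finite S \<and> S \<subseteq> carrier A \<and> I = left_ideal_gen A S)
        \<longrightarrow> (\<exists>e \<in> homogeneous G. e \<otimes>\<^bsub>A\<^esub> e = e \<and> I = left_ideal_gen A {e})) \<and>
     (\<forall>I. graded_right_ideal A G I \<longrightarrow> I \<cdot>\<^bsub>A\<^esub> I = I) \<and>
     (\<forall>I. graded_left_ideal A G I \<longrightarrow> I \<cdot>\<^bsub>A\<^esub> I = I) \<and>
     (\<forall>I. graded_ideal A G I \<longrightarrow> graded_semiprime A G I) \<and>
     jacobson_radical A = graded_jacobson_radical A G \<and>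
     graded_jacobson_radical A G = {\<zero>\<^bsub>A\<^esub>} \<and>
     bij_betw (\<lambda>I. I \<inter> carrier A\<^sub>0) {I. graded_right_ideal A G I} {B. right_ideal A\<^sub>0 B} \<and>
     bij_betw (\<lambda>I. I \<inter> carrier A\<^sub>0) {I. graded_left_ideal A G I} {B. left_ideal A\<^sub>0 B}"
proof -
  interpret A: graded_regular_ring A G "k_graph.KP_proj \<Lambda>"
    unfolding assms(4,5) by (rule k_graph.KP_graded_regular[OF assms(1)])
  obtain pos :: "int ^ 'k \<Rightarrow> bool" where pos: "\<And>m n. pos m \<Longrightarrow> pos n \<Longrightarrow> pos (m + n)"
    "\<And>m. m \<noteq> 0 \<Longrightarrow> pos m \<or> pos (- m)" "\<not> pos 0"
    using lexicographic_positive_cone by metis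
  have J: "jacobson_radical A = {\<zero>\<^bsub>A\<^esub>}"
    by (rule A.jacobson_radical_zero[of pos]) (fact pos)+
  have G0: "e \<in> homogeneous G" if "e \<in> G 0" for e
    using that unfolding homogeneous_def by (rule UN_I[OF UNIV_I])
  have c0: "carrier A\<^sub>0 = G 0" by (simp add: assms(6))
  show ?thesis
    \<comment> \<open>Both radicals have been computed to be zero, so their equality becomes
      reflexivity.\<close>
    unfolding c0 J A.graded_jacobson_radical_zero
  proof (intro conjI allI impI refl)
    fix I assume "graded_right_ideal A G I \<and> (\<exists>S. finite S \<and> S \<subseteq> carrier A \<and> I = right_ideal_gen A S)"
    then obtain S where "graded_right_ideal A G I" "finite S" "S \<subseteq> carrier A" "I = right_ideal_gen A S"
      by (elim conjE exE)
    then have "\<exists>e\<in>G 0. e \<otimes>\<^bsub>A\<^esub> e = e \<and> I = right_ideal_gen A {e}"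
      by (rule A.fg_graded_right_ideal)
    then show "\<exists>e \<in> homogeneous G. e \<otimes>\<^bsub>A\<^esub> e = e \<and> I = right_ideal_gen A {e}"
      using G0 by (elim bexE) (rule bexI)
  next
    fix I assume "graded_left_ideal A G I \<and> (\<exists>S. finite S \<and> S \<subseteq> carrier A \<and> I = left_ideal_gen A S)"
    then obtain S where "graded_left_ideal A G I" "finite S" "S \<subseteq> carrier A" "I = left_ideal_gen A S"
      by (elim conjE exE)
    then have "\<exists>e\<in>G 0. e \<otimes>\<^bsub>A\<^esub> e = e \<and> I = left_ideal_gen A {e}"
      by (rule A.fg_graded_left_ideal)
    then show "\<exists>e \<in> homogeneous G. e \<otimes>\<^bsub>A\<^esub> e = e \<and> I = left_ideal_gen A {e}"
      using G0 by (elim bexE) (rule bexI)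
  next
    fix I assume "graded_right_ideal A G I"
    then show "I \<cdot>\<^bsub>A\<^esub> I = I" by (rule A.graded_right_ideal_idempotent)
  next
    fix I assume "graded_left_ideal A G I"
    then show "I \<cdot>\<^bsub>A\<^esub> I = I" by (rule A.graded_left_ideal_idempotent)
  next
    fix I assume "graded_ideal A G I"
    then show "graded_semiprime A G I" by (rule A.graded_ideal_semiprime)
  next
    show "bij_betw (\<lambda>I. I \<inter> G 0) {I. graded_right_ideal A G I} {B. right_ideal A\<^sub>0 B}"
      unfolding assms(6) by (rule A.graded_right_ideal_correspondence)
    show "bij_betw (\<lambda>I. I \<inter> G 0) {I. graded_left_ideal A G I} {B. left_ideal A\<^sub>0 B}"
      unfolding assms(6) by (rule A.graded_left_ideal_correspondence)
  qed
qed

end
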